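(* Let $N$ be a compact space form (a Riemannian manifold of constant sectional curvature) and let $\phi:S^2\to N$ be a harmonic map from the $2$-sphere. Then any Jacobi field $v$ along $\phi$ preserves real isotropy to first order, i.e. $j^{\mathbf R}_{r,s}(v)=0$ for all integers $r,s\ge 1$ and all local complex coordinates on $S^2$; equivalently, any smooth variation $\{\phi_t\}$ of $\phi$ tangent to a Jacobi field is real isotropic to first order.
   Context: All manifolds and maps are smooth ($C^\infty$); manifolds are compact without boundary. $S^2$ carries its standard Riemann surface structure (and any Riemannian metric compatible with it; harmonicity and the Jacobi condition below do not depend on this choice). A vector field along $\phi:M\to N$ is a smooth section of $\phi^{-1}TN$. $\nabla$ denotes the connections induced by the Levi-Civita connections. The tension field is $\tau(\phi)=\mathrm{Trace}\,\nabla d\phi$, and $\phi$ is harmonic if $\tau(\phi)=0$. For $\phi$ harmonic, the Jacobi operator is $J_\phi(v)=\Delta v-\mathrm{Trace}\,R^N(d\phi,v)d\phi$, where $\Delta=-\mathrm{Trace}\,\nabla^2$ on $\phi^{-1}TN$ and the curvature sign convention is $R(X,Y)=-[\nabla_X,\nabla_Y]+\nabla_{[X,Y]}$. A Jacobi field along $\phi$ is a vector field $v$ along $\phi$ with $J_\phi(v)=0$. A smooth variation $\{\phi_t\}$ of $\phi$ is a smooth map $M\times I\to N$, $(x,t)\mapsto\phi_t(x)$, with $I\ni 0$ an open interval and $\phi_0=\phi$; it is tangent to $v$ if $v=\frac{\partial\phi_t}{\partial t}\big|_{t=0}$. Let $\langle\ ,\ \rangle^{\mathbf C}$ be the complex-bilinear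 extension of the metric of $N$ to $T^{c}N=TN\otimes_{\mathbb R}\mathbb C$, let $d^{c}\phi$ be the complex-linear extension of $d\phi$, and for a local complex coordinate $z$ on a Riemann surface $M$ put $\frac{\partial^{c}\phi}{\partial z}=d^{c}\phi(\frac{\partial}{\partial z})$; extend $\nabla$ complex-linearly, put $\frac{\nabla}{\partial z}=\nabla_{\partial/\partial z}$ and let $\frac{\nabla^{k}}{\partial z^{k}}$ be its $k$-fold iterate. For integers $r,s\ge1$ set $$\eta^{\mathbf R}_{r,s}(\phi)=\left\langle\frac{\nabla^{r-1}}{\partial z^{r-1}}\frac{\partial^{c}\phi}{\partial z},\frac{\nabla^{s-1}}{\partial z^{s-1}}\frac{\partial^{c}\phi}{\partial z}\right\rangle^{\mathbf C},$$ $$j^{\mathbf R}_{r,s}(v)=\left\langle\frac{\nabla^{r}v}{\partial z^{r}},\frac{\nabla^{s-1}}{\partial z^{s-1}}\frac{\partial^{c}\phi}{\partial z}\right\rangle^{\mathbf C}+\left\langle\frac{\nabla^{r-1}}{\partial z^{r-1}}\frac{\partial^{c}\phi}{\partial z},\frac{\nabla^{s}v}{\partial z^{s}}\right\rangle^{\mathbf C}.$$ The variation $\{\phi_t\}$ is real isotropic to first order if, for all $r,s\ge1$ and every local complex coordinate, $\eta^{\mathbf R}_{r,s}(\phi)=0$ and $\frac{\partial}{\partial t}\big|_{t=0}\eta^{\mathbf R}_{r,s}(\phi_t)=0$. *)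

theory Defs
  imports "HOL-Analysis.Analysis"
begin

section \<open>Smooth functions on open subsets of normed spaces\<close>

text \<open>These notions are only meant for open \<open>S\<close>, where \<open>frechet_derivative f (at x)\<close> is
  the derivative of \<open>f\<close> within \<open>S\<close>.\<close>

primrec Ck_on :: "nat \<Rightarrow> 'a::real_normed_vector set \<Rightarrow> ('a \<Rightarrow> 'b::real_normed_vector) \<Rightarrow> bool" where
  "Ck_on 0 S f \<longleftrightarrow> continuous_on S f"
| "Ck_on (Suc k) S f \<longleftrightarrow>
     f differentiable_on S \<and> (\<forall>u. Ck_on k S (\<lambda>x. frechet_derivative f (at x) u))"

definition smooth_on :: "'a::real_normed_vector set \<Rightarrow> ('a \<Rightarrow> 'b::real_normed_vector) \<Rightarrow> bool" where
  "smooth_on S f \<longleftrightarrow> (\<forall>k. Ck_on k S f)"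


section \<open>Manifolds\<close>

text \<open>A chart is a pair of its domain and its coordinate map; the map is only relevant on the
  domain.\<close>

type_synonym ('m, 'e) chart = "'m set \<times> ('m \<Rightarrow> 'e)"

record ('m, 'e) manifold =
  pts :: "'m set"
  charts :: "('m, 'e) chart set"

definition is_chart :: "'m::topological_space set \<Rightarrow> ('m, 'e::euclidean_space) chart \<Rightarrow> bool" where
  "is_chart M c \<longleftrightarrow> openin (top_of_set M) (fst c) \<and> open (snd c ` fst c) \<and>
     (\<exists>k. homeomorphism (fst c) (snd c ` fst c) (snd c) k)"

text \<open>The representative of \<open>f\<close> in the charts \<open>c\<close> and \<open>d\<close>; it is meaningful on
  \<open>rep_dom c d f\<close>.\<close>

definition local_rep :: "('m, 'e) chart \<Rightarrow> ('n, 'f) chart \<Rightarrow> ('m \<Rightarrow> 'n) \<Rightarrow> 'e \<Rightarrow> 'f" where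
  "local_rep c d f x = snd d (f (inv_into (fst c) (snd c) x))"

definition rep_dom :: "('m, 'e) chart \<Rightarrow> ('n, 'f) chart \<Rightarrow> ('m \<Rightarrow> 'n) \<Rightarrow> 'e set" where
  "rep_dom c d f = snd c ` {p \<in> fst c. f p \<in> fst d}"

definition transition :: "('m, 'e) chart \<Rightarrow> ('m, 'f) chart \<Rightarrow> 'e \<Rightarrow> 'f" where
  "transition c d = local_rep c d (\<lambda>p. p)"

definition transition_dom :: "('m, 'e) chart \<Rightarrow> ('m, 'f) chart \<Rightarrow> 'e set" where
  "transition_dom c d = rep_dom c d (\<lambda>p. p)"

text \<open>The Hausdorff axiom is imposed by the type class of the points; second countability is
  automatic for compact manifolds, the only ones to which this is applied.\<close>

definition smooth_manifold :: "('m::t2_space, 'e::euclidean_space, 'z) manifold_scheme \<Rightarrow> bool" where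
  "smooth_manifold M \<longleftrightarrow>
     (\<forall>c\<in>charts M. is_chart (pts M) c) \<and> (\<Union>c\<in>charts M. fst c) = pts M \<and>
     (\<forall>c\<in>charts M. \<forall>d\<in>charts M. smooth_on (transition_dom c d) (transition c d))"

definition smooth_map ::
  "('m::topological_space, 'e::euclidean_space, 'y) manifold_scheme \<Rightarrow>
   ('n::topological_space, 'f::euclidean_space, 'z) manifold_scheme \<Rightarrow> ('m \<Rightarrow> 'n) \<Rightarrow> bool" where
  "smooth_map M N f \<longleftrightarrow> continuous_on (pts M) f \<and> f ` pts M \<subseteq> pts N \<and>
     (\<forall>c\<in>charts M. \<forall>d\<in>charts N. smooth_on (rep_dom c d f) (local_rep c d f))"

definition times_interval ::
  "('m, 'e, 'z) manifold_scheme \<Rightarrow> real set \<Rightarrow> ('m \<times> real, 'e \<times> real) manifold" where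
  "times_interval M I =
     \<lparr>pts = pts M \<times> I, charts = (\<lambda>c. (fst c \<times> I, \<lambda>(p, t). (snd c p, t))) ` charts M\<rparr>"


section \<open>Riemannian manifolds\<close>

text \<open>\<open>metric M c x u w\<close> is the inner product of the tangent vectors whose components in the
  chart \<open>c\<close> are \<open>u\<close> and \<open>w\<close>, at the point with coordinates \<open>x\<close>.\<close>

record ('m, 'e) riemannian = "('m, 'e) manifold" +
  metric :: "('m, 'e) chart \<Rightarrow> 'e \<Rightarrow> 'e \<Rightarrow> 'e \<Rightarrow> real"

definition is_metric :: "('m, 'e::euclidean_space, 'z) riemannian_scheme \<Rightarrow> bool" where
  "is_metric M \<longleftrightarrow>
     (\<forall>c\<in>charts M. \<forall>x\<in>snd c ` fst c.
        bilinear (metric M c x) \<and> (\<forall>u w. metric M c x u w = metric M c x w u) \<and>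
        (\<forall>u. u \<noteq> 0 \<longrightarrow> metric M c x u u > 0)) \<and>
     (\<forall>c\<in>charts M. \<forall>u w. smooth_on (snd c ` fst c) (\<lambda>x. metric M c x u w)) \<and>
     (\<forall>c\<in>charts M. \<forall>d\<in>charts M. \<forall>x\<in>transition_dom c d. \<forall>u w.
        let D = frechet_derivative (transition c d) (at x)
        in metric M c x u w = metric M d (transition c d x) (D u) (D w))"

definition compact_riemannian_manifold ::
  "('m::t2_space, 'e::euclidean_space, 'z) riemannian_scheme \<Rightarrow> bool" where
  "compact_riemannian_manifold M \<longleftrightarrow> smooth_manifold M \<and> compact (pts M) \<and> is_metric M"

text \<open>A metric \<open>G\<close> on an open set of coordinates determines the Levi-Civita connection
  \<open>\<nabla>\<^bsub>u\<^esub> Z = D Z(u) + \<Gamma>(u, Z)\<close>, where \<open>\<Gamma> = christoffel G\<close>. For constant vector fields,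
  symmetry of \<open>\<Gamma>\<close> is torsion-freeness, and the third condition is
  \<open>u\<langle>w, z\<rangle> = \<langle>\<nabla>\<^bsub>u\<^esub> w, z\<rangle> + \<langle>w, \<nabla>\<^bsub>u\<^esub> z\<rangle>\<close>.\<close>

definition levi_civita_at ::
  "('e::euclidean_space \<Rightarrow> 'e \<Rightarrow> 'e \<Rightarrow> real) \<Rightarrow> 'e \<Rightarrow> ('e \<Rightarrow> 'e \<Rightarrow> 'e) \<Rightarrow> bool" where
  "levi_civita_at G x \<Gamma> \<longleftrightarrow> bilinear \<Gamma> \<and> (\<forall>u w. \<Gamma> u w = \<Gamma> w u) \<and>
     (\<forall>u w z. frechet_derivative (\<lambda>y. G y w z) (at x) u = G x (\<Gamma> u w) z + G x w (\<Gamma> u z))"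

definition christoffel ::
  "('e::euclidean_space \<Rightarrow> 'e \<Rightarrow> 'e \<Rightarrow> real) \<Rightarrow> 'e \<Rightarrow> 'e \<Rightarrow> 'e \<Rightarrow> 'e" where
  "christoffel G x = (THE \<Gamma>. levi_civita_at G x \<Gamma>)"

lemma levi_civita_unique_existence:
  assumes S: "open S" "x \<in> S" and
    bil: "\<And>y. y \<in> S \<Longrightarrow> bilinear (G y)" and
    sym: "\<And>y u w. y \<in> S \<Longrightarrow> G y u w = G y w u" and
    pos: "\<And>u. u \<noteq> 0 \<Longrightarrow> G x u u > 0" and
    diff: "\<And>u w. (\<lambda>y. G y u w) differentiable at x"
  shows "\<exists>!\<Gamma>. levi_civita_at G x \<Gamma>"
proof -
  define D where "D u w z = frechet_derivative (\<lambda>y. G y w z) (at x) u" for u w z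
  have der: "((\<lambda>y. G y w z) has_derivative (\<lambda>u. D u w z)) (at x)" for w z
    using diff[of w z] unfolding D_def by (simp add: frechet_derivative_works)
  have uniq: "D u w z = L u" if "((\<lambda>y. g y) has_derivative L) (at x)" "\<And>y. y \<in> S \<Longrightarrow> G y w z = g y"
    for u w z g L
  proof -
    have "((\<lambda>y. G y w z) has_derivative L) (at x)"
      by (rule has_derivative_transform_within_open[OF that(1) S]) (simp add: that(2))
    from has_derivative_unique[OF der this] show ?thesis by metis
  qed
  have lin1: "linear (\<lambda>u. D u w z)" for w z
    using der has_derivative_linear by blast
  have Dadd2: "D u (a + b) z = D u a z + D u b z" for u a b z
    by (rule uniq[OF has_derivative_add[OF der der]]) (simp add: bil bilinear_ladd)
  have Dsc2: "D u (k *\<^sub>R a) z = k *\<^sub>R D u a z" for u a k z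
    by (rule uniq[OF has_derivative_scaleR_right[OF der]]) (simp add: bil bilinear_lmul)
  have Dsym: "D u w z = D u z w" for u w z
    by (rule uniq[OF der]) (simp add: sym)
  have Dadd3: "D u z (a + b) = D u z a + D u z b" for u a b z
    using Dadd2 Dsym by metis
  have Dsc3: "D u z (k *\<^sub>R a) = k *\<^sub>R D u z a" for u a k z
    using Dsc2 Dsym by metis
  have Dadd1: "D (a + b) w z = D a w z + D b w z" for a b w z
    using linear_add[OF lin1] by blast
  have Dsc1: "D (k *\<^sub>R a) w z = k *\<^sub>R D a w z" for a k w z
    using linear_cmul[OF lin1] by blast
  note B = bil[OF S(2)]
  have inj0: "w = w'" if "\<And>z. G x w z = G x w' z" for w w'
  proof (rule ccontr)
    assume "w \<noteq> w'"
    then have "G x (w - w') (w - w') > 0" using pos by simp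
    moreover have "G x (w - w') (w - w') = 0"
      using that bilinear_lsub[OF B] by simp
    ultimately show False by simp
  qed
  have riesz: "\<exists>w. \<forall>z. G x w z = l z" if l: "linear l" for l :: "'a \<Rightarrow> real"
  proof -
    define T where "T w = (\<Sum>i\<in>Basis. G x w i *\<^sub>R i)" for w
    have exp: "m z = (\<Sum>i\<in>Basis. m i *\<^sub>R i) \<bullet> z" if "linear m" for m :: "'a \<Rightarrow> real" and z
    proof -
      have "m z = m (\<Sum>i\<in>Basis. (z \<bullet> i) *\<^sub>R i)" by (simp add: euclidean_representation)
      also have "\<dots> = (\<Sum>i\<in>Basis. (z \<bullet> i) * m i)"
        using that by (simp add: linear_sum linear_cmul)
      also have "\<dots> = (\<Sum>i\<in>Basis. m i *\<^sub>R i) \<bullet> z"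
        by (simp add: inner_sum_left) (simp add: inner_commute mult.commute)
      finally show ?thesis .
    qed
    have lG: "linear (G x w)" for w using B by (simp add: bilinear_def)
    have Tz: "G x w z = T w \<bullet> z" for w z unfolding T_def by (rule exp[OF lG])
    have "linear T"
      unfolding T_def by (rule linearI)
        (simp_all add: bilinear_ladd[OF B] bilinear_lmul[OF B] scaleR_add_left sum.distrib scaleR_sum_right)
    moreover have "inj T" by (rule injI, rule inj0) (simp add: Tz)
    ultimately have "surj T" by (rule linear_inj_imp_surj)
    then obtain w where "T w = (\<Sum>i\<in>Basis. l i *\<^sub>R i)" by (metis surjD)
    then show ?thesis using Tz exp[OF l] by metis
  qed
  have "\<exists>a. \<forall>z. G x a z = (D u w z + D w u z - D z u w) / 2" for u w
    by (rule riesz, rule linearI) (simp_all add: Dadd1 Dadd3 Dsc1 Dsc3 field_simps)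
  then obtain \<Gamma> where \<Gamma>: "\<And>u w z. G x (\<Gamma> u w) z = (D u w z + D w u z - D z u w) / 2" by metis
  have G_sym: "\<Gamma> u w = \<Gamma> w u" for u w
    by (rule inj0) (simp add: \<Gamma> Dsym[of _ u w])
  have G_lin: "linear (\<Gamma> u)" for u
    by (rule linearI; rule inj0)
       (simp_all add: \<Gamma> bilinear_ladd[OF B] bilinear_lmul[OF B] Dadd1 Dadd2 Dadd3 Dsc1 Dsc2 Dsc3 field_simps)
  have "(\<lambda>w. \<Gamma> w u) = \<Gamma> u" for u using G_sym by blast
  then have "bilinear \<Gamma>" unfolding bilinear_def using G_lin by metis
  moreover have "D u w z = G x (\<Gamma> u w) z + G x w (\<Gamma> u z)" for u w z
    using \<Gamma>[of u w z] \<Gamma>[of u z w] sym[OF S(2), of w "\<Gamma> u z"] Dsym[of u w z] Dsym[of w u z] Dsym[of z u w]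
    by (simp add: field_simps)
  ultimately have "levi_civita_at G x \<Gamma>" unfolding levi_civita_at_def D_def using G_sym by blast
  moreover have "\<Gamma>' = \<Gamma>" if "levi_civita_at G x \<Gamma>'" for \<Gamma>'
  proof (intro ext, rule inj0)
    fix u w z
    have s: "\<Gamma>' a b = \<Gamma>' b a" and m: "D a b c = G x (\<Gamma>' a b) c + G x b (\<Gamma>' a c)" for a b c
      using that unfolding levi_civita_at_def D_def by blast+
    have "2 * G x (\<Gamma>' u w) z = D u w z + D w u z - D z u w"
      using m[of u w z] m[of w u z] m[of z u w] sym[OF S(2), of w "\<Gamma>' u z"]
      unfolding s[of z u] s[of w u] s[of z w] by linarith
    then show "G x (\<Gamma>' u w) z = G x (\<Gamma> u w) z" by (simp add: \<Gamma>)
  qed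
  ultimately show ?thesis by blast
qed

text \<open>The covariant derivative at \<open>x\<close> in the direction \<open>u\<close> of a vector field \<open>W\<close> along
  \<open>F\<close>, for the connection pulled back by \<open>F\<close>.\<close>

definition cov ::
  "('f::euclidean_space \<Rightarrow> 'f \<Rightarrow> 'f \<Rightarrow> 'f) \<Rightarrow> ('e::euclidean_space \<Rightarrow> 'f) \<Rightarrow> 'e \<Rightarrow> ('e \<Rightarrow> 'f) \<Rightarrow> 'e \<Rightarrow> 'f" where
  "cov \<Gamma> F u W x =
     frechet_derivative W (at x) u + \<Gamma> (F x) (frechet_derivative F (at x) u) (W x)"

text \<open>The sign convention is \<open>R(X, Y) = - [\<nabla>\<^bsub>X\<^esub>, \<nabla>\<^bsub>Y\<^esub>] + \<nabla>\<^bsub>[X, Y]\<^esub>\<close>; it is applied to constant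
  vector fields, whose bracket vanishes.\<close>

definition curvature ::
  "('e::euclidean_space \<Rightarrow> 'e \<Rightarrow> 'e \<Rightarrow> 'e) \<Rightarrow> 'e \<Rightarrow> 'e \<Rightarrow> 'e \<Rightarrow> 'e \<Rightarrow> 'e" where
  "curvature \<Gamma> x u w z =
     - (cov \<Gamma> (\<lambda>y. y) u (cov \<Gamma> (\<lambda>y. y) w (\<lambda>_. z)) x -
        cov \<Gamma> (\<lambda>y. y) w (cov \<Gamma> (\<lambda>y. y) u (\<lambda>_. z)) x)"

definition sectional_curvature ::
  "('e::euclidean_space \<Rightarrow> 'e \<Rightarrow> 'e \<Rightarrow> real) \<Rightarrow> 'e \<Rightarrow> 'e \<Rightarrow> 'e \<Rightarrow> real" where
  "sectional_curvature G x u w =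
     G x (curvature (christoffel G) x u w u) w / (G x u u * G x w w - (G x u w)\<^sup>2)"

definition constant_curvature :: "('m, 'e::euclidean_space, 'z) riemannian_scheme \<Rightarrow> bool" where
  "constant_curvature N \<longleftrightarrow> (\<exists>K. \<forall>d\<in>charts N. \<forall>y\<in>snd d ` fst d. \<forall>u w.
     u \<noteq> w \<and> independent {u, w} \<longrightarrow> sectional_curvature (metric N d) y u w = K)"

text \<open>The trace of a bilinear map \<open>B\<close> with respect to an inner product \<open>b\<close>; it does not depend
  on the orthonormal basis.\<close>

definition orthonormal_basis :: "('e::euclidean_space \<Rightarrow> 'e \<Rightarrow> real) \<Rightarrow> 'e set \<Rightarrow> bool" where
  "orthonormal_basis b E \<longleftrightarrow> finite E \<and> span E = UNIV \<and>
     (\<forall>e\<in>E. \<forall>e'\<in>E. b e e' = (if e = e' then 1 else 0))"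

definition metric_trace ::
  "('e::euclidean_space \<Rightarrow> 'e \<Rightarrow> real) \<Rightarrow> ('e \<Rightarrow> 'e \<Rightarrow> 'f::real_vector) \<Rightarrow> 'f" where
  "metric_trace b B = (\<Sum>e\<in>(SOME E. orthonormal_basis b E). B e e)"


section \<open>Harmonic maps and Jacobi fields\<close>

text \<open>The coordinate expressions below are evaluated in a chart \<open>c\<close> of the domain and a chart
  \<open>d\<close> of the target, at the point with coordinates \<open>x \<in> rep_dom c d f\<close>.\<close>

definition tension ::
  "('m, 'e::euclidean_space, 'y) riemannian_scheme \<Rightarrow> ('n, 'f::euclidean_space, 'z) riemannian_scheme \<Rightarrow>
   ('m \<Rightarrow> 'n) \<Rightarrow> ('m, 'e) chart \<Rightarrow> ('n, 'f) chart \<Rightarrow> 'e \<Rightarrow> 'f" where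
  "tension M N f c d x =
     (let F = local_rep c d f;
          \<Gamma>M = christoffel (metric M c);
          \<Gamma>N = christoffel (metric N d)
      in metric_trace (metric M c x)
           (\<lambda>u w. cov \<Gamma>N F u (\<lambda>y. frechet_derivative F (at y) w) x -
                  frechet_derivative F (at x) (\<Gamma>M x u w)))"

definition harmonic ::
  "('m::topological_space, 'e::euclidean_space, 'y) riemannian_scheme \<Rightarrow>
   ('n::topological_space, 'f::euclidean_space, 'z) riemannian_scheme \<Rightarrow> ('m \<Rightarrow> 'n) \<Rightarrow> bool" where
  "harmonic M N f \<longleftrightarrow> smooth_map M N f \<and>
     (\<forall>c\<in>charts M. \<forall>d\<in>charts N. \<forall>x\<in>rep_dom c d f. tension M N f c d x = 0)"

text \<open>A tangent vector of \<open>N\<close> at a point is a family of vectors, one for each chart around the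
  point, which transforms by the derivatives of the transition maps. Accordingly, \<open>v d p\<close> is the
  component vector in the chart \<open>d\<close> of the value at \<open>p\<close> of a vector field \<open>v\<close> along \<open>f\<close>;
  it is only relevant if \<open>f p\<close> is in the domain of \<open>d\<close>.\<close>

type_synonym ('m, 'n, 'f) field_along = "('n, 'f) chart \<Rightarrow> 'm \<Rightarrow> 'f"

definition field_rep ::
  "('m, 'e) chart \<Rightarrow> ('n, 'f) chart \<Rightarrow> ('m, 'n, 'f) field_along \<Rightarrow> 'e \<Rightarrow> 'f" where
  "field_rep c d v x = v d (inv_into (fst c) (snd c) x)"

definition vector_field_along ::
  "('m, 'e::euclidean_space, 'y) manifold_scheme \<Rightarrow> ('n, 'f::euclidean_space, 'z) manifold_scheme \<Rightarrow>
   ('m \<Rightarrow> 'n) \<Rightarrow> ('m, 'n, 'f) field_along \<Rightarrow> bool" where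
  "vector_field_along M N f v \<longleftrightarrow>
     (\<forall>p\<in>pts M. \<forall>d\<in>charts N. \<forall>d'\<in>charts N. f p \<in> fst d \<inter> fst d' \<longrightarrow>
        v d' p = frechet_derivative (transition d d') (at (snd d (f p))) (v d p)) \<and>
     (\<forall>c\<in>charts M. \<forall>d\<in>charts N. smooth_on (rep_dom c d f) (field_rep c d v))"

definition rough_laplacian ::
  "('m, 'e::euclidean_space, 'y) riemannian_scheme \<Rightarrow> ('n, 'f::euclidean_space, 'z) riemannian_scheme \<Rightarrow>
   ('m \<Rightarrow> 'n) \<Rightarrow> ('m, 'n, 'f) field_along \<Rightarrow> ('m, 'e) chart \<Rightarrow> ('n, 'f) chart \<Rightarrow> 'e \<Rightarrow> 'f" where
  "rough_laplacian M N f v c d x =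
     (let F = local_rep c d f;
          W = field_rep c d v;
          \<Gamma>M = christoffel (metric M c);
          \<Gamma>N = christoffel (metric N d)
      in - metric_trace (metric M c x)
             (\<lambda>u w. cov \<Gamma>N F u (cov \<Gamma>N F w W) x - cov \<Gamma>N F (\<Gamma>M x u w) W x))"

definition jacobi_operator ::
  "('m, 'e::euclidean_space, 'y) riemannian_scheme \<Rightarrow> ('n, 'f::euclidean_space, 'z) riemannian_scheme \<Rightarrow>
   ('m \<Rightarrow> 'n) \<Rightarrow> ('m, 'n, 'f) field_along \<Rightarrow> ('m, 'e) chart \<Rightarrow> ('n, 'f) chart \<Rightarrow> 'e \<Rightarrow> 'f" where
  "jacobi_operator M N f v c d x =
     (let F = local_rep c d f;
          DF = frechet_derivative F (at x);
          R = curvature (christoffel (metric N d)) (F x)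
      in rough_laplacian M N f v c d x -
         metric_trace (metric M c x) (\<lambda>u w. R (DF u) (field_rep c d v x) (DF w)))"

definition jacobi_field ::
  "('m, 'e::euclidean_space, 'y) riemannian_scheme \<Rightarrow> ('n, 'f::euclidean_space, 'z) riemannian_scheme \<Rightarrow>
   ('m \<Rightarrow> 'n) \<Rightarrow> ('m, 'n, 'f) field_along \<Rightarrow> bool" where
  "jacobi_field M N f v \<longleftrightarrow> vector_field_along M N f v \<and>
     (\<forall>c\<in>charts M. \<forall>d\<in>charts N. \<forall>x\<in>rep_dom c d f. jacobi_operator M N f v c d x = 0)"

definition smooth_variation ::
  "('m::topological_space, 'e::euclidean_space, 'y) manifold_scheme \<Rightarrow>
   ('n::topological_space, 'f::euclidean_space, 'z) manifold_scheme \<Rightarrow>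
   ('m \<Rightarrow> 'n) \<Rightarrow> real set \<Rightarrow> (real \<Rightarrow> 'm \<Rightarrow> 'n) \<Rightarrow> bool" where
  "smooth_variation M N f I F \<longleftrightarrow> open I \<and> is_interval I \<and> 0 \<in> I \<and>
     smooth_map (times_interval M I) N (\<lambda>(p, t). F t p) \<and> (\<forall>p\<in>pts M. F 0 p = f p)"

definition tangent_to ::
  "('m, 'e, 'y) manifold_scheme \<Rightarrow> ('n, 'f::euclidean_space, 'z) manifold_scheme \<Rightarrow>
   (real \<Rightarrow> 'm \<Rightarrow> 'n) \<Rightarrow> ('m, 'n, 'f) field_along \<Rightarrow> bool" where
  "tangent_to M N F v \<longleftrightarrow> (\<forall>p\<in>pts M. \<forall>d\<in>charts N. F 0 p \<in> fst d \<longrightarrow>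
     v d p = vector_derivative (\<lambda>t. snd d (F t p)) (at 0))"


section \<open>Real isotropy\<close>

text \<open>From here on the domain is a Riemann surface, with local complex coordinates as charts, and
  complexified tangent vectors of the target have components in \<open>complex ^ 'd\<close>. The metric and
  the Christoffel symbols are extended complex-bilinearly.\<close>

definition cvec :: "real ^ 'd \<Rightarrow> complex ^ 'd" where
  "cvec u = (\<chi> i. complex_of_real (u $ i))"

definition metric_C :: "(real ^ 'd \<Rightarrow> real ^ 'd \<Rightarrow> real) \<Rightarrow> complex ^ 'd \<Rightarrow> complex ^ 'd \<Rightarrow> complex" where
  "metric_C b u w = (\<Sum>i\<in>UNIV. \<Sum>j\<in>UNIV. u $ i * w $ j * complex_of_real (b (axis i 1) (axis j 1)))"

definition christoffel_C ::
  "(real ^ 'd \<Rightarrow> real ^ 'd \<Rightarrow> real ^ 'd) \<Rightarrow> complex ^ 'd \<Rightarrow> complex ^ 'd \<Rightarrow> complex ^ 'd" where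
  "christoffel_C \<Gamma> u w = (\<Sum>i\<in>UNIV. \<Sum>j\<in>UNIV. (u $ i * w $ j) *s cvec (\<Gamma> (axis i 1) (axis j 1)))"

definition cov_C ::
  "(real ^ 'd \<Rightarrow> real ^ 'd \<Rightarrow> real ^ 'd \<Rightarrow> real ^ 'd) \<Rightarrow> (complex \<Rightarrow> real ^ 'd) \<Rightarrow>
   complex \<Rightarrow> (complex \<Rightarrow> complex ^ 'd) \<Rightarrow> complex \<Rightarrow> complex ^ 'd" where
  "cov_C \<Gamma> F u W x = frechet_derivative W (at x) u +
     christoffel_C (\<Gamma> (F x)) (cvec (frechet_derivative F (at x) u)) (W x)"

text \<open>With \<open>z = x + \<i> y\<close>, the tangent vectors \<open>\<partial>/\<partial>x\<close> and \<open>\<partial>/\<partial>y\<close> are \<open>1\<close> and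
  \<open>\<i>\<close>, and \<open>\<partial>/\<partial>z = (\<partial>/\<partial>x - \<i> \<partial>/\<partial>y) / 2\<close>.\<close>

definition nabla_z ::
  "(real ^ 'd \<Rightarrow> real ^ 'd \<Rightarrow> real ^ 'd \<Rightarrow> real ^ 'd) \<Rightarrow> (complex \<Rightarrow> real ^ 'd) \<Rightarrow>
   (complex \<Rightarrow> complex ^ 'd) \<Rightarrow> complex \<Rightarrow> complex ^ 'd" where
  "nabla_z \<Gamma> F W x = (1 / 2) *s (cov_C \<Gamma> F 1 W x - \<i> *s cov_C \<Gamma> F \<i> W x)"

definition d_z :: "(complex \<Rightarrow> real ^ 'd) \<Rightarrow> complex \<Rightarrow> complex ^ 'd" where
  "d_z F x = (1 / 2) *s (cvec (frechet_derivative F (at x) 1) -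
                         \<i> *s cvec (frechet_derivative F (at x) \<i>))"

definition eta ::
  "('n, real ^ 'd, 'z) riemannian_scheme \<Rightarrow> ('m \<Rightarrow> 'n) \<Rightarrow> nat \<Rightarrow> nat \<Rightarrow>
   ('m, complex) chart \<Rightarrow> ('n, real ^ 'd) chart \<Rightarrow> complex \<Rightarrow> complex" where
  "eta N f r s c d x =
     (let F = local_rep c d f;
          D = nabla_z (christoffel (metric N d)) F
      in metric_C (metric N d (F x)) ((D ^^ (r - 1)) (d_z F) x) ((D ^^ (s - 1)) (d_z F) x))"

definition j_R ::
  "('n, real ^ 'd, 'z) riemannian_scheme \<Rightarrow> ('m \<Rightarrow> 'n) \<Rightarrow> ('m, 'n, real ^ 'd) field_along \<Rightarrow>
   nat \<Rightarrow> nat \<Rightarrow> ('m, complex) chart \<Rightarrow> ('n, real ^ 'd) chart \<Rightarrow> complex \<Rightarrow> complex" where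
  "j_R N f v r s c d x =
     (let F = local_rep c d f;
          W = (\<lambda>y. cvec (field_rep c d v y));
          D = nabla_z (christoffel (metric N d)) F
      in metric_C (metric N d (F x)) ((D ^^ r) W x) ((D ^^ (s - 1)) (d_z F) x) +
         metric_C (metric N d (F x)) ((D ^^ (r - 1)) (d_z F) x) ((D ^^ s) W x))"

definition preserves_real_isotropy ::
  "('m, complex, 'y) manifold_scheme \<Rightarrow> ('n, real ^ 'd, 'z) riemannian_scheme \<Rightarrow>
   ('m \<Rightarrow> 'n) \<Rightarrow> ('m, 'n, real ^ 'd) field_along \<Rightarrow> bool" where
  "preserves_real_isotropy M N f v \<longleftrightarrow>
     (\<forall>r\<ge>1. \<forall>s\<ge>1. \<forall>c\<in>charts M. \<forall>d\<in>charts N. \<forall>x\<in>rep_dom c d f. j_R N f v r s c d x = 0)"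

text \<open>For \<open>x\<close> and \<open>d\<close> as below, \<open>d\<close> is a chart around \<open>F t p\<close> for all small \<open>t\<close>, where
  \<open>p\<close> is the point with coordinates \<open>x\<close>.\<close>

definition real_isotropic_to_first_order ::
  "('m, complex, 'y) manifold_scheme \<Rightarrow> ('n, real ^ 'd, 'z) riemannian_scheme \<Rightarrow>
   (real \<Rightarrow> 'm \<Rightarrow> 'n) \<Rightarrow> bool" where
  "real_isotropic_to_first_order M N F \<longleftrightarrow>
     (\<forall>r\<ge>1. \<forall>s\<ge>1. \<forall>c\<in>charts M. \<forall>d\<in>charts N. \<forall>x\<in>rep_dom c d (F 0).
        eta N (F 0) r s c d x = 0 \<and>
        ((\<lambda>t. eta N (F t) r s c d x) has_vector_derivative 0) (at 0))"


section \<open>The 2-sphere as a Riemann surface\<close>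

text \<open>The 2-sphere is the unit sphere of \<open>complex \<times> real\<close>, that is, of Euclidean 3-space. Its
  complex structure is given by the stereographic projections from \<open>(0, 1)\<close> and from
  \<open>(0, -1)\<close>, the latter followed by conjugation.\<close>

definition S2 :: "(complex \<times> real) set" where
  "S2 = sphere 0 1"

definition stereographic_charts :: "(complex \<times> real, complex) chart set" where
  "stereographic_charts =
     {(S2 - {(0, 1)}, \<lambda>(w, t). w / complex_of_real (1 - t)),
      (S2 - {(0, - 1)}, \<lambda>(w, t). cnj w / complex_of_real (1 + t))}"

definition complex_coordinates_S2 :: "(complex \<times> real, complex) chart set" where
  "complex_coordinates_S2 = {c. is_chart S2 c \<and>
     (\<forall>d\<in>stereographic_charts.
        transition c d holomorphic_on transition_dom c d \<and>
        transition d c holomorphic_on transition_dom d c)}"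

definition sphere_with_metric ::
  "((complex \<times> real, complex) chart \<Rightarrow> complex \<Rightarrow> complex \<Rightarrow> complex \<Rightarrow> real) \<Rightarrow>
   (complex \<times> real, complex) riemannian" where
  "sphere_with_metric h = \<lparr>pts = S2, charts = complex_coordinates_S2, metric = h\<rparr>"

text \<open>Compatibility of a metric with a Riemann surface structure: \<open>h = l |dz|\<^sup>2\<close> in each local
  complex coordinate \<open>z\<close>.\<close>

definition conformal_metric :: "('m, complex, 'z) riemannian_scheme \<Rightarrow> bool" where
  "conformal_metric M \<longleftrightarrow> (\<forall>c\<in>charts M. \<forall>x\<in>snd c ` fst c.
     \<exists>l>0. \<forall>u w. metric M c x u w = l * (u \<bullet> w))"

end

theory Submission
  imports Defs "HOL-Complex_Analysis.Cauchy_Integral_Formula"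
begin

text \<open>Write \<open>\<psi>\<^sub>a = \<nabla>\<^sub>z\<^sup>a (\<partial>\<phi>/\<partial>z)\<close>, and let \<open>u\<^sub>a\<close> be its formal covariant derivative under an infinitesimal
  deformation of \<open>\<phi>\<close> in the direction \<open>v\<close>. The fields \<open>\<psi>\<^sub>a + \<epsilon> u\<^sub>a\<close> over the dual numbers satisfy the
  same identities as the \<open>\<psi>\<^sub>a\<close> themselves, because \<open>v\<close> is a Jacobi field and the curvature tensor of a
  space form is parallel. If the pairings \<open>\<langle>\<psi>\<^sub>a + \<epsilon> u\<^sub>a, \<psi>\<^sub>b + \<epsilon> u\<^sub>b\<rangle>\<close> vanish for \<open>a + b < n\<close>, then the special
  form of the curvature shows that those with \<open>a + b = n\<close> are holomorphic and transform like the
  coefficient of a differential of degree \<open>n + 2\<close> on the 2-sphere; such a differential vanishes by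
  Liouville's theorem. By induction all pairings vanish; their two coefficients over the dual numbers are
  \<open>\<eta>\<close> and, up to terms that vanish by isotropy, \<open>j\<close>.\<close>

section \<open>Calculus of smooth functions\<close>

text \<open>In a space form, commuting the z and zbar derivatives of psi_a produces only multiples
  <A, psi_a> B and <B, psi_a> A, where A and B are the z and zbar derivatives of phi. Paired with
  psi_b, each product contains <A, psi_a> or <A, psi_b>, a pairing of lower level. The obstacle is
  that psi_a is not a tensor: a change of z brings in derivatives of the Jacobian. They are never
  computed. A pairing that vanishes identically may be differentiated, which moves a derivative from
  one argument to the other with a sign; at the lowest level not yet known to vanish this leaves
  only a power of the Jacobian. Under z -> 1/z that power is (-z^-2)^(n+2), which forces decay at
  infinity. Both coefficients go through the same induction, because the epsilon coefficient at
  level n uses both coefficients at lower levels. For a variation nothing is required at t other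
  than 0: the true covariant t-derivative of psi_a at t = 0 coincides with u_a.\<close>

abbreviation fderiv :: "('a::real_normed_vector \<Rightarrow> 'b::real_normed_vector) \<Rightarrow> 'a \<Rightarrow> 'a \<Rightarrow> 'b" where
  "fderiv f x u \<equiv> frechet_derivative f (at x) u"

lemma fderiv_eq: "(f has_derivative f') (at x) \<Longrightarrow> fderiv f x u = f' u"
  by (metis frechet_derivative_at)

lemma has_fderiv: "f differentiable at x \<Longrightarrow> (f has_derivative fderiv f x) (at x)"
  by (simp add: frechet_derivative_works)

lemma linear_fderiv: "f differentiable at x \<Longrightarrow> linear (fderiv f x)"
  using has_fderiv has_derivative_linear by blast

text \<open>\<open>frechet_derivative\<close> chooses among all derivatives at the point, and f and
  g have the same ones there. So the equality holds even where neither is differentiable.\<close>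

lemma fderiv_cong:
  assumes "open S" "x \<in> S" "\<And>y. y \<in> S \<Longrightarrow> f y = g y"
  shows "fderiv f x = fderiv g x"
proof -
  have "(f has_derivative f') (at x) \<longleftrightarrow> (g has_derivative f') (at x)" for f'
    using has_derivative_transform_within_open[OF _ assms(1,2), of f f' UNIV g]
      has_derivative_transform_within_open[OF _ assms(1,2), of g f' UNIV f] assms(3) by auto
  then show ?thesis by (simp add: frechet_derivative_def)
qed

lemma differentiable_cong:
  assumes "open S" "x \<in> S" "\<And>y. y \<in> S \<Longrightarrow> f y = g y" "f differentiable at x"
  shows "g differentiable at x"
  using assms has_derivative_transform_within_open[OF _ assms(1,2), of f _ UNIV g]
  unfolding differentiable_def by blast

lemma fderiv_const [simp]: "fderiv (\<lambda>_. c) x u = 0"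
  by (rule fderiv_eq) auto

lemma fderiv_linear: "bounded_linear L \<Longrightarrow> fderiv L x u = L u"
  by (rule fderiv_eq) (rule bounded_linear_imp_has_derivative)

lemma fderiv_add:
  "f differentiable at x \<Longrightarrow> g differentiable at x \<Longrightarrow>
    fderiv (\<lambda>y. f y + g y) x u = fderiv f x u + fderiv g x u"
  using fderiv_eq[OF has_derivative_add[OF has_fderiv has_fderiv]] by blast

lemma fderiv_bounded_linear:
  "bounded_linear L \<Longrightarrow> f differentiable at x \<Longrightarrow> fderiv (\<lambda>y. L (f y)) x u = L (fderiv f x u)"
  using fderiv_eq[OF bounded_linear.has_derivative[OF _ has_fderiv]] by blast

lemma fderiv_bilinear:
  assumes "bounded_bilinear B" "f differentiable at x" "g differentiable at x"
  shows "fderiv (\<lambda>y. B (f y) (g y)) x u = B (fderiv f x u) (g x) + B (f x) (fderiv g x u)"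
  using fderiv_eq[OF bounded_bilinear.FDERIV[OF assms(1) has_fderiv[OF assms(2)] has_fderiv[OF assms(3)]], of u]
  by (simp only: add.commute)

lemma differentiable_bounded_linear:
  "bounded_linear L \<Longrightarrow> f differentiable at x \<Longrightarrow> (\<lambda>y. L (f y)) differentiable at x"
  using bounded_linear.has_derivative unfolding differentiable_def by blast

lemma differentiable_bilinear:
  "bounded_bilinear B \<Longrightarrow> f differentiable at x \<Longrightarrow> g differentiable at x \<Longrightarrow>
    (\<lambda>y. B (f y) (g y)) differentiable at x"
  using bounded_bilinear.FDERIV unfolding differentiable_def by blast

lemma fderiv_compose:
  assumes "f differentiable at x" "g differentiable at (f x)"
  shows "fderiv (\<lambda>y. g (f y)) x u = fderiv g (f x) (fderiv f x u)"
  using fderiv_eq[OF diff_chain_at[OF has_fderiv[OF assms(1)] has_fderiv[OF assms(2)]]]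
  by (simp add: o_def)

lemma differentiable_compose':
  "f differentiable at x \<Longrightarrow> g differentiable at (f x) \<Longrightarrow> (\<lambda>y. g (f y)) differentiable at x"
  using differentiable_chain_at[of f x g] by (simp add: o_def)

lemma Ck_on_cong:
  "open S \<Longrightarrow> (\<And>x. x \<in> S \<Longrightarrow> f x = g x) \<Longrightarrow> Ck_on k S f \<Longrightarrow> Ck_on k S g"
proof (induction k arbitrary: f g)
  case 0
  then show ?case by (metis Ck_on.simps(1) continuous_on_cong)
next
  case (Suc k)
  have "Ck_on k S (\<lambda>x. fderiv g x u)" for u
  proof (rule Suc.IH)
    show "Ck_on k S (\<lambda>x. fderiv f x u)" using Suc.prems(3) by simp
    show "fderiv f x u = fderiv g x u" if "x \<in> S" for x
      using fderiv_cong[OF Suc.prems(1) that Suc.prems(2)] by simp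
  qed (rule Suc.prems(1))
  moreover have "g differentiable at x" if x: "x \<in> S" for x
    by (rule differentiable_cong[OF Suc.prems(1) x Suc.prems(2)])
      (use Suc.prems(1,3) x in \<open>auto simp: differentiable_on_def at_within_open_NO_MATCH\<close>)
  then have "g differentiable_on S"
    using Suc.prems(1) by (simp add: differentiable_on_def at_within_open_NO_MATCH)
  ultimately show ?case by simp
qed

lemma Ck_on_SucD: "Ck_on (Suc k) S f \<Longrightarrow> Ck_on k S f"
proof (induction k arbitrary: f)
  case 0
  then show ?case by (simp add: differentiable_imp_continuous_on)
next
  case (Suc k)
  then show ?case by (metis Ck_on.simps(2))
qed

lemma Ck_on_differentiable: "Ck_on (Suc k) S f \<Longrightarrow> open S \<Longrightarrow> x \<in> S \<Longrightarrow> f differentiable at x"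
  by (auto simp: differentiable_on_def at_within_open_NO_MATCH)

lemma Ck_on_SucI:
  assumes "open S" "\<And>x. x \<in> S \<Longrightarrow> f differentiable at x" "\<And>u. Ck_on k S (\<lambda>x. fderiv f x u)"
  shows "Ck_on (Suc k) S f"
  using assms by (auto simp: differentiable_on_def at_within_open_NO_MATCH)

lemma Ck_on_subset: "Ck_on k S f \<Longrightarrow> T \<subseteq> S \<Longrightarrow> Ck_on k T f"
  by (induction k arbitrary: f) (auto intro: continuous_on_subset differentiable_on_subset)

lemma Ck_on_const: "open S \<Longrightarrow> Ck_on k S (\<lambda>_. c)"
  by (induction k arbitrary: c) (auto simp: differentiable_on_def)

lemma Ck_on_add:
  "open S \<Longrightarrow> Ck_on k S f \<Longrightarrow> Ck_on k S g \<Longrightarrow> Ck_on k S (\<lambda>x. f x + g x)"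
proof (induction k arbitrary: f g)
  case 0
  then show ?case by (simp add: continuous_on_add)
next
  case (Suc k)
  note d = Ck_on_differentiable[OF Suc.prems(2,1)] Ck_on_differentiable[OF Suc.prems(3,1)]
  show ?case
  proof (rule Ck_on_SucI)
    show "Ck_on k S (\<lambda>x. fderiv (\<lambda>x. f x + g x) x u)" for u
      by (rule Ck_on_cong[OF Suc.prems(1) _ Suc.IH[OF Suc.prems(1)]])
        (simp add: fderiv_add[OF d], use Suc.prems in simp_all)
  qed (use d Suc.prems in auto)
qed

lemma Ck_on_bounded_linear:
  assumes L: "bounded_linear L" and S: "open S"
  shows "Ck_on k S f \<Longrightarrow> Ck_on k S (\<lambda>x. L (f x))"
proof (induction k arbitrary: f)
  case 0
  then show ?case unfolding Ck_on.simps by (rule bounded_linear.continuous_on[OF L])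
next
  case (Suc k)
  note d = Ck_on_differentiable[OF Suc.prems S]
  show ?case
  proof (rule Ck_on_SucI[OF S])
    show "Ck_on k S (\<lambda>x. fderiv (\<lambda>x. L (f x)) x u)" for u
      by (rule Ck_on_cong[OF S _ Suc.IH]) (use Suc.prems in \<open>auto simp: fderiv_bounded_linear[OF L d]\<close>)
  qed (rule differentiable_bounded_linear[OF L d])
qed

lemma Ck_on_bilinear:
  assumes B: "bounded_bilinear B" and S: "open S"
  shows "Ck_on k S f \<Longrightarrow> Ck_on k S g \<Longrightarrow> Ck_on k S (\<lambda>x. B (f x) (g x))"
proof (induction k arbitrary: f g)
  case 0
  then show ?case unfolding Ck_on.simps by (rule bounded_bilinear.continuous_on[OF B])
next
  case (Suc k)
  note d = Ck_on_differentiable[OF Suc.prems(1) S] Ck_on_differentiable[OF Suc.prems(2) S]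
  show ?case
  proof (rule Ck_on_SucI[OF S])
    have "Ck_on k S (\<lambda>x. B (fderiv f x u) (g x) + B (f x) (fderiv g x u))" for u
      by (intro Ck_on_add Suc.IH S) (use Suc.prems Suc.prems[THEN Ck_on_SucD] in simp_all)
    then show "Ck_on k S (\<lambda>x. fderiv (\<lambda>x. B (f x) (g x)) x u)" for u
      by (rule Ck_on_cong[OF S, rotated]) (simp add: fderiv_bilinear[OF B d])
  qed (rule differentiable_bilinear[OF B d])
qed

lemma Ck_on_sum:
  "open S \<Longrightarrow> (\<And>i. i \<in> I \<Longrightarrow> Ck_on k S (f i)) \<Longrightarrow> Ck_on k S (\<lambda>x. \<Sum>i\<in>I. f i x)"
  by (induction I rule: infinite_finite_induct) (auto intro: Ck_on_add Ck_on_const)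

lemma linear_eq_sum_Basis:
  fixes L :: "'e::euclidean_space \<Rightarrow> 'b::real_vector"
  assumes "linear L" shows "L u = (\<Sum>i\<in>Basis. (u \<bullet> i) *\<^sub>R L i)"
  by (subst euclidean_representation[symmetric])
    (simp only: linear_sum[OF assms] linear_cmul[OF assms])

text \<open>The chain rule evaluates the derivative of g in the direction
  \<open>fderiv f x u\<close>, which moves with x, while \<open>Ck_on\<close> controls fixed
  directions only. Expanding that direction in the basis of the intermediate space separates the
  two, and the induction hypothesis applies to each fixed direction.\<close>

lemma Ck_on_compose:
  fixes f :: "'a::real_normed_vector \<Rightarrow> 'e::euclidean_space"
  assumes S: "open S" and T: "open T" and m: "f ` S \<subseteq> T"
  shows "Ck_on k S f \<Longrightarrow> Ck_on k T g \<Longrightarrow> Ck_on k S (\<lambda>x. g (f x))"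
proof (induction k arbitrary: g)
  case 0
  then show ?case using continuous_on_compose2[of T g S f] m by simp
next
  case (Suc k)
  note d = Ck_on_differentiable[OF Suc.prems(1) S] Ck_on_differentiable[OF Suc.prems(2) T]
  have m': "x \<in> S \<Longrightarrow> f x \<in> T" for x using m by blast
  show ?case
  proof (rule Ck_on_SucI[OF S])
    have "Ck_on k S (\<lambda>x. \<Sum>i\<in>Basis. (fderiv f x u \<bullet> i) *\<^sub>R fderiv g (f x) i)" for u
      by (intro Ck_on_sum S Ck_on_bilinear[OF bounded_bilinear_scaleR]
          Ck_on_bounded_linear[OF bounded_linear_inner_left] Suc.IH)
        (use Suc.prems Suc.prems[THEN Ck_on_SucD] in simp_all)
    then show "Ck_on k S (\<lambda>x. fderiv (\<lambda>x. g (f x)) x u)" for u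
      by (rule Ck_on_cong[OF S, rotated])
        (simp add: fderiv_compose[OF d(1) d(2)[OF m']] m' linear_eq_sum_Basis[OF linear_fderiv[OF d(2)], symmetric])
  qed (rule differentiable_compose'[OF d(1) d(2)[OF m']])
qed

text \<open>The derivative -f'/f^2 contains 1/f only undifferentiated, so the induction on the order
  closes.\<close>

lemma Ck_on_inverse:
  fixes f :: "'a::real_normed_vector \<Rightarrow> real"
  assumes S: "open S" and nz: "\<And>x. x \<in> S \<Longrightarrow> f x \<noteq> 0"
  shows "Ck_on k S f \<Longrightarrow> Ck_on k S (\<lambda>x. inverse (f x))"
proof (induction k)
  case 0
  then have "continuous_on S f" by simp
  then have "continuous_on S (\<lambda>x. inverse (f x))"
    by (rule continuous_on_inverse) (blast dest: nz)
  then show ?case by simp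
next
  case (Suc k)
  note d = Ck_on_differentiable[OF Suc.prems S]
  note B = Ck_on_bilinear[OF bounded_bilinear_mult S]
  show ?case
  proof (rule Ck_on_SucI[OF S])
    have "Ck_on k S (\<lambda>x. (-1) * (inverse (f x) * fderiv f x u * inverse (f x)))" for u
      by (intro B Suc.IH Ck_on_const S) (use Suc.prems Suc.prems[THEN Ck_on_SucD] in simp_all)
    then show "Ck_on k S (\<lambda>x. fderiv (\<lambda>x. inverse (f x)) x u)" for u
    proof (rule Ck_on_cong[OF S, rotated])
      fix x assume "x \<in> S"
      from fderiv_eq[OF Deriv.has_derivative_inverse[OF nz[OF this] has_fderiv[OF d[OF this]]]]
      show "(-1) * (inverse (f x) * fderiv f x u * inverse (f x)) = fderiv (\<lambda>x. inverse (f x)) x u"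
        by simp
    qed
  qed (rule differentiable_inverse[OF d nz])
qed

lemma smooth_on_cong:
  "open S \<Longrightarrow> (\<And>x. x \<in> S \<Longrightarrow> f x = g x) \<Longrightarrow> smooth_on S f \<Longrightarrow> smooth_on S g"
  unfolding smooth_on_def using Ck_on_cong by metis

lemma smooth_on_fderiv: "smooth_on S f \<Longrightarrow> smooth_on S (\<lambda>x. fderiv f x u)"
  unfolding smooth_on_def by (metis Ck_on.simps(2))

lemma smooth_on_differentiable: "smooth_on S f \<Longrightarrow> open S \<Longrightarrow> x \<in> S \<Longrightarrow> f differentiable at x"
  unfolding smooth_on_def by (meson Ck_on_differentiable)

lemma smooth_on_subset: "smooth_on S f \<Longrightarrow> T \<subseteq> S \<Longrightarrow> smooth_on T f"
  unfolding smooth_on_def using Ck_on_subset by blast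

lemma smooth_on_const: "open S \<Longrightarrow> smooth_on S (\<lambda>_. c)"
  unfolding smooth_on_def using Ck_on_const by blast

lemma smooth_on_add: "open S \<Longrightarrow> smooth_on S f \<Longrightarrow> smooth_on S g \<Longrightarrow> smooth_on S (\<lambda>x. f x + g x)"
  unfolding smooth_on_def using Ck_on_add by blast

lemma smooth_on_bounded_linear:
  "bounded_linear L \<Longrightarrow> open S \<Longrightarrow> smooth_on S f \<Longrightarrow> smooth_on S (\<lambda>x. L (f x))"
  unfolding smooth_on_def using Ck_on_bounded_linear[of L S _ f] by simp

lemma smooth_on_bilinear:
  "bounded_bilinear B \<Longrightarrow> open S \<Longrightarrow> smooth_on S f \<Longrightarrow> smooth_on S g \<Longrightarrow>
    smooth_on S (\<lambda>x. B (f x) (g x))"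
  unfolding smooth_on_def using Ck_on_bilinear[of B S _ f g] by simp

lemma smooth_on_sum:
  "open S \<Longrightarrow> (\<And>i. i \<in> I \<Longrightarrow> smooth_on S (f i)) \<Longrightarrow> smooth_on S (\<lambda>x. \<Sum>i\<in>I. f i x)"
  unfolding smooth_on_def by (intro allI Ck_on_sum) auto

lemma smooth_on_compose:
  fixes f :: "'a::real_normed_vector \<Rightarrow> 'e::euclidean_space"
  shows "open S \<Longrightarrow> open T \<Longrightarrow> f ` S \<subseteq> T \<Longrightarrow> smooth_on S f \<Longrightarrow> smooth_on T g \<Longrightarrow>
    smooth_on S (\<lambda>x. g (f x))"
  unfolding smooth_on_def using Ck_on_compose[of S T f _ g] by simp

lemma smooth_on_inverse:
  fixes f :: "'a::real_normed_vector \<Rightarrow> real"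
  shows "open S \<Longrightarrow> (\<And>x. x \<in> S \<Longrightarrow> f x \<noteq> 0) \<Longrightarrow> smooth_on S f \<Longrightarrow> smooth_on S (\<lambda>x. inverse (f x))"
  unfolding smooth_on_def using Ck_on_inverse[of S f] by simp

lemma smooth_on_linear:
  assumes "bounded_linear L" "open S" shows "smooth_on S L"
  unfolding smooth_on_def
proof
  show "Ck_on k S L" for k
  proof (cases k)
    case 0
    then show ?thesis using assms(1) by (simp add: linear_continuous_on)
  next
    case (Suc m)
    have "Ck_on (Suc m) S L"
      by (rule Ck_on_SucI[OF assms(2)])
        (use assms in \<open>auto simp: fderiv_linear Ck_on_const intro: bounded_linear_imp_differentiable\<close>)
    then show ?thesis using Suc by simp
  qed
qed

lemma smooth_on_diff:
  "open S \<Longrightarrow> smooth_on S f \<Longrightarrow> smooth_on S g \<Longrightarrow> smooth_on S (\<lambda>x. f x - g x)"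
  using smooth_on_add[OF _ _ smooth_on_bounded_linear[OF bounded_linear_minus[OF bounded_linear_ident]], of S f g]
  by simp

lemma smooth_on_mult:
  fixes f g :: "_ \<Rightarrow> 'b::real_normed_algebra"
  shows "open S \<Longrightarrow> smooth_on S f \<Longrightarrow> smooth_on S g \<Longrightarrow> smooth_on S (\<lambda>x. f x * g x)"
  by (rule smooth_on_bilinear[OF bounded_bilinear_mult])

lemma smooth_on_prod:
  fixes f :: "'i \<Rightarrow> _ \<Rightarrow> real"
  shows "open S \<Longrightarrow> (\<And>i. i \<in> I \<Longrightarrow> smooth_on S (f i)) \<Longrightarrow> smooth_on S (\<lambda>x. \<Prod>i\<in>I. f i x)"
  by (induction I rule: infinite_finite_induct) (auto intro: smooth_on_mult smooth_on_const)

text \<open>Prepares Cramer's rule, by which the Christoffel symbols are shown to be smooth.\<close>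

lemma smooth_on_det:
  fixes M :: "'a::real_normed_vector \<Rightarrow> real ^ 'd ^ 'd"
  assumes "open S" "\<And>i j. smooth_on S (\<lambda>x. M x $ i $ j)"
  shows "smooth_on S (\<lambda>x. det (M x))"
  unfolding det_def
  by (intro smooth_on_sum smooth_on_mult smooth_on_prod smooth_on_const assms)

lemma smooth_on_vec:
  fixes f :: "'a::real_normed_vector \<Rightarrow> 'b::euclidean_space ^ 'd"
  assumes S: "open S" and f: "\<And>i. smooth_on S (\<lambda>x. f x $ i)"
  shows "smooth_on S f"
proof -
  have b: "bounded_linear (\<lambda>y. axis i y :: 'b ^ 'd)" for i
    by (auto simp: linear_conv_bounded_linear[symmetric] axis_def vec_eq_iff intro!: linearI)
  have "smooth_on S (\<lambda>x. \<Sum>i\<in>UNIV. axis i (f x $ i))"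
    by (intro smooth_on_sum smooth_on_bounded_linear[OF b] S f)
  moreover have "(\<Sum>i\<in>UNIV. axis i (f x $ i)) = f x" for x
    by (simp add: vec_eq_iff axis_def if_distrib cong: if_cong)
  ultimately show ?thesis by simp
qed

section \<open>Symmetry of second derivatives\<close>

lemma has_real_derivative_line:
  fixes f :: "'a::real_normed_vector \<Rightarrow> real"
  assumes "f differentiable at (a + s *\<^sub>R u)"
  shows "((\<lambda>s. f (a + s *\<^sub>R u)) has_real_derivative fderiv f (a + s *\<^sub>R u) u) (at s)"
proof -
  have "((\<lambda>s. a + s *\<^sub>R u) has_derivative (\<lambda>r. r *\<^sub>R u)) (at s)"
    by (auto intro!: derivative_eq_intros)
  from has_derivative_compose[OF this has_fderiv[OF assms]]
  have "((\<lambda>s. f (a + s *\<^sub>R u)) has_derivative (\<lambda>r. fderiv f (a + s *\<^sub>R u) (r *\<^sub>R u))) (at s)" .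
  moreover have "(\<lambda>r. fderiv f (a + s *\<^sub>R u) (r *\<^sub>R u)) = (*) (fderiv f (a + s *\<^sub>R u) u)"
    by (auto simp: linear_cmul[OF linear_fderiv[OF assms]])
  ultimately show ?thesis by (simp add: has_field_derivative_def)
qed

text \<open>Two applications of the mean value theorem, one along each side of the parallelogram
  spanned by h u and h w. The left-hand side is symmetric in u and w, the right-hand side is a mixed
  derivative in a fixed order; this is what makes the two orders comparable.\<close>

lemma second_difference_mvt:
  fixes f :: "'a::real_normed_vector \<Rightarrow> real"
  assumes S: "open S" and f: "Ck_on 2 S f" and h: "h > 0"
    and sub: "\<And>s t. s \<in> {0..h} \<Longrightarrow> t \<in> {0..h} \<Longrightarrow> x + s *\<^sub>R u + t *\<^sub>R w \<in> S"
  shows "\<exists>s\<in>{0..h}. \<exists>t\<in>{0..h}. f (x + h *\<^sub>R u + h *\<^sub>R w) - f (x + h *\<^sub>R u) - f (x + h *\<^sub>R w) + f x =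
     h * h * fderiv (\<lambda>y. fderiv f y u) (x + s *\<^sub>R u + t *\<^sub>R w) w"
proof -
  have d1: "f differentiable at y" if "y \<in> S" for y
    using Ck_on_differentiable[of 1 S f] f S that by (simp add: numeral_2_eq_2)
  have d2: "(\<lambda>y. fderiv f y u) differentiable at y" if "y \<in> S" for y
    using Ck_on_differentiable[of 0 S "\<lambda>y. fderiv f y u"] f S that by (simp add: numeral_2_eq_2)
  define g where "g s = f ((x + h *\<^sub>R w) + s *\<^sub>R u) - f (x + s *\<^sub>R u)" for s
  define g' where "g' s = fderiv f ((x + h *\<^sub>R w) + s *\<^sub>R u) u - fderiv f (x + s *\<^sub>R u) u" for s
  have "\<exists>s>0. s < h \<and> g h - g 0 = (h - 0) * g' s"
  proof (rule MVT2[OF h])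
    fix s assume s: "0 \<le> s" "s \<le> h"
    have "x + s *\<^sub>R u \<in> S" "(x + h *\<^sub>R w) + s *\<^sub>R u \<in> S"
      using sub[of s 0] sub[of s h] s h by (auto simp: algebra_simps)
    then show "(g has_real_derivative g' s) (at s)"
      unfolding g_def g'_def by (intro DERIV_diff has_real_derivative_line d1)
  qed
  then obtain s where s: "0 < s" "s < h" "g h - g 0 = h * g' s" by auto
  define k where "k t = fderiv f ((x + s *\<^sub>R u) + t *\<^sub>R w) u" for t
  define k' where "k' t = fderiv (\<lambda>y. fderiv f y u) ((x + s *\<^sub>R u) + t *\<^sub>R w) w" for t
  have "\<exists>t>0. t < h \<and> k h - k 0 = (h - 0) * k' t"
  proof (rule MVT2[OF h])
    fix t assume t: "0 \<le> t" "t \<le> h"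
    have "x + s *\<^sub>R u + t *\<^sub>R w \<in> S" using sub[of s t] s t by auto
    then show "(k has_real_derivative k' t) (at t)"
      unfolding k_def k'_def by (intro has_real_derivative_line d2)
  qed
  then obtain t where t: "0 < t" "t < h" "k h - k 0 = h * k' t" by auto
  have "f (x + h *\<^sub>R u + h *\<^sub>R w) - f (x + h *\<^sub>R u) - f (x + h *\<^sub>R w) + f x = g h - g 0"
    by (simp add: g_def algebra_simps)
  also have "\<dots> = h * (k h - k 0)" using s by (simp add: g'_def k_def algebra_simps)
  also have "\<dots> = h * h * k' t" using t by simp
  finally show ?thesis using s t unfolding k'_def by (intro bexI[of _ s] bexI[of _ t]) auto
qed

lemma fderiv_symmetric_real:
  fixes f :: "'a::real_normed_vector \<Rightarrow> real"
  assumes S: "open S" and x: "x \<in> S" and f: "Ck_on 2 S f"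
  shows "fderiv (\<lambda>y. fderiv f y u) x w = fderiv (\<lambda>y. fderiv f y w) x u"
proof (rule ccontr)
  define a where "a y = fderiv (\<lambda>y. fderiv f y u) y w" for y
  define b where "b y = fderiv (\<lambda>y. fderiv f y w) y u" for y
  assume "\<not> ?thesis"
  then have ne: "a x \<noteq> b x" by (simp add: a_def b_def)
  \<comment> \<open>Half of the supposed gap: a number closer than e to both \<open>a x\<close> and
    \<open>b x\<close> cannot exist.\<close>
  define e where "e = \<bar>a x - b x\<bar> / 2"
  have e: "e > 0" using ne by (simp add: e_def)
  have "continuous_on S a" "continuous_on S b"
    using f unfolding a_def b_def by (simp_all add: numeral_2_eq_2)
  then have "isCont a x" "isCont b x" using S x continuous_on_eq_continuous_at by blast+
  then obtain d1 d2 where d: "d1 > 0" "\<And>y. dist y x < d1 \<Longrightarrow> dist (a y) (a x) < e"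
    "d2 > 0" "\<And>y. dist y x < d2 \<Longrightarrow> dist (b y) (b x) < e"
    using e unfolding continuous_at_eps_delta by metis
  obtain d3 where d3: "d3 > 0" "ball x d3 \<subseteq> S" using S x open_contains_ball by blast
  define D where "D = Min {d1, d2, d3}"
  have D: "D > 0" "D \<le> d1" "D \<le> d2" "D \<le> d3" using d d3 by (auto simp: D_def)
  \<comment> \<open>The summand 1 keeps the denominator positive when u = w = 0. The factor makes h
    times (norm u + norm w) smaller than D, so the whole parallelogram stays within distance D of
    x.\<close>
  define h where "h = D / (2 * (1 + norm u + norm w))"
  have np: "1 + norm u + norm w > 0" by (smt (verit) norm_ge_zero)
  have h: "h > 0" using D np by (auto simp: h_def)
  have near: "dist (x + s *\<^sub>R u' + t *\<^sub>R w') x < D"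
    if "s \<in> {0..h}" "t \<in> {0..h}" "norm u' + norm w' = norm u + norm w" for s t u' w'
  proof -
    have "norm (s *\<^sub>R u' + t *\<^sub>R w') \<le> s * norm u' + t * norm w'"
      using norm_triangle_ineq[of "s *\<^sub>R u'" "t *\<^sub>R w'"] that by simp
    also have "\<dots> \<le> h * norm u' + h * norm w'"
      using that by (intro add_mono mult_right_mono) auto
    also have "\<dots> = h * (norm u + norm w)" using that by (metis distrib_left)
    also have "\<dots> < h * (2 * (1 + norm u + norm w))"
      using h by (intro mult_strict_left_mono) (smt (verit) norm_ge_zero)+
    also have "\<dots> = D" using np by (simp add: h_def)
    finally show ?thesis by (simp add: dist_norm add.assoc)
  qed
  have sub: "x + s *\<^sub>R u + t *\<^sub>R w \<in> S" "x + s *\<^sub>R w + t *\<^sub>R u \<in> S"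
    if "s \<in> {0..h}" "t \<in> {0..h}" for s t
    using near[OF that, of u w] near[OF that, of w u] d3 D by (auto simp: subset_eq dist_commute)
  obtain s t where st: "s \<in> {0..h}" "t \<in> {0..h}"
    "f (x + h *\<^sub>R u + h *\<^sub>R w) - f (x + h *\<^sub>R u) - f (x + h *\<^sub>R w) + f x = h * h * a (x + s *\<^sub>R u + t *\<^sub>R w)"
    using second_difference_mvt[OF S f h sub(1)] unfolding a_def by blast
  obtain s' t' where st': "s' \<in> {0..h}" "t' \<in> {0..h}"
    "f (x + h *\<^sub>R w + h *\<^sub>R u) - f (x + h *\<^sub>R w) - f (x + h *\<^sub>R u) + f x = h * h * b (x + s' *\<^sub>R w + t' *\<^sub>R u)"
    using second_difference_mvt[OF S f h sub(2)] unfolding b_def by blast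
  have "h * h * a (x + s *\<^sub>R u + t *\<^sub>R w) = h * h * b (x + s' *\<^sub>R w + t' *\<^sub>R u)"
    using st(3) st'(3) by (simp add: algebra_simps)
  then have eq: "a (x + s *\<^sub>R u + t *\<^sub>R w) = b (x + s' *\<^sub>R w + t' *\<^sub>R u)" using h by simp
  have "dist (a (x + s *\<^sub>R u + t *\<^sub>R w)) (a x) < e"
    by (rule d(2)) (use near[OF st(1,2), of u w] D in auto)
  moreover have "dist (b (x + s' *\<^sub>R w + t' *\<^sub>R u)) (b x) < e"
    by (rule d(4)) (use near[OF st'(1,2), of w u] D in auto)
  moreover have "\<bar>a x - b x\<bar> \<le> \<bar>c - a x\<bar> + \<bar>c - b x\<bar>" for c by linarith
  ultimately show False unfolding eq dist_real_def e_def by (smt (verit) field_sum_of_halves)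
qed

lemma fderiv_symmetric:
  fixes f :: "'a::real_normed_vector \<Rightarrow> 'b::euclidean_space"
  assumes S: "open S" and x: "x \<in> S" and f: "smooth_on S f"
  shows "fderiv (\<lambda>y. fderiv f y u) x w = fderiv (\<lambda>y. fderiv f y w) x u"
proof (rule euclidean_eqI)
  fix i :: 'b
  have "fderiv (\<lambda>y. fderiv f y u) x w \<bullet> i = fderiv (\<lambda>y. fderiv (\<lambda>z. f z \<bullet> i) y u) x w" for u w
  proof -
    have "fderiv (\<lambda>y. fderiv (\<lambda>z. f z \<bullet> i) y u) x w = fderiv (\<lambda>y. fderiv f y u \<bullet> i) x w"
      by (rule fun_cong[OF fderiv_cong[OF S x]])
        (simp add: fderiv_bounded_linear[OF bounded_linear_inner_left] smooth_on_differentiable[OF f S])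
    then show ?thesis
      by (simp add: fderiv_bounded_linear[OF bounded_linear_inner_left]
          smooth_on_differentiable[OF smooth_on_fderiv[OF f] S] x)
  qed
  moreover have "Ck_on 2 S (\<lambda>z. f z \<bullet> i)"
    using smooth_on_bounded_linear[OF bounded_linear_inner_left S f] by (simp add: smooth_on_def)
  ultimately show "fderiv (\<lambda>y. fderiv f y u) x w \<bullet> i = fderiv (\<lambda>y. fderiv f y w) x u \<bullet> i"
    using fderiv_symmetric_real[OF S x] by metis
qed

section \<open>Covariant derivatives along maps into a chart\<close>

lemma bilinear_expand:
  fixes h :: "real ^ 'd \<Rightarrow> real ^ 'd \<Rightarrow> 'c::real_vector"
  assumes "bilinear h"
  shows "h a b = (\<Sum>i\<in>UNIV. \<Sum>j\<in>UNIV. (a $ i * b $ j) *\<^sub>R h (axis i 1) (axis j 1))"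
proof -
  have e: "(\<Sum>i\<in>UNIV. x $ i *\<^sub>R axis i 1) = x" for x :: "real ^ 'd"
    using basis_expansion[of x] by (simp add: scalar_mult_eq_scaleR)
  have l: "linear (\<lambda>a. h a b)" "linear (h a)" for a b using assms by (auto simp: bilinear_def)
  have "h a b = h (\<Sum>i\<in>UNIV. a $ i *\<^sub>R axis i 1) (\<Sum>j\<in>UNIV. b $ j *\<^sub>R axis j 1)" by (simp only: e)
  also have "\<dots> = (\<Sum>i\<in>UNIV. a $ i *\<^sub>R h (axis i 1) (\<Sum>j\<in>UNIV. b $ j *\<^sub>R axis j 1))"
    by (simp only: linear_sum[OF l(1)] linear_cmul[OF l(1)])
  also have "\<dots> = (\<Sum>i\<in>UNIV. a $ i *\<^sub>R (\<Sum>j\<in>UNIV. b $ j *\<^sub>R h (axis i 1) (axis j 1)))"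
    by (simp only: linear_sum[OF l(2)] linear_cmul[OF l(2)])
  finally show ?thesis by (simp add: scaleR_sum_right)
qed

text \<open>H is differentiable in the base point only for fixed vector arguments, whereas here all
  three arguments move. Expansion in the standard basis turns the expression into a finite sum of
  scalar coefficients times functions with fixed arguments, and the product rule yields the three
  terms.\<close>

lemma bilinear_family_has_derivative:
  fixes H :: "real ^ 'd \<Rightarrow> real ^ 'd \<Rightarrow> real ^ 'd \<Rightarrow> 'c::euclidean_space"
    and F A B :: "'e::real_normed_vector \<Rightarrow> real ^ 'd"
  assumes V: "open V" and bil: "\<And>y. y \<in> V \<Longrightarrow> bilinear (H y)"
    and sm: "\<And>a b y. y \<in> V \<Longrightarrow> (\<lambda>y. H y a b) differentiable at y"
    and U: "open U" and x: "x \<in> U" and F: "\<And>x. x \<in> U \<Longrightarrow> F x \<in> V" "F differentiable at x"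
    and A: "A differentiable at x" and B: "B differentiable at x"
  shows "((\<lambda>x. H (F x) (A x) (B x)) has_derivative
    (\<lambda>u. H (F x) (fderiv A x u) (B x) + H (F x) (A x) (fderiv B x u) +
      fderiv (\<lambda>y. H y (A x) (B x)) (F x) (fderiv F x u))) (at x)"
proof -
  note Fx = F(1)[OF x]
  define h where "h i j y = H y (axis i 1) (axis j 1)" for i j y
  have h: "(h i j has_derivative fderiv (h i j) (F x)) (at (F x))" for i j
    unfolding h_def by (rule has_fderiv[OF sm[OF Fx]])
  have hF: "((\<lambda>x. h i j (F x)) has_derivative (\<lambda>u. fderiv (h i j) (F x) (fderiv F x u))) (at x)" for i j
    by (rule has_derivative_compose[OF has_fderiv[OF F(2)] h])
  have exp: "H y a b = (\<Sum>i\<in>UNIV. \<Sum>j\<in>UNIV. (a $ i * b $ j) *\<^sub>R h i j y)" if "y \<in> V" for y a b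
    unfolding h_def by (rule bilinear_expand[OF bil[OF that]])
  have Dexp: "fderiv (\<lambda>y. H y a b) (F x) v = (\<Sum>i\<in>UNIV. \<Sum>j\<in>UNIV. (a $ i * b $ j) *\<^sub>R fderiv (h i j) (F x) v)"
    for a b v
  proof -
    have "((\<lambda>y. \<Sum>i\<in>UNIV. \<Sum>j\<in>UNIV. (a $ i * b $ j) *\<^sub>R h i j y) has_derivative
      (\<lambda>v. \<Sum>i\<in>UNIV. \<Sum>j\<in>UNIV. (a $ i * b $ j) *\<^sub>R fderiv (h i j) (F x) v)) (at (F x))"
      by (intro has_derivative_sum has_derivative_scaleR_right h)
    then have "((\<lambda>y. H y a b) has_derivative
      (\<lambda>v. \<Sum>i\<in>UNIV. \<Sum>j\<in>UNIV. (a $ i * b $ j) *\<^sub>R fderiv (h i j) (F x) v)) (at (F x))"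
      by (rule has_derivative_transform_within_open[OF _ V Fx]) (simp add: exp)
    then show ?thesis by (rule fderiv_eq)
  qed
  have c: "((\<lambda>x. A x $ i * B x $ j) has_derivative
      (\<lambda>u. A x $ i * fderiv B x u $ j + fderiv A x u $ i * B x $ j)) (at x)" for i j
    by (intro has_derivative_mult bounded_linear.has_derivative[OF bounded_linear_vec_nth] has_fderiv A B)
  have "((\<lambda>x. \<Sum>i\<in>UNIV. \<Sum>j\<in>UNIV. (A x $ i * B x $ j) *\<^sub>R h i j (F x)) has_derivative
      (\<lambda>u. \<Sum>i\<in>UNIV. \<Sum>j\<in>UNIV. (A x $ i * B x $ j) *\<^sub>R fderiv (h i j) (F x) (fderiv F x u) +
         (A x $ i * fderiv B x u $ j + fderiv A x u $ i * B x $ j) *\<^sub>R h i j (F x))) (at x)"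
    by (intro has_derivative_sum has_derivative_scaleR c hF)
  moreover have "(\<Sum>i\<in>UNIV. \<Sum>j\<in>UNIV. (A x $ i * B x $ j) *\<^sub>R fderiv (h i j) (F x) (fderiv F x u) +
         (A x $ i * fderiv B x u $ j + fderiv A x u $ i * B x $ j) *\<^sub>R h i j (F x)) =
     H (F x) (fderiv A x u) (B x) + H (F x) (A x) (fderiv B x u) +
      fderiv (\<lambda>y. H y (A x) (B x)) (F x) (fderiv F x u)" for u
    unfolding Dexp exp[OF Fx] by (simp add: sum.distrib algebra_simps)
  ultimately have "((\<lambda>x. \<Sum>i\<in>UNIV. \<Sum>j\<in>UNIV. (A x $ i * B x $ j) *\<^sub>R h i j (F x)) has_derivative
    (\<lambda>u. H (F x) (fderiv A x u) (B x) + H (F x) (A x) (fderiv B x u) +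
      fderiv (\<lambda>y. H y (A x) (B x)) (F x) (fderiv F x u))) (at x)" by simp
  then show ?thesis
    by (rule has_derivative_transform_within_open[OF _ U x]) (simp add: exp F(1))
qed

lemma smooth_on_bilinear_family:
  fixes H :: "real ^ 'd \<Rightarrow> real ^ 'd \<Rightarrow> real ^ 'd \<Rightarrow> 'c::euclidean_space"
    and F A B :: "'e::real_normed_vector \<Rightarrow> real ^ 'd"
  assumes V: "open V" and bil: "\<And>y. y \<in> V \<Longrightarrow> bilinear (H y)"
    and sm: "\<And>a b. smooth_on V (\<lambda>y. H y a b)"
    and U: "open U" and FV: "F ` U \<subseteq> V" and F: "smooth_on U F" and A: "smooth_on U A" and B: "smooth_on U B"
  shows "smooth_on U (\<lambda>x. H (F x) (A x) (B x))"
proof -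
  have "smooth_on U (\<lambda>x. \<Sum>i\<in>UNIV. \<Sum>j\<in>UNIV. (A x $ i * B x $ j) *\<^sub>R H (F x) (axis i 1) (axis j 1))"
    by (intro smooth_on_sum smooth_on_bilinear[OF bounded_bilinear_scaleR] smooth_on_mult U
        smooth_on_bounded_linear[OF bounded_linear_vec_nth U A]
        smooth_on_bounded_linear[OF bounded_linear_vec_nth U B] smooth_on_compose[OF U V FV F sm])
  then show ?thesis
    by (rule smooth_on_cong[OF U, rotated]) (use FV in \<open>auto intro!: bilinear_expand[OF bil, symmetric]\<close>)
qed

section \<open>The Levi-Civita connection in a single chart\<close>

locale metric_chart =
  fixes V :: "(real ^ 'd::finite) set" and G :: "real ^ 'd \<Rightarrow> real ^ 'd \<Rightarrow> real ^ 'd \<Rightarrow> real"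
  assumes open_V: "open V"
    and bil: "y \<in> V \<Longrightarrow> bilinear (G y)"
    and sym: "y \<in> V \<Longrightarrow> G y u w = G y w u"
    and pos: "y \<in> V \<Longrightarrow> u \<noteq> 0 \<Longrightarrow> G y u u > 0"
    and smooth_G: "smooth_on V (\<lambda>y. G y u w)"
begin

abbreviation \<Gamma> :: "real ^ 'd \<Rightarrow> real ^ 'd \<Rightarrow> real ^ 'd \<Rightarrow> real ^ 'd" where "\<Gamma> \<equiv> christoffel G"

lemma diff_G: "y \<in> V \<Longrightarrow> (\<lambda>y. G y u w) differentiable at y"
  by (rule smooth_on_differentiable[OF smooth_G open_V])

lemma levi_civita_ex1: "y \<in> V \<Longrightarrow> \<exists>!\<Gamma>. levi_civita_at G y \<Gamma>"
  by (rule levi_civita_unique_existence[OF open_V _ bil sym pos diff_G])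

lemma levi_civita: "y \<in> V \<Longrightarrow> levi_civita_at G y (\<Gamma> y)"
  unfolding christoffel_def using theI'[OF levi_civita_ex1] .

lemma bil_\<Gamma>: "y \<in> V \<Longrightarrow> bilinear (\<Gamma> y)"
  and \<Gamma>_sym: "y \<in> V \<Longrightarrow> \<Gamma> y u w = \<Gamma> y w u"
  and fderiv_G: "y \<in> V \<Longrightarrow> fderiv (\<lambda>y. G y w z) y u = G y (\<Gamma> y u w) z + G y w (\<Gamma> y u z)"
  using levi_civita unfolding levi_civita_at_def by blast+

lemma G_add: "y \<in> V \<Longrightarrow> G y (a + b) c = G y a c + G y b c" "y \<in> V \<Longrightarrow> G y c (a + b) = G y c a + G y c b"
  and G_diff: "y \<in> V \<Longrightarrow> G y (a - b) c = G y a c - G y b c" "y \<in> V \<Longrightarrow> G y c (a - b) = G y c a - G y c b"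
  and G_scale: "y \<in> V \<Longrightarrow> G y (r *\<^sub>R a) c = r * G y a c" "y \<in> V \<Longrightarrow> G y c (r *\<^sub>R a) = r * G y c a"
  and G_neg: "y \<in> V \<Longrightarrow> G y (- a) c = - G y a c" "y \<in> V \<Longrightarrow> G y c (- a) = - G y c a"
  using bil by (simp_all add: bilinear_ladd bilinear_radd bilinear_lsub bilinear_rsub
      bilinear_lmul bilinear_rmul bilinear_lneg bilinear_rneg)

lemma \<Gamma>_add: "y \<in> V \<Longrightarrow> \<Gamma> y (a + b) c = \<Gamma> y a c + \<Gamma> y b c" "y \<in> V \<Longrightarrow> \<Gamma> y c (a + b) = \<Gamma> y c a + \<Gamma> y c b"
  and \<Gamma>_scale: "y \<in> V \<Longrightarrow> \<Gamma> y (r *\<^sub>R a) c = r *\<^sub>R \<Gamma> y a c" "y \<in> V \<Longrightarrow> \<Gamma> y c (r *\<^sub>R a) = r *\<^sub>R \<Gamma> y c a"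
  using bil_\<Gamma> by (simp_all add: bilinear_ladd bilinear_radd bilinear_lsub bilinear_rsub
      bilinear_lmul bilinear_rmul)

lemma G_nondegenerate: "y \<in> V \<Longrightarrow> (\<And>z. G y a z = G y b z) \<Longrightarrow> a = b"
  using pos[of y "a - b"] G_diff(1)[of y a b] by (metis cancel_comm_monoid_add_class.diff_cancel eq_iff_diff_eq_0 less_irrefl)

lemma koszul:
  assumes "y \<in> V"
  shows "G y (\<Gamma> y u w) z =
    (fderiv (\<lambda>y. G y w z) y u + fderiv (\<lambda>y. G y u z) y w - fderiv (\<lambda>y. G y u w) y z) / 2"
  using assms \<Gamma>_sym[of y z u] \<Gamma>_sym[of y w u] \<Gamma>_sym[of y z w] sym[of y w "\<Gamma> y u z"] by (simp add: fderiv_G)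

text \<open>\<open>christoffel\<close> is a definite description, so smoothness needs a formula. The
  Koszul identity says that \<Gamma>(u, w) solves a linear system whose matrix is the Gram matrix of
  the metric; positive definiteness makes its determinant nonzero, and Cramer's rule writes the
  components as quotients of smooth functions.\<close>

lemma smooth_\<Gamma>: "smooth_on V (\<lambda>y. \<Gamma> y u w)"
proof -
  define M :: "real ^ 'd \<Rightarrow> real ^ 'd ^ 'd" where "M y = (\<chi> k l. G y (axis l 1) (axis k 1))" for y
  define b :: "real ^ 'd \<Rightarrow> real ^ 'd" where
    "b y = (\<chi> k. (fderiv (\<lambda>y. G y w (axis k 1)) y u + fderiv (\<lambda>y. G y u (axis k 1)) y w
       + (-1) * fderiv (\<lambda>y. G y u w) y (axis k 1)) * (1 / 2))" for y
  have Mv: "(M y *v a) $ k = G y a (axis k 1)" if "y \<in> V" for y a k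
  proof -
    have l: "linear (\<lambda>a. G y a (axis k 1))" using bil[OF that] by (simp add: bilinear_def)
    have "G y a (axis k 1) = G y (\<Sum>l\<in>UNIV. a $ l *\<^sub>R axis l 1) (axis k 1)"
      using basis_expansion[of a] by (simp add: scalar_mult_eq_scaleR)
    also have "\<dots> = (\<Sum>l\<in>UNIV. a $ l *\<^sub>R G y (axis l 1) (axis k 1))"
      by (simp only: linear_sum[OF l] linear_cmul[OF l])
    finally show ?thesis by (simp add: M_def matrix_vector_mult_def mult.commute)
  qed
  have M\<Gamma>: "M y *v \<Gamma> y u w = b y" if "y \<in> V" for y
    using that by (simp add: vec_eq_iff Mv koszul b_def)
  have det: "det (M y) \<noteq> 0" if "y \<in> V" for y
  proof -
    have "a = 0" if "M y *v a = 0" for a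
    proof -
      have 0: "G y a (axis k 1) = 0" for k using that Mv[OF \<open>y \<in> V\<close>, of a k] by simp
      have l: "linear (G y a)" using bil[OF \<open>y \<in> V\<close>] by (simp add: bilinear_def)
      have "G y a a = G y a (\<Sum>k\<in>UNIV. a $ k *\<^sub>R axis k 1)"
        using basis_expansion[of a] by (simp add: scalar_mult_eq_scaleR)
      also have "\<dots> = 0" by (simp only: linear_sum[OF l] linear_cmul[OF l] 0) simp
      finally have "G y a a = 0" .
      then show ?thesis using pos[OF \<open>y \<in> V\<close>, of a] by force
    qed
    then show ?thesis
      unfolding invertible_det_nz[symmetric] invertible_left_inverse matrix_left_invertible_ker by blast
  qed
  have sM: "smooth_on V (\<lambda>y. M y $ k $ l)" for k l by (simp add: M_def smooth_G)
  have sb: "smooth_on V (\<lambda>y. b y $ k)" for k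
    unfolding b_def vec_lambda_beta
    by (intro smooth_on_mult smooth_on_add smooth_on_const open_V smooth_on_fderiv smooth_G)
  have "smooth_on V (\<lambda>y. (\<chi> k. det (\<chi> i j. if j = k then b y $ i else M y $ i $ j) * inverse (det (M y))) :: real ^ 'd)"
  proof (rule smooth_on_vec[OF open_V])
    fix k
    have "smooth_on V (\<lambda>y. (\<chi> i j. if j = k then b y $ i else M y $ i $ j) $ i $ j)" for i j
      by (cases "j = k") (simp_all add: sb sM)
    then show "smooth_on V (\<lambda>y. (\<chi> k. det (\<chi> i j. if j = k then b y $ i else M y $ i $ j) * inverse (det (M y))) $ k)"
      unfolding vec_lambda_beta
      by (intro smooth_on_mult smooth_on_inverse smooth_on_det open_V det sM) auto
  qed
  then show ?thesis
  proof (rule smooth_on_cong[OF open_V, rotated])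
    fix y assume "y \<in> V"
    show "(\<chi> k. det (\<chi> i j. if j = k then b y $ i else M y $ i $ j) * inverse (det (M y))) = \<Gamma> y u w"
      using cramer[OF det[OF \<open>y \<in> V\<close>], of "\<Gamma> y u w" "b y"] M\<Gamma>[OF \<open>y \<in> V\<close>] by (simp add: divide_inverse)
  qed
qed

lemma diff_\<Gamma>: "y \<in> V \<Longrightarrow> (\<lambda>y. \<Gamma> y u w) differentiable at y"
  by (rule smooth_on_differentiable[OF smooth_\<Gamma> open_V])

lemma curvature_eq:
  "curvature \<Gamma> y u w z = - (fderiv (\<lambda>y. \<Gamma> y w z) y u + \<Gamma> y u (\<Gamma> y w z)
     - (fderiv (\<lambda>y. \<Gamma> y u z) y w + \<Gamma> y w (\<Gamma> y u z)))"
proof -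
  have "cov \<Gamma> (\<lambda>y. y) u (\<lambda>_. z) = (\<lambda>y. \<Gamma> y u z)" for u
    by (rule ext) (simp add: cov_def fderiv_linear[OF bounded_linear_ident])
  then show ?thesis
    by (simp add: curvature_def cov_def fderiv_linear[OF bounded_linear_ident])
qed

end

section \<open>The pulled-back connection along a map\<close>

locale map_into_chart = metric_chart V G
  for V :: "(real ^ 'd::finite) set" and G +
  fixes U :: "'e::euclidean_space set" and F :: "'e \<Rightarrow> real ^ 'd"
  assumes open_U: "open U" and smooth_F: "smooth_on U F" and FV: "x \<in> U \<Longrightarrow> F x \<in> V"
begin

lemma diff: "smooth_on U f \<Longrightarrow> x \<in> U \<Longrightarrow> f differentiable at x"
  by (rule smooth_on_differentiable[OF _ open_U])

lemmas diff_F = diff[OF smooth_F]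

lemma smooth_G_along: "smooth_on U A \<Longrightarrow> smooth_on U B \<Longrightarrow> smooth_on U (\<lambda>x. G (F x) (A x) (B x))"
  by (rule smooth_on_bilinear_family[OF open_V bil smooth_G open_U]) (use FV smooth_F in auto)

lemma smooth_\<Gamma>_along: "smooth_on U A \<Longrightarrow> smooth_on U B \<Longrightarrow> smooth_on U (\<lambda>x. \<Gamma> (F x) (A x) (B x))"
  by (rule smooth_on_bilinear_family[OF open_V bil_\<Gamma> smooth_\<Gamma> open_U]) (use FV smooth_F in auto)

abbreviation cv :: "'e \<Rightarrow> ('e \<Rightarrow> real ^ 'd) \<Rightarrow> 'e \<Rightarrow> real ^ 'd" where "cv \<equiv> cov \<Gamma> F"
abbreviation DF :: "'e \<Rightarrow> 'e \<Rightarrow> real ^ 'd" where "DF u \<equiv> \<lambda>x. fderiv F x u"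

lemma smooth_DF: "smooth_on U (DF u)"
  by (rule smooth_on_fderiv[OF smooth_F])

lemma smooth_cv: "smooth_on U A \<Longrightarrow> smooth_on U (cv u A)"
  unfolding cov_def
  by (intro smooth_on_add smooth_on_fderiv smooth_\<Gamma>_along smooth_F open_U)

lemma cv_cong: "x \<in> U \<Longrightarrow> (\<And>y. y \<in> U \<Longrightarrow> A y = B y) \<Longrightarrow> cv u A x = cv u B x"
  unfolding cov_def using fderiv_cong[OF open_U, of x A B] by simp

lemma cv_linear:
  assumes "x \<in> U" "A differentiable at x" shows "linear (\<lambda>u. cv u A x)"
  unfolding cov_def
  using linear_fderiv[OF assms(2)] linear_fderiv[OF diff_F[OF assms(1)]] FV[OF assms(1)]
  by (intro linearI) (simp_all add: linear_add linear_cmul \<Gamma>_add \<Gamma>_scale algebra_simps)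

lemma fderiv_G_along:
  assumes x: "x \<in> U" and A: "A differentiable at x" and B: "B differentiable at x"
  shows "fderiv (\<lambda>x. G (F x) (A x) (B x)) x u = G (F x) (cv u A x) (B x) + G (F x) (A x) (cv u B x)"
  by (subst fderiv_eq[OF bilinear_family_has_derivative[OF open_V bil diff_G open_U x FV diff_F[OF x] A B]])
    (simp_all add: cov_def fderiv_G G_add FV[OF x])

lemma fderiv_\<Gamma>_along:
  assumes x: "x \<in> U" and A: "A differentiable at x" and B: "B differentiable at x"
  shows "fderiv (\<lambda>x. \<Gamma> (F x) (A x) (B x)) x u = \<Gamma> (F x) (fderiv A x u) (B x) + \<Gamma> (F x) (A x) (fderiv B x u) +
     fderiv (\<lambda>y. \<Gamma> y (A x) (B x)) (F x) (fderiv F x u)"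
  by (subst fderiv_eq[OF bilinear_family_has_derivative[OF open_V bil_\<Gamma> diff_\<Gamma> open_U x FV diff_F[OF x] A B]]) simp_all

lemma torsion_free: "x \<in> U \<Longrightarrow> cv u (DF w) x = cv w (DF u) x"
  unfolding cov_def using fderiv_symmetric[OF open_U _ smooth_F] \<Gamma>_sym[OF FV] by simp

text \<open>The pulled-back connection has the pulled-back curvature. After full expansion the
  second derivatives of A and F and the mixed first-order products are symmetric in u and w and
  cancel; what remains is the coordinate formula of the curvature. The minus sign comes from the
  convention in \<open>curvature\<close>.\<close>

lemma ricci_identity:
  assumes x: "x \<in> U" and A: "smooth_on U A"
  shows "cv u (cv w A) x - cv w (cv u A) x = - curvature \<Gamma> (F x) (DF u x) (DF w x) (A x)"
proof -
  have "cv u (cv w A) x = fderiv (\<lambda>y. fderiv A y w) x u +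
     (\<Gamma> (F x) (fderiv (DF w) x u) (A x) + \<Gamma> (F x) (DF w x) (fderiv A x u)
      + fderiv (\<lambda>y. \<Gamma> y (DF w x) (A x)) (F x) (DF u x))
     + (\<Gamma> (F x) (DF u x) (fderiv A x w) + \<Gamma> (F x) (DF u x) (\<Gamma> (F x) (DF w x) (A x)))" for u w
  proof -
    have "fderiv (cv w A) x u = fderiv (\<lambda>y. fderiv A y w) x u + fderiv (\<lambda>y. \<Gamma> (F y) (DF w y) (A y)) x u"
      unfolding cov_def by (intro fderiv_add diff[OF _ x] smooth_on_fderiv A smooth_\<Gamma>_along smooth_F)
    then show ?thesis
      by (simp add: cov_def[of _ _ u] fderiv_\<Gamma>_along[OF x diff[OF smooth_DF x] diff[OF A x]])
        (simp add: cov_def \<Gamma>_add FV[OF x])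
  qed
  then show ?thesis
    using fderiv_symmetric[OF open_U x A, of u w] fderiv_symmetric[OF open_U x smooth_F, of u w]
    by (simp add: curvature_eq)
qed

end

section \<open>Curvature of space forms\<close>

text \<open>Polarisation: a tensor with curvature symmetries is determined by its diagonal values.
  The Bianchi identity and the two skew symmetries give the pair symmetry. Replacing u by u + z in
  the diagonal gives \<open>Q u w z w = 0\<close>, and then w by w + t makes Q skew under exchange
  of its second and fourth arguments. Together with the other symmetries this makes Q invariant
  under cyclic permutation of the first three, so the Bianchi identity reads 3 Q = 0.\<close>

lemma algebraic_curvature_zero:
  fixes Q :: "'v::real_vector \<Rightarrow> 'v \<Rightarrow> 'v \<Rightarrow> 'v \<Rightarrow> real"
  assumes add: "\<And>a b w z t. Q (a + b) w z t = Q a w z t + Q b w z t"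
    and anti: "\<And>u w z t. Q u w z t = - Q w u z t" and skew: "\<And>u w z t. Q u w z t = - Q u w t z"
    and bianchi: "\<And>u w z t. Q u w z t + Q w z u t + Q z u w t = 0"
    and diag: "\<And>u w. Q u w u w = 0"
  shows "Q u w z t = 0"
proof -
  have pair: "Q u w z t = Q z t u w" for u w z t
    using bianchi[of u w z t] bianchi[of w z t u] bianchi[of z t u w] bianchi[of t u w z]
      anti[of u w t z] anti[of z u w t] anti[of w z t u] anti[of t w z u] anti[of t u w z] anti[of u z t w]
      anti[of z t u w] anti[of z t w u] anti[of t w u z] anti[of w t u z] anti[of u z w t] anti[of t u z w] anti[of u t z w]
      skew[of u w z t] skew[of w z u t] skew[of z u w t] skew[of z t w u] skew[of t w z u] skew[of t u w z]
      skew[of u w t z] skew[of w t u z] skew[of z t u w] skew[of t u z w] skew[of u z t w] skew[of u t z w]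
    by linarith
  have add2: "Q u (a + b) z t = Q u a z t + Q u b z t" for u a b z t
    using anti[of u "a + b" z t] anti[of u a z t] anti[of u b z t] add[of a b u z t] by linarith
  have 1: "Q u w z w = 0" for u w z
    using diag[of "u + z" w] pair[of u w z w] diag[of u w] diag[of z w]
      pair[of "u + z" w u w] pair[of "u + z" w z w] add[of u z w "u + z" w]
      pair[of u w "u + z" w] pair[of z w "u + z" w] add[of u z w u w] add[of u z w z w] by linarith
  have 2: "Q u w z t = - Q u t z w" for u w z t
    using 1[of u "w + t" z] 1[of u w z] 1[of u t z] add2[of u w t z "w + t"]
      pair[of u w z "w + t"] pair[of u t z "w + t"] add2[of z w t u w] add2[of z w t u t]
      pair[of u w z t] pair[of u t z w] pair[of u w z w] pair[of u t z t] by linarith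
  have "Q w z u t = Q u w z t" "Q z u w t = Q u w z t"
    using 2[of w z u t] anti[of w t u z] 2[of t w u z] skew[of u w z t]
      pair[of u w z t] pair[of w z u t] 2[of u w z t] anti[of u w z t] skew[of w z u t] anti[of z u w t] 2[of u z w t]
      2[of w u z t] anti[of w t z u] skew[of w t z u] skew[of u t w z] pair[of w t u z] pair[of u t w z]
      anti[of u t z w] 2[of t u z w] 2[of z u w t] skew[of u z t w] pair[of u z w t] anti[of w z u t]
    by linarith+
  then show ?thesis using bianchi[of u w z t] by linarith
qed

context map_into_chart
begin

text \<open>The second derivatives of the function G(A, B) commute. Expanding both orders by metric
  compatibility, the products of first derivatives cancel and only the commutators on A and on B
  survive.\<close>

lemma curvature_skew:
  assumes x: "x \<in> U" and A: "smooth_on U A" and B: "smooth_on U B"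
  shows "G (F x) (curvature \<Gamma> (F x) (DF u x) (DF w x) (A x)) (B x) =
     - G (F x) (A x) (curvature \<Gamma> (F x) (DF u x) (DF w x) (B x))"
proof -
  note s = A B smooth_cv[OF A] smooth_cv[OF B]
  note d = s[THEN diff, OF x]
  have "fderiv (\<lambda>y. fderiv (\<lambda>x. G (F x) (A x) (B x)) y w) x u =
      G (F x) (cv u (cv w A) x) (B x) + G (F x) (cv w A x) (cv u B x) +
      (G (F x) (cv u A x) (cv w B x) + G (F x) (A x) (cv u (cv w B) x))" for u w
  proof -
    have "fderiv (\<lambda>y. fderiv (\<lambda>x. G (F x) (A x) (B x)) y w) x u =
       fderiv (\<lambda>y. G (F y) (cv w A y) (B y) + G (F y) (A y) (cv w B y)) x u"
      by (rule fun_cong[OF fderiv_cong[OF open_U x]]) (rule fderiv_G_along[OF _ A[THEN diff] B[THEN diff]])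
    also have "\<dots> = fderiv (\<lambda>y. G (F y) (cv w A y) (B y)) x u + fderiv (\<lambda>y. G (F y) (A y) (cv w B y)) x u"
      by (intro fderiv_add diff[OF _ x] smooth_G_along s)
    finally show ?thesis by (simp only: fderiv_G_along[OF x] d)
  qed
  from this[of u w] this[of w u] fderiv_symmetric[OF open_U x smooth_G_along[OF A B], of u w]
  have "G (F x) (cv u (cv w A) x - cv w (cv u A) x) (B x) + G (F x) (A x) (cv u (cv w B) x - cv w (cv u B) x) = 0"
    by (simp add: G_diff FV[OF x])
  then show ?thesis unfolding ricci_identity[OF x A] ricci_identity[OF x B] by (simp add: G_neg FV[OF x])
qed

end

locale space_form_chart = metric_chart +
  fixes K :: real
  assumes sectional: "y \<in> V \<Longrightarrow> u \<noteq> w \<Longrightarrow> independent {u, w} \<Longrightarrow> sectional_curvature G y u w = K"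
begin

text \<open>Q below is the difference between the curvature tensor and the model tensor of curvature
  K. Both have the curvature symmetries, and the hypothesis on sectional curvatures makes Q vanish
  on the diagonal, so polarisation applies.\<close>

lemma curvature_space_form:
  assumes y: "y \<in> V"
  shows "curvature \<Gamma> y u w z = K *\<^sub>R (G y u z *\<^sub>R w - G y w z *\<^sub>R u)"
proof -
  let ?R = "curvature \<Gamma> y"
  \<comment> \<open>Taking the identity as the map and constant fields along it turns the skewness
    proved along maps into skewness of the curvature tensor itself.\<close>
  interpret I: map_into_chart V G V "\<lambda>y. y"
    by unfold_locales (use open_V smooth_on_linear[OF bounded_linear_ident] in auto)
  have fid: "fderiv (\<lambda>y::real^'a. y) x u = u" for x u by (rule fderiv_linear[OF bounded_linear_ident])
  define T where "T u w z = fderiv (\<lambda>y. \<Gamma> y w z) y u" for u w z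
  have R: "?R u w z = - (T u w z + \<Gamma> y u (\<Gamma> y w z) - (T w u z + \<Gamma> y w (\<Gamma> y u z)))" for u w z
    by (simp add: curvature_eq T_def)
  have T1: "T (a + b) w z = T a w z + T b w z" "T (r *\<^sub>R a) w z = r *\<^sub>R T a w z" for a b w z r
    using linear_fderiv[OF diff_\<Gamma>[OF y]] by (simp_all add: T_def linear_add linear_cmul)
  have T2: "T u (a + b) z = T u a z + T u b z" for u a b z
  proof -
    have "T u (a + b) z = fderiv (\<lambda>y. \<Gamma> y a z + \<Gamma> y b z) y u"
      unfolding T_def by (rule fun_cong[OF fderiv_cong[OF open_V y]]) (simp add: \<Gamma>_add)
    then show ?thesis by (simp add: fderiv_add[OF diff_\<Gamma>[OF y] diff_\<Gamma>[OF y]] T_def)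
  qed
  have T2': "T u (r *\<^sub>R a) z = r *\<^sub>R T u a z" for u a z r
  proof -
    have "T u (r *\<^sub>R a) z = fderiv (\<lambda>y. r *\<^sub>R \<Gamma> y a z) y u"
      unfolding T_def by (rule fun_cong[OF fderiv_cong[OF open_V y]]) (simp add: \<Gamma>_scale)
    then show ?thesis by (simp add: fderiv_bounded_linear[OF bounded_linear_scaleR_right diff_\<Gamma>[OF y]] T_def)
  qed
  have Ts: "T u w z = T u z w" for u w z
    unfolding T_def by (rule fun_cong[OF fderiv_cong[OF open_V y]]) (rule \<Gamma>_sym)
  have Radd: "?R (a + b) w z = ?R a w z + ?R b w z" for a b w z
    unfolding R by (simp add: T1 T2 \<Gamma>_add y)
  have Rscale: "?R (r *\<^sub>R a) w z = r *\<^sub>R ?R a w z" for a r w z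
    unfolding R by (simp add: T1 T2' \<Gamma>_scale y algebra_simps)
  have Ranti: "?R u w z = - ?R w u z" for u w z unfolding R by simp
  have Rbianchi: "?R u w z + ?R w z u + ?R z u w = 0" for u w z
    unfolding R using Ts[of u w z] Ts[of w z u] Ts[of z u w] by (simp add: \<Gamma>_sym[OF y, of w z] \<Gamma>_sym[OF y, of u z] \<Gamma>_sym[OF y, of u w])
  have Rskew: "G y (?R u w z) t = - G y (?R u w t) z" for u w z t
    using I.curvature_skew[OF y smooth_on_const[OF open_V] smooth_on_const[OF open_V], of u w z t]
    by (simp add: fid sym[OF y])
  define Q where "Q u w z t = G y (?R u w z) t - K * (G y u z * G y w t - G y w z * G y u t)" for u w z t
  have "Q u w z t = 0" for u w z t
  proof (rule algebraic_curvature_zero[of Q])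
    show "Q (a + b) w z t = Q a w z t + Q b w z t" for a b w z t
      unfolding Q_def by (simp add: Radd G_add y algebra_simps)
    show "Q u w z t = - Q w u z t" for u w z t
      unfolding Q_def using Ranti[of u w z] by (simp add: G_neg y algebra_simps)
    show "Q u w z t = - Q u w t z" for u w z t
      unfolding Q_def using Rskew[of u w z t] by (simp add: algebra_simps)
    show "Q u w z t + Q w z u t + Q z u w t = 0" for u w z t
    proof -
      have "G y (?R u w z) t + G y (?R w z u) t + G y (?R z u w) t = 0"
        using Rbianchi[of u w z] bilinear_lzero[OF bil[OF y], of t] by (metis G_add(1) y)
      then show ?thesis unfolding Q_def using sym[OF y] by (simp add: algebra_simps)
    qed
    show "Q u w u w = 0" for u w
    proof -
      have Q0: "Q (r *\<^sub>R w) w z t = 0" for r z t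
        unfolding Q_def Rscale by (simp add: R G_scale y bilinear_lzero[OF bil[OF y]])
      show ?thesis
      proof (cases "w = 0")
        case True
        then show ?thesis by (simp add: Q_def bilinear_rzero[OF bil[OF y]] bilinear_lzero[OF bil[OF y]])
      next
        case w: False
        show ?thesis
        proof (cases "u \<in> span {w}")
          case True
          then show ?thesis using Q0 by (auto simp: span_singleton)
        next
          case False
          then have ne: "u \<noteq> w" and ind: "independent {u, w}"
            using w by (auto simp: span_base independent_insert)
          \<comment> \<open>c w is the projection of u to the line of w. Positivity of the squared
            length of u - c w is the strict Cauchy-Schwarz inequality, so the denominator of the
            sectional curvature is nonzero and can be cleared.\<close>
          define c where "c = G y u w / G y w w"
          have "u - c *\<^sub>R w \<noteq> 0" using False by (auto simp: span_singleton)
          then have "0 < G y (u - c *\<^sub>R w) (u - c *\<^sub>R w)" by (rule pos[OF y])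
          also have "\<dots> = G y u u - (G y u w)\<^sup>2 / G y w w"
            using pos[OF y w] sym[OF y, of w u] by (simp add: G_diff G_scale y c_def field_simps power2_eq_square)
          finally have "G y u u * G y w w - (G y u w)\<^sup>2 \<noteq> 0" using pos[OF y w] by (simp add: field_simps)
          then have "G y (?R u w u) w = K * (G y u u * G y w w - (G y u w)\<^sup>2)"
            using sectional[OF y ne ind] by (simp add: sectional_curvature_def field_simps)
          then show ?thesis unfolding Q_def using sym[OF y, of w u] by (simp add: power2_eq_square)
        qed
      qed
    qed
  qed
  then have "G y (?R u w z) t = G y (K *\<^sub>R (G y u z *\<^sub>R w - G y w z *\<^sub>R u)) t" for t
    unfolding Q_def by (simp add: G_diff G_scale y)
  then show ?thesis by (rule G_nondegenerate[OF y])
qed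

end

section \<open>Complexified vector fields\<close>

text \<open>Splitting complexified vectors into two real ones lets every complex identity below be
  checked on real and imaginary parts, where the real connection and metric apply.\<close>

definition reV :: "complex ^ 'd \<Rightarrow> real ^ 'd" where "reV w = (\<chi> i. Re (w $ i))"
definition imV :: "complex ^ 'd \<Rightarrow> real ^ 'd" where "imV w = (\<chi> i. Im (w $ i))"
definition mkV :: "real ^ 'd \<Rightarrow> real ^ 'd \<Rightarrow> complex ^ 'd" where "mkV a b = (\<chi> i. Complex (a $ i) (b $ i))"

lemma reV_mkV [simp]: "reV (mkV a b) = a" and imV_mkV [simp]: "imV (mkV a b) = b"
  and mkV_reV_imV [simp]: "mkV (reV w) (imV w) = w"
  by (simp_all add: vec_eq_iff reV_def imV_def mkV_def)

lemma reV_simps [simp]: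
  "reV (a + b) = reV a + reV b" "reV (a - b) = reV a - reV b" "reV (- a) = - reV a" "reV 0 = 0"
  "reV (r *\<^sub>R a) = r *\<^sub>R reV a" "reV (c *s a) = Re c *\<^sub>R reV a - Im c *\<^sub>R imV a"
  and imV_simps [simp]:
  "imV (a + b) = imV a + imV b" "imV (a - b) = imV a - imV b" "imV (- a) = - imV a" "imV 0 = 0"
  "imV (r *\<^sub>R a) = r *\<^sub>R imV a" "imV (c *s a) = Re c *\<^sub>R imV a + Im c *\<^sub>R reV a"
  and reV_cvec [simp]: "reV (cvec u) = u" and imV_cvec [simp]: "imV (cvec u) = 0"
  by (simp_all add: vec_eq_iff reV_def imV_def cvec_def)

lemma scaleR_eq_cscale: "r *\<^sub>R w = of_real r *s w" for w :: "complex ^ 'd"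
  by (simp add: vec_eq_iff complex_eq_iff)

lemma complex_vec_eqI: "reV a = reV b \<Longrightarrow> imV a = imV b \<Longrightarrow> a = b"
  by (metis mkV_reV_imV)

lemma bounded_linear_reV: "bounded_linear reV" and bounded_linear_imV: "bounded_linear imV"
  by (auto simp: linear_conv_bounded_linear[symmetric] intro!: linearI)

lemma bounded_linear_cvec: "bounded_linear cvec"
  by (auto simp: linear_conv_bounded_linear[symmetric] cvec_def vec_eq_iff complex_eq_iff intro!: linearI)

lemma bounded_bilinear_cscale: "bounded_bilinear ((*s) :: complex \<Rightarrow> complex ^ 'd \<Rightarrow> complex ^ 'd)"
  unfolding bilinear_conv_bounded_bilinear[symmetric] bilinear_def
  by (auto intro!: linearI simp: vec_eq_iff algebra_simps)

lemma mkV_eq: "mkV a b = cvec a + \<i> *s cvec b"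
  by (rule complex_vec_eqI) simp_all

lemma smooth_on_mkV: "open S \<Longrightarrow> smooth_on S a \<Longrightarrow> smooth_on S b \<Longrightarrow> smooth_on S (\<lambda>x. mkV (a x) (b x))"
  unfolding mkV_eq
  by (intro smooth_on_add smooth_on_bounded_linear[OF bounded_linear_cvec] smooth_on_const
      smooth_on_bilinear[OF bounded_bilinear_cscale])

lemmas smooth_on_reV = smooth_on_bounded_linear[OF bounded_linear_reV]
  and smooth_on_imV = smooth_on_bounded_linear[OF bounded_linear_imV]
  and smooth_on_cvec = smooth_on_bounded_linear[OF bounded_linear_cvec]
  and smooth_on_cscale = smooth_on_bilinear[OF bounded_bilinear_cscale]

lemma metric_C_eq:
  assumes "bilinear b"
  shows "metric_C b w z = Complex (b (reV w) (reV z) - b (imV w) (imV z)) (b (reV w) (imV z) + b (imV w) (reV z))"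
  unfolding bilinear_expand[OF assms, of "reV w"] bilinear_expand[OF assms, of "imV w"]
  by (simp add: complex_eq_iff metric_C_def reV_def imV_def sum_subtractf[symmetric] sum.distrib[symmetric] algebra_simps)

text \<open>Each component of \<Gamma> is a real bilinear form, so the formula for
  \<open>metric_C\<close> applies componentwise.\<close>

lemma christoffel_C_eq:
  assumes "bilinear \<Gamma>"
  shows "christoffel_C \<Gamma> w z =
    mkV (\<Gamma> (reV w) (reV z) - \<Gamma> (imV w) (imV z)) (\<Gamma> (reV w) (imV z) + \<Gamma> (imV w) (reV z))"
proof -
  have "bilinear (\<lambda>u w. \<Gamma> u w $ k)" for k
    using assms by (auto simp: bilinear_def linear_iff)
  from metric_C_eq[OF this, of _ w z] show ?thesis
    by (simp add: vec_eq_iff christoffel_C_def metric_C_def cvec_def mkV_def)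
qed

definition derivC :: "'e \<times> 'e \<Rightarrow> ('e::real_normed_vector \<Rightarrow> complex) \<Rightarrow> 'e \<Rightarrow> complex" where
  "derivC p f x = fderiv f x (fst p) + \<i> * fderiv f x (snd p)"

definition partC :: "('e::real_normed_vector \<Rightarrow> real ^ 'd) \<Rightarrow> 'e \<times> 'e \<Rightarrow> 'e \<Rightarrow> complex ^ 'd" where
  "partC F p x = mkV (fderiv F x (fst p)) (fderiv F x (snd p))"

text \<open>A pair \<open>(u, w)\<close> of directions stands for the complexified tangent vector \<open>u + \<i> w\<close>.\<close>

definition covC ::
  "(real ^ 'd \<Rightarrow> real ^ 'd \<Rightarrow> real ^ 'd \<Rightarrow> real ^ 'd) \<Rightarrow> ('e::euclidean_space \<Rightarrow> real ^ 'd) \<Rightarrow>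
   'e \<times> 'e \<Rightarrow> ('e \<Rightarrow> complex ^ 'd) \<Rightarrow> 'e \<Rightarrow> complex ^ 'd" where
  "covC \<Gamma> F p W x = mkV
     (cov \<Gamma> F (fst p) (\<lambda>x. reV (W x)) x - cov \<Gamma> F (snd p) (\<lambda>x. imV (W x)) x)
     (cov \<Gamma> F (fst p) (\<lambda>x. imV (W x)) x + cov \<Gamma> F (snd p) (\<lambda>x. reV (W x)) x)"

lemma fderiv_mkV:
  assumes "W differentiable at x"
  shows "fderiv W x u = mkV (fderiv (\<lambda>x. reV (W x)) x u) (fderiv (\<lambda>x. imV (W x)) x u)"
  by (rule complex_vec_eqI)
    (simp_all add: fderiv_bounded_linear[OF bounded_linear_reV assms] fderiv_bounded_linear[OF bounded_linear_imV assms])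

lemma fderiv_Complex:
  assumes "f differentiable at x"
  shows "fderiv f x u = Complex (fderiv (\<lambda>x. Re (f x)) x u) (fderiv (\<lambda>x. Im (f x)) x u)"
  by (simp add: complex_eq_iff fderiv_bounded_linear[OF bounded_linear_Re assms] fderiv_bounded_linear[OF bounded_linear_Im assms])

locale space_form_map = space_form_chart V G K + map_into_chart V G U F
  for V :: "(real ^ 'd::finite) set" and G K and U :: "'e::euclidean_space set" and F
begin

abbreviation ip :: "'e \<Rightarrow> complex ^ 'd \<Rightarrow> complex ^ 'd \<Rightarrow> complex" where "ip x \<equiv> metric_C (G (F x))"
abbreviation cvC :: "'e \<times> 'e \<Rightarrow> ('e \<Rightarrow> complex ^ 'd) \<Rightarrow> 'e \<Rightarrow> complex ^ 'd" where "cvC \<equiv> covC \<Gamma> F"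
abbreviation DC :: "'e \<times> 'e \<Rightarrow> 'e \<Rightarrow> complex ^ 'd" where "DC \<equiv> partC F"

lemma ip_eq: "x \<in> U \<Longrightarrow> ip x w z = Complex (G (F x) (reV w) (reV z) - G (F x) (imV w) (imV z))
    (G (F x) (reV w) (imV z) + G (F x) (imV w) (reV z))"
  by (rule metric_C_eq[OF bil[OF FV]])

lemma ip_sym: "x \<in> U \<Longrightarrow> ip x w z = ip x z w"
  by (simp add: ip_eq sym[OF FV, of x "reV z"] sym[OF FV, of x "imV z"])

lemma ip_add: "ip x (a + b) c = ip x a c + ip x b c" "ip x c (a + b) = ip x c a + ip x c b"
  and ip_diff: "ip x (a - b) c = ip x a c - ip x b c" "ip x c (a - b) = ip x c a - ip x c b"
  and ip_scale: "ip x (r *s a) c = r * ip x a c" "ip x c (r *s a) = r * ip x c a"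
  and ip_zero: "ip x 0 c = 0" "ip x c 0 = 0"
  by (simp_all add: metric_C_def algebra_simps sum.distrib sum_subtractf sum_distrib_left)

lemmas ip_simps = ip_add ip_diff ip_scale ip_zero

lemma smooth_ip:
  assumes "smooth_on U W" "smooth_on U Z" shows "smooth_on U (\<lambda>x. ip x (W x) (Z x))"
proof -
  have "smooth_on U (\<lambda>x. of_real (G (F x) (reV (W x)) (reV (Z x)) + (-1) * G (F x) (imV (W x)) (imV (Z x)))
     + \<i> * of_real (G (F x) (reV (W x)) (imV (Z x)) + G (F x) (imV (W x)) (reV (Z x))))"
    by (intro smooth_on_add smooth_on_mult smooth_on_const open_U smooth_on_bounded_linear[OF bounded_linear_of_real]
        smooth_G_along smooth_on_reV smooth_on_imV assms)
  then show ?thesis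
    by (rule smooth_on_cong[OF open_U, rotated]) (simp add: ip_eq complex_eq_iff)
qed

lemma smooth_DC: "smooth_on U (DC p)"
  unfolding partC_def[abs_def] by (intro smooth_on_mkV smooth_DF open_U)

lemma smooth_cvC: "smooth_on U W \<Longrightarrow> smooth_on U (cvC p W)"
  unfolding covC_def[abs_def]
  by (intro smooth_on_mkV smooth_on_add smooth_on_diff smooth_cv open_U smooth_on_reV smooth_on_imV)

lemma derivC_cong: "x \<in> U \<Longrightarrow> (\<And>y. y \<in> U \<Longrightarrow> f y = g y) \<Longrightarrow> derivC p f x = derivC p g x"
  unfolding derivC_def using fderiv_cong[OF open_U, of x f g] by simp

lemma cvC_cong:
  assumes "x \<in> U" "\<And>y. y \<in> U \<Longrightarrow> W y = Z y" shows "cvC p W x = cvC p Z x"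
proof -
  have "cv u (\<lambda>x. reV (W x)) x = cv u (\<lambda>x. reV (Z x)) x" "cv u (\<lambda>x. imV (W x)) x = cv u (\<lambda>x. imV (Z x)) x" for u
    by (rule cv_cong[OF assms(1)], simp add: assms(2))+
  then show ?thesis by (simp add: covC_def)
qed

lemma cv_add: "x \<in> U \<Longrightarrow> smooth_on U A \<Longrightarrow> smooth_on U B \<Longrightarrow> cv u (\<lambda>x. A x + B x) x = cv u A x + cv u B x"
  by (simp add: cov_def fderiv_add[OF diff diff] \<Gamma>_add FV)

lemma cv_scale:
  assumes "x \<in> U" "smooth_on U r" "smooth_on U A"
  shows "cv u (\<lambda>x. r x *\<^sub>R A x) x = fderiv r x u *\<^sub>R A x + r x *\<^sub>R cv u A x"
  unfolding cov_def fderiv_bilinear[OF bounded_bilinear_scaleR diff[OF assms(2,1)] diff[OF assms(3,1)]]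
  by (simp add: \<Gamma>_scale FV[OF assms(1)] algebra_simps)

lemma cv_diff:
  assumes "x \<in> U" "smooth_on U A" "smooth_on U B"
  shows "cv u (\<lambda>x. A x - B x) x = cv u A x - cv u B x"
  using cv_add[OF assms(1,2) smooth_on_bounded_linear[OF bounded_linear_scaleR_right open_U assms(3)], of u "-1"]
    cv_scale[OF assms(1) smooth_on_const[OF open_U] assms(3), of u "-1"] by simp

lemma cvC_add:
  assumes "x \<in> U" "smooth_on U W" "smooth_on U Z"
  shows "cvC p (\<lambda>x. W x + Z x) x = cvC p W x + cvC p Z x"
  by (rule complex_vec_eqI)
    (simp_all add: covC_def cv_add[OF assms(1) smooth_on_reV[OF open_U] smooth_on_reV[OF open_U]]
      cv_add[OF assms(1) smooth_on_imV[OF open_U] smooth_on_imV[OF open_U]] assms(2,3))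

lemma cvC_diff:
  assumes "x \<in> U" "smooth_on U W" "smooth_on U Z"
  shows "cvC p (\<lambda>x. W x - Z x) x = cvC p W x - cvC p Z x"
  by (rule complex_vec_eqI)
    (simp_all add: covC_def cv_diff[OF assms(1) smooth_on_reV[OF open_U] smooth_on_reV[OF open_U]]
      cv_diff[OF assms(1) smooth_on_imV[OF open_U] smooth_on_imV[OF open_U]] assms(2,3))

lemma cvC_scale:
  assumes x: "x \<in> U" and f: "smooth_on U f" and W: "smooth_on U W"
  shows "cvC p (\<lambda>x. f x *s W x) x = derivC p f x *s W x + f x *s cvC p W x"
proof -
  note sf = smooth_on_bounded_linear[OF bounded_linear_Re open_U f] smooth_on_bounded_linear[OF bounded_linear_Im open_U f]
  note sW = smooth_on_reV[OF open_U W] smooth_on_imV[OF open_U W]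
  note s = smooth_on_bilinear[OF bounded_bilinear_scaleR open_U]
  note df = fderiv_bounded_linear[OF bounded_linear_Re diff[OF f x]] fderiv_bounded_linear[OF bounded_linear_Im diff[OF f x]]
  have re: "cv u (\<lambda>x. Re (f x) *\<^sub>R reV (W x) - Im (f x) *\<^sub>R imV (W x)) x = Re (fderiv f x u) *\<^sub>R reV (W x) - Im (fderiv f x u) *\<^sub>R imV (W x)
      + Re (f x) *\<^sub>R cv u (\<lambda>x. reV (W x)) x - Im (f x) *\<^sub>R cv u (\<lambda>x. imV (W x)) x" for u
    by (subst cv_diff[OF x s[OF sf(1) sW(1)] s[OF sf(2) sW(2)]])
      (simp add: cv_scale[OF x sf(1) sW(1)] cv_scale[OF x sf(2) sW(2)] df)
  have im: "cv u (\<lambda>x. Re (f x) *\<^sub>R imV (W x) + Im (f x) *\<^sub>R reV (W x)) x = Re (fderiv f x u) *\<^sub>R imV (W x) + Im (fderiv f x u) *\<^sub>R reV (W x)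
      + Re (f x) *\<^sub>R cv u (\<lambda>x. imV (W x)) x + Im (f x) *\<^sub>R cv u (\<lambda>x. reV (W x)) x" for u
    by (subst cv_add[OF x s[OF sf(1) sW(2)] s[OF sf(2) sW(1)]])
      (simp add: cv_scale[OF x sf(1) sW(2)] cv_scale[OF x sf(2) sW(1)] df)
  show ?thesis
    by (rule complex_vec_eqI) (simp_all add: covC_def re im derivC_def, simp_all add: algebra_simps)
qed

lemma derivC_ip:
  assumes x: "x \<in> U" and W: "smooth_on U W" and Z: "smooth_on U Z"
  shows "derivC p (\<lambda>x. ip x (W x) (Z x)) x = ip x (cvC p W x) (Z x) + ip x (W x) (cvC p Z x)"
proof -
  note sW = smooth_on_reV[OF open_U W] smooth_on_imV[OF open_U W]
  note sZ = smooth_on_reV[OF open_U Z] smooth_on_imV[OF open_U Z]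
  note dW = sW[THEN diff, OF x] and dZ = sZ[THEN diff, OF x]
  have fd: "fderiv (\<lambda>x. A x - B x) x u = fderiv A x u - fderiv B x u"
    if "smooth_on U A" "smooth_on U B" for A B :: "'e \<Rightarrow> real" and u
    by (rule fderiv_eq) (intro has_derivative_diff has_fderiv diff[OF _ x] that)
  have "fderiv (\<lambda>x. ip x (W x) (Z x)) x u = Complex
     (fderiv (\<lambda>x. G (F x) (reV (W x)) (reV (Z x)) - G (F x) (imV (W x)) (imV (Z x))) x u)
     (fderiv (\<lambda>x. G (F x) (reV (W x)) (imV (Z x)) + G (F x) (imV (W x)) (reV (Z x))) x u)" for u
    unfolding fderiv_Complex[OF diff[OF smooth_ip[OF W Z] x]]
    by (intro arg_cong2[where f = Complex] fun_cong[OF fderiv_cong[OF open_U x]]) (simp_all add: ip_eq)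
  then have "fderiv (\<lambda>x. ip x (W x) (Z x)) x u =
     ip x (mkV (cv u (\<lambda>x. reV (W x)) x) (cv u (\<lambda>x. imV (W x)) x)) (Z x) +
     ip x (W x) (mkV (cv u (\<lambda>x. reV (Z x)) x) (cv u (\<lambda>x. imV (Z x)) x))" for u
    by (simp add: fd smooth_G_along sW sZ fderiv_add[OF diff[OF smooth_G_along[OF sW(1) sZ(2)] x] diff[OF smooth_G_along[OF sW(2) sZ(1)] x]]
        fderiv_G_along[OF x] dW dZ ip_eq x complex_eq_iff)
  moreover have "cvC p W x = mkV (cv (fst p) (\<lambda>x. reV (W x)) x) (cv (fst p) (\<lambda>x. imV (W x)) x)
     + \<i> *s mkV (cv (snd p) (\<lambda>x. reV (W x)) x) (cv (snd p) (\<lambda>x. imV (W x)) x)" for W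
    by (rule complex_vec_eqI) (simp_all add: covC_def)
  ultimately show ?thesis by (simp add: derivC_def ip_simps algebra_simps)
qed

lemma cvC_torsion_free: "x \<in> U \<Longrightarrow> cvC p (DC q) x = cvC q (DC p) x"
  by (rule complex_vec_eqI)
    (simp_all add: covC_def partC_def torsion_free[of x "fst p"] torsion_free[of x "snd p"])

text \<open>Both sides are complex-bilinear in the two directions. The claim reduces to the real
  Ricci identity for the four combinations of real and imaginary directions, used on both parts of
  W, with the space-form curvature inserted.\<close>

lemma cvC_ricci:
  assumes x: "x \<in> U" and W: "smooth_on U W"
  shows "cvC p (cvC q W) x - cvC q (cvC p W) x =
     K *\<^sub>R (ip x (DC q x) (W x) *s DC p x - ip x (DC p x) (W x) *s DC q x)"
proof -
  note sW = smooth_on_reV[OF open_U W] smooth_on_imV[OF open_U W]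
  let ?r = "\<lambda>x. reV (W x)" and ?i = "\<lambda>x. imV (W x)"
  have r: "cv u (cv w A) x = cv w (cv u A) x + K *\<^sub>R (G (F x) (DF w x) (A x) *\<^sub>R DF u x - G (F x) (DF u x) (A x) *\<^sub>R DF w x)"
    if "smooth_on U A" for u w A
    using ricci_identity[OF x that, of u w] curvature_space_form[OF FV[OF x], of "DF u x" "DF w x" "A x"]
    by (simp add: algebra_simps)
  have c: "cv u (\<lambda>x. cv a ?r x - cv b ?i x) x = cv u (cv a ?r) x - cv u (cv b ?i) x"
    "cv u (\<lambda>x. cv a ?i x + cv b ?r x) x = cv u (cv a ?i) x + cv u (cv b ?r) x" for u a b
    by (simp_all add: cv_diff[OF x smooth_cv smooth_cv] cv_add[OF x smooth_cv smooth_cv] sW)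
  note rr = r[OF sW(1), of "fst p" "fst q"] r[OF sW(1), of "snd p" "snd q"] r[OF sW(1), of "fst p" "snd q"] r[OF sW(1), of "snd p" "fst q"]
    r[OF sW(2), of "fst p" "fst q"] r[OF sW(2), of "snd p" "snd q"] r[OF sW(2), of "fst p" "snd q"] r[OF sW(2), of "snd p" "fst q"]
  show ?thesis
    by (rule complex_vec_eqI) (simp_all add: covC_def partC_def c rr ip_eq[OF x], simp_all add: algebra_simps)
qed

end

section \<open>First-order deformations\<close>

text \<open>A pair \<open>(X, Y)\<close> stands for the field \<open>X + \<epsilon> Y\<close> over the dual numbers, that is, for a field
  \<open>X\<close> along \<open>F\<close> together with its covariant derivative \<open>Y\<close> under the infinitesimal deformation
  of \<open>F\<close> in the direction \<open>v\<close>. The curvature terms of \<open>dN\<close> come from commuting this derivative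
  with \<open>\<nabla>\<close>. The two coefficients of the pairing over the dual numbers are \<open>pr False\<close> and
  \<open>pr True\<close>.\<close>

abbreviation zd :: "complex \<times> complex" where "zd \<equiv> (1 / 2, - (\<i> / 2))"
abbreviation zb :: "complex \<times> complex" where "zb \<equiv> (1 / 2, \<i> / 2)"

definition pscale :: "complex \<Rightarrow> (complex ^ 'd) \<times> (complex ^ 'd) \<Rightarrow> (complex ^ 'd) \<times> (complex ^ 'd)" where
  "pscale c P = (c *s fst P, c *s snd P)"

lemma pscale_sel [simp]: "fst (pscale c P) = c *s fst P" "snd (pscale c P) = c *s snd P"
  by (simp_all add: pscale_def)

locale deformation = space_form_map V G K U F
  for V :: "(real ^ 'd::finite) set" and G K and U :: "'e::euclidean_space set" and F +
  fixes v :: "'e \<Rightarrow> complex ^ 'd"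
  assumes smooth_v: "smooth_on U v"
begin

definition dN :: "'e \<times> 'e \<Rightarrow> ('e \<Rightarrow> (complex ^ 'd) \<times> (complex ^ 'd)) \<Rightarrow> 'e \<Rightarrow> (complex ^ 'd) \<times> (complex ^ 'd)" where
  "dN p P x = (cvC p (\<lambda>x. fst (P x)) x, cvC p (\<lambda>x. snd (P x)) x +
     of_real K *s (ip x (DC p x) (fst (P x)) *s v x - ip x (v x) (fst (P x)) *s DC p x))"

definition pr :: "bool \<Rightarrow> 'e \<Rightarrow> (complex ^ 'd) \<times> (complex ^ 'd) \<Rightarrow> (complex ^ 'd) \<times> (complex ^ 'd) \<Rightarrow> complex" where
  "pr i x P Q = (if i then ip x (fst P) (snd Q) + ip x (snd P) (fst Q) else ip x (fst P) (fst Q))"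

definition psmooth :: "('e \<Rightarrow> (complex ^ 'd) \<times> (complex ^ 'd)) \<Rightarrow> bool" where
  "psmooth P \<longleftrightarrow> smooth_on U (\<lambda>x. fst (P x)) \<and> smooth_on U (\<lambda>x. snd (P x))"

lemma ip_neg: "ip x (- a) c = - ip x a c" "ip x c (- a) = - ip x c a"
  by (simp_all add: metric_C_def sum_negf)

lemma pr_sym: "x \<in> U \<Longrightarrow> pr i x P Q = pr i x Q P"
  by (auto simp: pr_def ip_sym[of x "fst P"] ip_sym[of x "snd P"])

lemma pr_add: "pr i x (P + P') Q = pr i x P Q + pr i x P' Q"
  and pr_scale: "pr i x (pscale c P) Q = c * pr i x P Q" "pr i x P (pscale c Q) = c * pr i x P Q"
  and pr_zero: "pr i x 0 Q = 0"
  by (auto simp: pr_def ip_simps algebra_simps)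

lemma smooth_pr: "psmooth P \<Longrightarrow> psmooth Q \<Longrightarrow> smooth_on U (\<lambda>x. pr i x (P x) (Q x))"
  unfolding pr_def psmooth_def by (cases i) (auto intro!: smooth_on_add smooth_ip open_U)

lemma psmooth_dN: "psmooth P \<Longrightarrow> psmooth (dN p P)"
  unfolding psmooth_def dN_def fst_conv snd_conv
  by (intro conjI smooth_cvC smooth_on_add smooth_on_cscale smooth_on_diff smooth_ip smooth_DC smooth_v
      smooth_on_const open_U) auto

lemma derivC_add: "x \<in> U \<Longrightarrow> smooth_on U f \<Longrightarrow> smooth_on U g \<Longrightarrow>
    derivC p (\<lambda>x. f x + g x) x = derivC p f x + derivC p g x"
  by (simp add: derivC_def fderiv_add[OF diff diff] algebra_simps)

text \<open>\<open>dN\<close> is a metric connection over the dual numbers: its extra term, X going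
  to <A, X> v - <v, X> A, is skew for the pairing and cancels between the two summands.\<close>

lemma derivC_pr:
  assumes x: "x \<in> U" and P: "psmooth P" and Q: "psmooth Q"
  shows "derivC p (\<lambda>x. pr i x (P x) (Q x)) x = pr i x (dN p P x) (Q x) + pr i x (P x) (dN p Q x)"
proof -
  note s = P[unfolded psmooth_def, THEN conjunct1] P[unfolded psmooth_def, THEN conjunct2]
    Q[unfolded psmooth_def, THEN conjunct1] Q[unfolded psmooth_def, THEN conjunct2]
  show ?thesis
  proof (cases i)
    case False
    then show ?thesis by (simp add: pr_def dN_def derivC_ip[OF x s(1,3)])
  next
    case True
    show ?thesis
      by (simp add: True pr_def dN_def derivC_add[OF x smooth_ip[OF s(1,4)] smooth_ip[OF s(2,3)]]
          derivC_ip[OF x s(1,4)] derivC_ip[OF x s(2,3)] ip_simps)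
        (simp add: ip_sym[OF x, of "fst (P x)" "v x"] ip_sym[OF x, of "fst (P x)" "DC p x"] algebra_simps)
  qed
qed

lemma dN_fst_snd: "fst (dN p P x) = cvC p (\<lambda>x. fst (P x)) x"
  "snd (dN p P x) = cvC p (\<lambda>x. snd (P x)) x +
     of_real K *s (ip x (DC p x) (fst (P x)) *s v x - ip x (v x) (fst (P x)) *s DC p x)"
  by (simp_all add: dN_def)

text \<open>The right-hand side is the Ricci identity read over the dual numbers: its second
  component is the epsilon part of K (<B, X> A - <A, X> B), where A, B and X are deformed to A +
  \<epsilon> \<open>cvC p v\<close>, B + \<epsilon> \<open>cvC q v\<close> and X + \<epsilon> Y. No
  derivative of the curvature itself occurs since K is constant, and the terms containing v
  undifferentiated cancel by torsion-freeness and by exchanging p and q.\<close>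

lemma dN_ricci:
  assumes x: "x \<in> U" and P: "psmooth P"
  shows "dN p (dN q P) x = dN q (dN p P) x +
    (let X = fst (P x); Y = snd (P x) in
     (of_real K *s (ip x (DC q x) X *s DC p x - ip x (DC p x) X *s DC q x),
      of_real K *s (ip x (DC q x) Y *s DC p x - ip x (DC p x) Y *s DC q x
        + ip x (DC q x) X *s cvC p v x - ip x (DC p x) X *s cvC q v x
        + ip x (cvC q v x) X *s DC p x - ip x (cvC p v x) X *s DC q x)))"
proof -
  note s = P[unfolded psmooth_def, THEN conjunct1] P[unfolded psmooth_def, THEN conjunct2]
  let ?X = "\<lambda>x. fst (P x)" and ?Y = "\<lambda>x. snd (P x)"
  have R: "cvC p (cvC q W) x = cvC q (cvC p W) x +
     of_real K *s (ip x (DC q x) (W x) *s DC p x - ip x (DC p x) (W x) *s DC q x)" if "smooth_on U W" for W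
    using cvC_ricci[OF x that, of p q] by (simp add: scaleR_eq_cscale[of K] algebra_simps)
  have "cvC p (\<lambda>x. snd (dN q P x)) x = cvC p (cvC q ?Y) x + of_real K *s
      ((ip x (cvC p (DC q) x) (?X x) + ip x (DC q x) (cvC p ?X x)) *s v x + ip x (DC q x) (?X x) *s cvC p v x
      - ((ip x (cvC p v x) (?X x) + ip x (v x) (cvC p ?X x)) *s DC q x + ip x (v x) (?X x) *s cvC p (DC q) x))" for p q
  proof -
    note a = smooth_on_cscale[OF open_U smooth_ip[OF smooth_DC s(1)] smooth_v]
      and b = smooth_on_cscale[OF open_U smooth_ip[OF smooth_v s(1)] smooth_DC]
    note c = smooth_on_diff[OF open_U a b]
    have dK: "derivC p (\<lambda>_. of_real K) x = 0" by (simp add: derivC_def)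
    show ?thesis
      unfolding dN_fst_snd cvC_add[OF x smooth_cvC[OF s(2)] smooth_on_cscale[OF open_U smooth_on_const[OF open_U] c]]
        cvC_scale[OF x smooth_on_const[OF open_U] c] dK cvC_diff[OF x a b]
        cvC_scale[OF x smooth_ip[OF smooth_DC s(1)] smooth_v] cvC_scale[OF x smooth_ip[OF smooth_v s(1)] smooth_DC]
        derivC_ip[OF x smooth_DC s(1)] derivC_ip[OF x smooth_v s(1)] by simp
  qed
  note c = this
  have "fst (dN p (dN q P) x) = fst (dN q (dN p P) x) +
      of_real K *s (ip x (DC q x) (?X x) *s DC p x - ip x (DC p x) (?X x) *s DC q x)"
    by (simp add: dN_fst_snd R[OF s(1)])
  moreover have "snd (dN p (dN q P) x) = snd (dN q (dN p P) x) +
      of_real K *s (ip x (DC q x) (?Y x) *s DC p x - ip x (DC p x) (?Y x) *s DC q x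
        + ip x (DC q x) (?X x) *s cvC p v x - ip x (DC p x) (?X x) *s cvC q v x
        + ip x (cvC q v x) (?X x) *s DC p x - ip x (cvC p v x) (?X x) *s DC q x)"
    unfolding dN_fst_snd(2)[of p "dN q P"] dN_fst_snd(2)[of q "dN p P"] c R[OF s(2)] dN_fst_snd(1)
      cvC_torsion_free[OF x, of p q]
    by (simp add: vec_eq_iff algebra_simps)
  ultimately show ?thesis by (simp add: prod_eq_iff Let_def)
qed

end

section \<open>Iterated z-derivatives over the dual numbers\<close>

locale surface_deformation = deformation V G K U F v
  for V :: "(real ^ 'd::finite) set" and G K and U :: "complex set" and F v
begin

text \<open>\<open>PP a\<close> encodes psi_a + \<epsilon> u_a. The starting value reflects
  torsion-freeness: deforming F in the direction v changes its z-derivative by the covariant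
  z-derivative of v.\<close>

primrec PP :: "nat \<Rightarrow> complex \<Rightarrow> (complex ^ 'd) \<times> (complex ^ 'd)" where
  "PP 0 = (\<lambda>x. (DC zd x, cvC zd v x))"
| "PP (Suc a) = dN zd (PP a)"

lemma psmooth_PP: "psmooth (PP a)"
proof (induction a)
  case 0
  show ?case unfolding psmooth_def by (simp add: smooth_DC smooth_cvC smooth_v)
qed (simp add: psmooth_dN)

lemma fst_PP: "fst (PP a x) = (cvC zd ^^ a) (DC zd) x"
  by (induction a arbitrary: x) (simp_all add: dN_def)

text \<open>Abstract form of a coordinate change with Jacobian g, where the \<open>Q a\<close> are
  the iterated derivatives for the other coordinate. \<open>PP a\<close> is g^(a+1) times
  \<open>Q a\<close> plus terms with derivatives of g; to avoid them, derivatives are moved across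
  pairings that vanish identically. The induction \<open>mu\<close> replaces the first argument and
  collects g^(a+1), the second induction replaces the other argument. Each move produces a sign,
  which \<open>alt\<close> removes again at the top level.\<close>

lemma pr_transform:
  fixes Q :: "nat \<Rightarrow> complex \<Rightarrow> (complex ^ 'd) \<times> (complex ^ 'd)"
  assumes Q: "\<And>a. psmooth (Q a)" and dQ: "\<And>a x. x \<in> U \<Longrightarrow> dN zd (Q a) x = pscale (g x) (Q (Suc a) x)"
    and Q0: "\<And>x. x \<in> U \<Longrightarrow> PP 0 x = pscale (g x) (Q 0 x)"
    and low: "\<And>a b x. a + b < n \<Longrightarrow> x \<in> U \<Longrightarrow> pr i x (Q a x) (Q b x) = 0"
    and alt: "\<And>a b x. Suc (a + b) = n \<Longrightarrow> x \<in> U \<Longrightarrow> pr i x (Q a x) (Q (Suc b) x) = - pr i x (Q (Suc a) x) (Q b x)"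
    and x: "x \<in> U" and ab: "a + b \<le> n"
  shows "pr i x (PP a x) (PP b x) = g x ^ (n + 2) * pr i x (Q a x) (Q b x)"
proof -
  have d0: "derivC zd f x = 0" if "x \<in> U" "\<And>y. y \<in> U \<Longrightarrow> f y = 0" for f x
    using derivC_cong[OF that(1), of f "\<lambda>_. 0" zd] that(2) by (simp add: derivC_def)
  have mu: "pr i x (PP a x) (Q b x) = g x ^ Suc a * pr i x (Q a x) (Q b x)"
    if "x \<in> U" "a + b \<le> n" for a b x
    using that
  proof (induction a arbitrary: b x)
    case 0
    then show ?case by (simp only: Q0 pr_scale) simp
  next
    case (Suc a)
    \<comment> \<open>The level a + b is below n because \<open>Suc a + b\<close> is at most n. The
      pairing therefore vanishes on all of U, and so does its derivative.\<close>
    have z: "pr i y (PP a y) (Q b y) = 0" if "y \<in> U" for y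
      using Suc.IH[OF that, of b] low[of a b y] that Suc.prems by simp
    have "0 = pr i x (dN zd (PP a) x) (Q b x) + pr i x (PP a x) (dN zd (Q b) x)"
      using derivC_pr[OF Suc.prems(1) psmooth_PP Q, of zd i a b] d0[OF Suc.prems(1), of "\<lambda>x. pr i x (PP a x) (Q b x)"] z
      by simp
    then have "pr i x (PP (Suc a) x) (Q b x) = - (g x * pr i x (PP a x) (Q (Suc b) x))"
      by (simp add: dQ Suc.prems pr_scale eq_neg_iff_add_eq_0)
    also have "\<dots> = - (g x * (g x ^ Suc a * pr i x (Q a x) (Q (Suc b) x)))"
      using Suc.IH[OF Suc.prems(1), of "Suc b"] Suc.prems by simp
    also have "pr i x (Q a x) (Q (Suc b) x) = - pr i x (Q (Suc a) x) (Q b x)"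
    proof (cases "Suc (a + b) = n")
      case True
      then show ?thesis using alt Suc.prems by blast
    next
      case False
      then show ?thesis using low[of a "Suc b" x] low[of "Suc a" b x] Suc.prems by simp
    qed
    finally show ?case by simp
  qed
  show ?thesis using x ab
  proof (induction b arbitrary: a x)
    case 0
    have "pr i x (PP a x) (PP 0 x) = g x * pr i x (PP a x) (Q 0 x)"
      by (simp only: Q0[OF 0(1)] pr_scale)
    also have "\<dots> = g x ^ (a + 2) * pr i x (Q a x) (Q 0 x)" using mu[OF 0(1), of a 0] 0 by simp
    \<comment> \<open>For a = n the exponents agree; for a < n the pairing is zero and the exponent
      may be changed at will.\<close>
    also have "\<dots> = g x ^ (n + 2) * pr i x (Q a x) (Q 0 x)"
      using low[of a 0 x] 0 by (cases "a = n") auto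
    finally show ?case .
  next
    case (Suc b)
    have z: "pr i y (PP a y) (PP b y) = 0" if "y \<in> U" for y
      using Suc.IH[OF that, of a] low[of a b y] that Suc.prems by simp
    have "0 = pr i x (dN zd (PP a) x) (PP b x) + pr i x (PP a x) (dN zd (PP b) x)"
      using derivC_pr[OF Suc.prems(1) psmooth_PP psmooth_PP, of zd i a b] d0[OF Suc.prems(1), of "\<lambda>x. pr i x (PP a x) (PP b x)"] z
      by simp
    then have "pr i x (PP a x) (PP (Suc b) x) = - pr i x (PP (Suc a) x) (PP b x)"
      by (simp add: eq_neg_iff_add_eq_0 add.commute)
    also have "\<dots> = - (g x ^ (n + 2) * pr i x (Q (Suc a) x) (Q b x))"
      using Suc.IH[OF Suc.prems(1), of "Suc a"] Suc.prems by simp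
    also have "\<dots> = g x ^ (n + 2) * pr i x (Q a x) (Q (Suc b) x)"
    proof (cases "Suc (a + b) = n")
      case True
      then show ?thesis using alt[OF True Suc.prems(1)] by simp
    next
      case False
      then show ?thesis using low[of a "Suc b" x] low[of "Suc a" b x] Suc.prems by simp
    qed
    finally show ?case .
  qed
qed

text \<open>The second component of \<open>PP a\<close> differs from the iterated derivative of \<open>v\<close> only by
  curvature terms, which become multiples of \<open>\<partial>F/\<partial>z\<close> under isotropy and so are invisible to the
  pairing.\<close>

lemma pr_nabla_power:
  assumes H: "\<And>i a b x. x \<in> U \<Longrightarrow> pr i x (PP a x) (PP b x) = 0" and x: "x \<in> U"
  shows "ip x ((cvC zd ^^ Suc a) v x) (fst (PP b x)) = ip x (snd (PP a x)) (fst (PP b x))"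
proof -
  have sv: "smooth_on U ((cvC zd ^^ Suc a) v)" for a
    by (induction a) (auto intro: smooth_cvC smooth_v)
  have sP: "smooth_on U (\<lambda>x. fst (PP a x))" "smooth_on U (\<lambda>x. snd (PP a x))" for a
    using psmooth_PP[of a] by (auto simp: psmooth_def)
  show ?thesis
    using x
  proof (induction a arbitrary: b x)
    case 0
    then show ?case by simp
  next
    case (Suc a)
    note x = Suc.prems
    let ?w = "(cvC zd ^^ Suc a) v"
    have e: "derivC zd (\<lambda>x. ip x (?w x) (fst (PP b x))) x = derivC zd (\<lambda>x. ip x (snd (PP a x)) (fst (PP b x))) x"
      by (rule derivC_cong[OF x Suc.IH])
    have n: "cvC zd (\<lambda>x. fst (PP b x)) x = fst (PP (Suc b) x)" by (simp add: dN_def)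
    have A: "ip x (DC zd x) (fst (PP b x)) = 0" for b using H[OF x, of False 0 b] by (simp add: pr_def)
    have "ip x (cvC zd ?w x) (fst (PP b x)) = ip x (cvC zd (\<lambda>x. snd (PP a x)) x) (fst (PP b x))"
      using e Suc.IH[OF x, of "Suc b"] unfolding derivC_ip[OF x sv sP(1)] derivC_ip[OF x sP(2) sP(1)] n by simp
    also have "\<dots> = ip x (snd (PP (Suc a) x)) (fst (PP b x))"
      by (simp add: dN_fst_snd ip_simps A)
    finally show ?case by simp
  qed
qed

end

text \<open>The two assumptions are the two coefficients of the single equation
  \<open>dN zb (PP 0) x = 0\<close>: the Jacobi equation is the epsilon part of the harmonic map
  equation.\<close>

locale jacobi_system = surface_deformation V G K U F v
  for V :: "(real ^ 'd::finite) set" and G K and U :: "complex set" and F v +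
  assumes harmonic_z: "x \<in> U \<Longrightarrow> cvC zb (DC zd) x = 0"
    and jacobi_z: "x \<in> U \<Longrightarrow> cvC zb (cvC zd v) x +
      of_real K *s (ip x (DC zb x) (DC zd x) *s v x - ip x (v x) (DC zd x) *s DC zb x) = 0"
begin

lemma dN_PP_0: "x \<in> U \<Longrightarrow> dN zb (PP 0) x = 0"
  using harmonic_z[of x] jacobi_z[of x] by (simp add: dN_def zero_prod_def)

text \<open>It suffices that \<open>dN zb (PP a)\<close> is orthogonal to \<open>PP b\<close> up to
  level n (\<open>beta\<close>), by induction on a. The start is the harmonic and Jacobi equation.
  In the step the zbar and z derivatives are exchanged: the exchanged term is handled by
  differentiating a pairing already known to vanish, and the curvature term consists of products
  each containing a factor of lower level.\<close>

lemma pr_holomorphic: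
  assumes H: "\<And>i a b x. a + b < n \<Longrightarrow> x \<in> U \<Longrightarrow> pr i x (PP a x) (PP b x) = 0"
    and x: "x \<in> U" and ab: "a + b \<le> n"
  shows "derivC zb (\<lambda>x. pr i x (PP a x) (PP b x)) x = 0"
proof -
  have beta: "pr i x (dN zb (PP a) x) (PP b x) = 0" if "x \<in> U" "a + b \<le> n" for a b i x
    using that
  proof (induction a arbitrary: b i x)
    case 0
    then show ?case by (simp only: dN_PP_0 pr_zero)
  next
    case (Suc a)
    note x = Suc.prems(1)
    let ?A = "DC zd x" and ?B = "DC zb x"
    have z: "pr i y (dN zb (PP a) y) (PP b y) = 0" if "y \<in> U" for y i
      using Suc.IH[OF that, of b i] Suc.prems by simp
    have "derivC zd (\<lambda>x. pr i x (dN zb (PP a) x) (PP b x)) x = 0" for i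
      using derivC_cong[OF x, of "\<lambda>x. pr i x (dN zb (PP a) x) (PP b x)" "\<lambda>_. 0" zd] z
      by (simp add: derivC_def)
    then have "pr i x (dN zd (dN zb (PP a)) x) (PP b x) + pr i x (dN zb (PP a) x) (PP (Suc b) x) = 0" for i
      unfolding derivC_pr[OF x psmooth_dN[OF psmooth_PP] psmooth_PP] by simp
    moreover have "pr i x (dN zb (PP a) x) (PP (Suc b) x) = 0" for i
      using Suc.IH[OF x, of "Suc b" i] Suc.prems by simp
    ultimately have 1: "pr i x (dN zd (dN zb (PP a)) x) (PP b x) = 0" for i by simp
    \<comment> \<open>Since \<open>Suc a + b\<close> is at most n, both a and b are smaller than n,
      so the pairings of \<open>PP 0\<close> with \<open>PP a\<close> and \<open>PP b\<close> fall
      under H. \<open>h0\<close> and \<open>h1\<close> are their two coefficients, ready to be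
      substituted into the curvature term.\<close>
    have h: "pr i x (PP 0 x) (PP a x) = 0" "pr i x (PP 0 x) (PP b x) = 0" for i
      using H[of 0 a x i] H[of 0 b x i] x Suc.prems by auto
    have h0: "ip x ?A (fst (PP a x)) = 0" "ip x ?A (fst (PP b x)) = 0"
      using h[of False] by (simp_all add: pr_def)
    have h1: "ip x ?A (snd (PP a x)) = - ip x (cvC zd v x) (fst (PP a x))"
        "ip x ?A (snd (PP b x)) = - ip x (cvC zd v x) (fst (PP b x))"
      using h[of True] by (simp_all add: pr_def eq_neg_iff_add_eq_0)
    show ?case
      unfolding PP.simps dN_ricci[OF x psmooth_PP, of zb zd a] pr_add 1 Let_def
      by (cases i) (simp_all add: pr_def ip_simps ip_neg h0 h1 algebra_simps)
  qed
  show ?thesis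
    unfolding derivC_pr[OF x psmooth_PP psmooth_PP]
    using beta[OF x ab, of i] beta[OF x, of b a i] ab pr_sym[OF x, of i "PP a x" "dN zb (PP b) x"] by simp
qed

lemma pr_alternating:
  assumes H: "\<And>x. x \<in> U \<Longrightarrow> pr i x (PP a x) (PP b x) = 0" and x: "x \<in> U"
  shows "pr i x (PP a x) (PP (Suc b) x) = - pr i x (PP (Suc a) x) (PP b x)"
proof -
  have "derivC zd (\<lambda>x. pr i x (PP a x) (PP b x)) x = 0"
    using derivC_cong[OF x, of "\<lambda>x. pr i x (PP a x) (PP b x)" "\<lambda>_. 0" zd] H by (simp add: derivC_def)
  then show ?thesis unfolding derivC_pr[OF x psmooth_PP psmooth_PP] by (simp add: eq_neg_iff_add_eq_0 add.commute)
qed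

end

section \<open>Changes of coordinates\<close>

subsection \<open>Coordinates of the target\<close>

locale chart_change = S: metric_chart V G + S': metric_chart V' G'
  for V :: "(real ^ 'd::finite) set" and G and V' :: "(real ^ 'd) set" and G' +
  fixes V0 :: "(real ^ 'd) set" and T :: "real ^ 'd \<Rightarrow> real ^ 'd"
  assumes open_V0: "open V0" and V0: "V0 \<subseteq> V" and smooth_T: "smooth_on V0 T"
    and TV: "y \<in> V0 \<Longrightarrow> T y \<in> V'"
    and isometry: "y \<in> V0 \<Longrightarrow> G y u w = G' (T y) (fderiv T y u) (fderiv T y w)"
begin

sublocale M: map_into_chart V' G' V0 T
  by unfold_locales (use open_V0 smooth_T TV in auto)

lemma linear_T: "y \<in> V0 \<Longrightarrow> linear (fderiv T y)"
  by (rule linear_fderiv[OF M.diff_F])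

lemma surj_T:
  assumes y: "y \<in> V0" shows "surj (fderiv T y)"
proof (rule linear_inj_imp_surj[OF linear_T[OF y]])
  have "u = 0" if "fderiv T y u = 0" for u
  proof (rule ccontr)
    assume "u \<noteq> 0"
    then have "G y u u > 0" using S.pos V0 y by blast
    then show False using that by (simp add: isometry[OF y] bilinear_lzero[OF S'.bil[OF TV[OF y]]])
  qed
  then show "inj (fderiv T y)" using linear_injective_0[OF linear_T[OF y]] by blast
qed

text \<open>Uniqueness of the Levi-Civita connection in tensor form. The difference B of the two
  connections is symmetric in its first two arguments, as both are torsion-free, and skew in its
  last two, as both are metric. Alternating these symmetries returns B with the opposite sign, so it
  vanishes; surjectivity of the derivative of T turns this into the vector identity.\<close>

lemma christoffel_change:
  assumes y: "y \<in> V0"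
  shows "fderiv T y (S.\<Gamma> y u w) =
    fderiv (\<lambda>y. fderiv T y w) y u + S'.\<Gamma> (T y) (fderiv T y u) (fderiv T y w)"
proof -
  have yV: "y \<in> V" using y V0 by blast
  note TyV = TV[OF y]
  let ?t = "fderiv T y"
  define c where "c u w = M.cv u (M.DF w) y" for u w
  have csym: "c u w = c w u" for u w unfolding c_def by (rule M.torsion_free[OF y])
  define B where "B u w z = G' (T y) (c u w - ?t (S.\<Gamma> y u w)) (?t z)" for u w z
  have Bsym: "B u w z = B w u z" for u w z
    unfolding B_def csym[of u w] S.\<Gamma>_sym[OF yV, of u w] ..
  have Banti: "B u w z = - B u z w" for u w z
  proof -
    have "G y (S.\<Gamma> y u w) z + G y w (S.\<Gamma> y u z) = fderiv (\<lambda>y. G y w z) y u"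
      by (rule S.fderiv_G[OF yV, symmetric])
    also have "\<dots> = fderiv (\<lambda>y. G' (T y) (M.DF w y) (M.DF z y)) y u"
      by (rule fun_cong[OF fderiv_cong[OF open_V0 y]]) (rule isometry)
    also have "\<dots> = G' (T y) (c u w) (?t z) + G' (T y) (?t w) (c u z)"
      unfolding c_def by (intro M.fderiv_G_along y M.diff[OF M.smooth_DF])
    finally show ?thesis
      unfolding B_def isometry[OF y] by (simp add: S'.G_diff[OF TyV] S'.sym[OF TyV, of "?t w"])
  qed
  have "B u w z = 0" for u w z
    using Banti[of u w z] Bsym[of u z w] Banti[of z u w] Bsym[of z w u] Banti[of w z u] Bsym[of w u z] by linarith
  then have "G' (T y) (c u w - ?t (S.\<Gamma> y u w)) b = G' (T y) 0 b" for b
    using surjD[OF surj_T[OF y], of b] unfolding B_def by (auto simp: bilinear_lzero[OF S'.bil[OF TyV]])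
  then have "c u w - ?t (S.\<Gamma> y u w) = 0" by (rule S'.G_nondegenerate[OF TyV])
  then show ?thesis by (simp add: c_def cov_def)
qed

lemma cov_change:
  fixes U :: "'e::euclidean_space set"
  assumes U: "open U" and x: "x \<in> U" and F: "smooth_on U F" "\<And>x. x \<in> U \<Longrightarrow> F x \<in> V0" and A: "smooth_on U A"
  shows "cov S'.\<Gamma> (\<lambda>x. T (F x)) u (\<lambda>x. fderiv T (F x) (A x)) x = fderiv T (F x) (cov S.\<Gamma> F u A x)"
proof -
  note d = smooth_on_differentiable[OF _ U x]
  \<comment> \<open>The Leibniz rule at hand is for bilinear families, but the derivative of T is
    only linear in its vector argument. A dummy first argument is added, entering through its
    coordinate \<open>?k\<close> and filled with a constant vector whose coordinate
    \<open>?k\<close> is 1.\<close>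
  let ?k = "undefined :: 'd"
  have "((\<lambda>x. (axis ?k 1 :: real ^ 'd) $ ?k *\<^sub>R fderiv T (F x) (A x)) has_derivative
    (\<lambda>u. fderiv (\<lambda>_. axis ?k (1::real)) x u $ ?k *\<^sub>R fderiv T (F x) (A x) +
      (axis ?k 1 :: real ^ 'd) $ ?k *\<^sub>R fderiv T (F x) (fderiv A x u) +
      fderiv (\<lambda>y. (axis ?k 1 :: real ^ 'd) $ ?k *\<^sub>R fderiv T y (A x)) (F x) (fderiv F x u))) (at x)"
  proof (rule bilinear_family_has_derivative[OF open_V0 _ _ U x F(2) d[OF F(1)] _ d[OF A],
        where H = "\<lambda>y a b. a $ ?k *\<^sub>R fderiv T y b"])
    show "bilinear (\<lambda>a b. a $ ?k *\<^sub>R fderiv T y b)" if "y \<in> V0" for y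
      using linear_T[OF that] unfolding bilinear_def linear_iff by (simp add: algebra_simps)
    show "(\<lambda>y. a $ ?k *\<^sub>R fderiv T y b) differentiable at y" if "y \<in> V0" for a b y
      by (rule differentiable_bounded_linear[OF bounded_linear_scaleR_right M.diff[OF M.smooth_DF that]])
  qed auto
  from fderiv_eq[OF this, of u]
  have "fderiv (\<lambda>x. fderiv T (F x) (A x)) x u = fderiv T (F x) (fderiv A x u) +
      fderiv (\<lambda>y. fderiv T y (A x)) (F x) (fderiv F x u)" by simp
  then show ?thesis
    unfolding cov_def fderiv_compose[OF d[OF F(1)] M.diff_F[OF F(2)[OF x]]]
    by (simp add: linear_add[OF linear_T[OF F(2)[OF x]]] christoffel_change[OF F(2)[OF x]])
qed

definition lift :: "real ^ 'd \<Rightarrow> complex ^ 'd \<Rightarrow> complex ^ 'd" where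
  "lift y W = mkV (fderiv T y (reV W)) (fderiv T y (imV W))"

lemma lift_linear:
  assumes "y \<in> V0"
  shows "lift y (a + b) = lift y a + lift y b" "lift y (a - b) = lift y a - lift y b" "lift y (c *s a) = c *s lift y a"
  by (rule complex_vec_eqI; simp add: lift_def linear_add[OF linear_T[OF assms]] linear_diff[OF linear_T[OF assms]]
      linear_cmul[OF linear_T[OF assms]])+

lemma metric_C_lift:
  assumes "y \<in> V0"
  shows "metric_C (G' (T y)) (lift y a) (lift y b) = metric_C (G y) a b"
  using assms V0 TV[OF assms] by (auto simp: metric_C_eq[OF S.bil] metric_C_eq[OF S'.bil] lift_def isometry[OF assms])

lemma covC_change:
  fixes U :: "'e::euclidean_space set"
  assumes U: "open U" and x: "x \<in> U" and F: "smooth_on U F" "\<And>x. x \<in> U \<Longrightarrow> F x \<in> V0" and W: "smooth_on U W"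
  shows "covC S'.\<Gamma> (\<lambda>x. T (F x)) p (\<lambda>x. lift (F x) (W x)) x = lift (F x) (covC S.\<Gamma> F p W x)"
  using linear_T[OF F(2)[OF x]]
  by (simp add: covC_def lift_def cov_change[OF U x F smooth_on_reV[OF U W]] cov_change[OF U x F smooth_on_imV[OF U W]]
      linear_add linear_diff)

lemma partC_change:
  fixes U :: "'e::euclidean_space set"
  assumes U: "open U" and x: "x \<in> U" and F: "smooth_on U F" "\<And>x. x \<in> U \<Longrightarrow> F x \<in> V0"
  shows "partC (\<lambda>x. T (F x)) p x = lift (F x) (partC F p x)"
  by (simp add: partC_def lift_def fderiv_compose[OF smooth_on_differentiable[OF F(1) U x] M.diff_F[OF F(2)[OF x]]])

end

text \<open>A change of target chart is an isometry, so its complexified derivative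
  \<open>lift\<close> intertwines covariant derivatives and preserves the pairing. By induction it
  carries each \<open>PP a\<close> of one chart to that of the other, and all pairings
  agree.\<close>

lemma pr_target_change:
  assumes S: "surface_deformation V G K U F v" and S': "surface_deformation V' G' K U F' v'"
    and C: "chart_change V G V' G' V0 T" and FV0: "\<And>x. x \<in> U \<Longrightarrow> F x \<in> V0"
    and F': "\<And>x. x \<in> U \<Longrightarrow> F' x = T (F x)"
    and v': "\<And>x. x \<in> U \<Longrightarrow> v' x = chart_change.lift T (F x) (v x)" and x: "x \<in> U"
  shows "deformation.pr G' F' i x (surface_deformation.PP G' K F' v' a x) (surface_deformation.PP G' K F' v' b x) =
     deformation.pr G F i x (surface_deformation.PP G K F v a x) (surface_deformation.PP G K F v b x)"
proof -
  interpret S: surface_deformation V G K U F v by fact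
  interpret S': surface_deformation V' G' K U F' v' by fact
  interpret C: chart_change V G V' G' V0 T by fact
  note U = S.open_U
  have fd: "fderiv F' x = fderiv (\<lambda>x. T (F x)) x" if "x \<in> U" for x
    by (rule fderiv_cong[OF U that F'])
  have cvC': "S'.cvC p (\<lambda>x. C.lift (F x) (W x)) x = C.lift (F x) (S.cvC p W x)"
    if "x \<in> U" "smooth_on U W" for p W x
    using C.covC_change[OF U that(1) S.smooth_F FV0 that(2), of p]
    by (simp add: covC_def cov_def fd[OF that(1)] F'[OF that(1)])
  have DC': "S'.DC p x = C.lift (F x) (S.DC p x)" if "x \<in> U" for p x
    using C.partC_change[OF U that S.smooth_F FV0, of p] by (simp add: partC_def fd[OF that])
  have ip': "S'.ip x (C.lift (F x) a) (C.lift (F x) b) = S.ip x a b" if "x \<in> U" for x a b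
    using C.metric_C_lift[OF FV0[OF that], of a b] by (simp add: F'[OF that])
  have PP: "S'.PP a x = (C.lift (F x) (fst (S.PP a x)), C.lift (F x) (snd (S.PP a x)))" if "x \<in> U" for a x
    using that
  proof (induction a arbitrary: x)
    case 0
    have "S'.cvC zd v' x = S'.cvC zd (\<lambda>x. C.lift (F x) (v x)) x" by (rule S'.cvC_cong[OF 0 v'])
    then show ?case by (simp add: DC'[OF 0] cvC'[OF 0 S.smooth_v])
  next
    case (Suc a)
    note x = Suc.prems
    note s = S.psmooth_PP[of a, unfolded S.psmooth_def, THEN conjunct1] S.psmooth_PP[of a, unfolded S.psmooth_def, THEN conjunct2]
    have 1: "S'.cvC zd (\<lambda>x. fst (S'.PP a x)) x = C.lift (F x) (S.cvC zd (\<lambda>x. fst (S.PP a x)) x)"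
      using S'.cvC_cong[OF x, of "\<lambda>x. fst (S'.PP a x)" "\<lambda>x. C.lift (F x) (fst (S.PP a x))" zd]
      by (simp add: Suc.IH cvC'[OF x s(1)])
    have 2: "S'.cvC zd (\<lambda>x. snd (S'.PP a x)) x = C.lift (F x) (S.cvC zd (\<lambda>x. snd (S.PP a x)) x)"
      using S'.cvC_cong[OF x, of "\<lambda>x. snd (S'.PP a x)" "\<lambda>x. C.lift (F x) (snd (S.PP a x))" zd]
      by (simp add: Suc.IH cvC'[OF x s(2)])
    show ?case
      by (simp add: S'.dN_def S.dN_def 1 2 Suc.IH[OF x] DC'[OF x] v'[OF x] ip'[OF x] C.lift_linear[OF FV0[OF x]])
  qed
  show ?thesis by (cases i) (simp_all add: S'.pr_def S.pr_def PP[OF x] ip'[OF x])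
qed

subsection \<open>Complex coordinates of the domain\<close>

lemma fderiv_holomorphic_compose:
  assumes "(T has_field_derivative g) (at x)" "f differentiable at (T x)"
  shows "fderiv (\<lambda>x. f (T x)) x u = fderiv f (T x) (g * u)"
proof -
  have d: "(T has_derivative (*) g) (at x)" using assms(1) by (simp add: has_field_derivative_def)
  then have "T differentiable at x" by (auto simp: differentiable_def)
  from fderiv_compose[OF this assms(2), of u] show ?thesis by (simp add: fderiv_eq[OF d])
qed

lemma linear_complex_split:
  fixes l :: "complex \<Rightarrow> 'b::real_vector"
  assumes "linear l"
  shows "l (g / 2) = (Re g / 2) *\<^sub>R l 1 + (Im g / 2) *\<^sub>R l \<i>"
    and "l (- (g * \<i> / 2)) = (Im g / 2) *\<^sub>R l 1 - (Re g / 2) *\<^sub>R l \<i>"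
proof -
  have e: "l z = Re z *\<^sub>R l 1 + Im z *\<^sub>R l \<i>" for z
  proof -
    have "z = Re z *\<^sub>R 1 + Im z *\<^sub>R \<i>" by (simp add: complex_eq_iff)
    then have "l z = l (Re z *\<^sub>R 1 + Im z *\<^sub>R \<i>)" by simp
    then show ?thesis by (simp add: linear_add[OF assms] linear_cmul[OF assms])
  qed
  show "l (g / 2) = (Re g / 2) *\<^sub>R l 1 + (Im g / 2) *\<^sub>R l \<i>"
    "l (- (g * \<i> / 2)) = (Im g / 2) *\<^sub>R l 1 - (Re g / 2) *\<^sub>R l \<i>"
    by (subst e, simp)+
qed

text \<open>A holomorphic map with derivative g sends the vector field of the first coordinate to g
  times that of the second. The products \<open>g * fst zd\<close> and \<open>g * snd zd\<close> use
  the complex structure of the domain, while \<open>g *s\<close> acts on the complexified target;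
  the two agree because \<open>zd\<close> is of type (1,0).\<close>

lemma zd_scale:
  assumes "linear l" "linear m"
  shows "mkV (l (g * fst zd) - m (g * snd zd)) (m (g * fst zd) + l (g * snd zd)) =
    g *s mkV (l (fst zd) - m (snd zd)) (m (fst zd) + l (snd zd))"
  using linear_complex_split[OF assms(1), of g] linear_complex_split[OF assms(2), of g]
    linear_complex_split[OF assms(1), of 1] linear_complex_split[OF assms(2), of 1]
  by (intro complex_vec_eqI) (simp_all add: algebra_simps)

text \<open>\<open>pr_transform\<close> with the fields of the other coordinate, composed with T, in
  the role of Q. The power of g is n + 2 because n derivatives are shared between two factors that
  each start with one derivative of F.\<close>

lemma pr_domain_change:
  fixes T :: "complex \<Rightarrow> complex"
  assumes S: "surface_deformation V G K U F v" and S': "surface_deformation V G K U' F' v'"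
    and T: "\<And>x. x \<in> U' \<Longrightarrow> T x \<in> U" "\<And>x. x \<in> U' \<Longrightarrow> (T has_field_derivative g x) (at x)" "smooth_on U' T"
    and F': "\<And>x. x \<in> U' \<Longrightarrow> F' x = F (T x)" and v': "\<And>x. x \<in> U' \<Longrightarrow> v' x = v (T x)"
    and low: "\<And>a b x. a + b < n \<Longrightarrow> x \<in> U \<Longrightarrow>
      deformation.pr G F i x (surface_deformation.PP G K F v a x) (surface_deformation.PP G K F v b x) = 0"
    and alt: "\<And>a b x. Suc (a + b) = n \<Longrightarrow> x \<in> U \<Longrightarrow>
      deformation.pr G F i x (surface_deformation.PP G K F v a x) (surface_deformation.PP G K F v (Suc b) x) =
      - deformation.pr G F i x (surface_deformation.PP G K F v (Suc a) x) (surface_deformation.PP G K F v b x)"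
    and x: "x \<in> U'" and ab: "a + b \<le> n"
  shows "deformation.pr G F' i x (surface_deformation.PP G K F' v' a x) (surface_deformation.PP G K F' v' b x) =
     g x ^ (n + 2) * deformation.pr G F i (T x) (surface_deformation.PP G K F v a (T x)) (surface_deformation.PP G K F v b (T x))"
proof -
  interpret S: surface_deformation V G K U F v by fact
  interpret S': surface_deformation V G K U' F' v' by fact
  note U = S.open_U and U' = S'.open_U
  have TU: "T ` U' \<subseteq> U" using T(1) by blast
  have sm: "smooth_on U' (\<lambda>x. W (T x))" if "smooth_on U W" for W :: "complex \<Rightarrow> 'b::euclidean_space"
    by (rule smooth_on_compose[OF U' U TU T(3) that])
  have fF: "fderiv F' x u = fderiv F (T x) (g x * u)" if "x \<in> U'" for x u
    using fderiv_cong[OF U' that F'] fderiv_holomorphic_compose[OF T(2)[OF that] S.diff_F[OF T(1)[OF that]]] by simp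
  have ipT: "S'.ip x a b = S.ip (T x) a b" if "x \<in> U'" for x a b by (simp add: F'[OF that])
  have prT: "S'.pr i x P Q = S.pr i (T x) P Q" if "x \<in> U'" for x P Q
    by (simp add: S'.pr_def S.pr_def ipT[OF that])
  have cv: "S'.cv u (\<lambda>x. A (T x)) x = S.cv (g x * u) A (T x)" if "x \<in> U'" "smooth_on U A" for x u A
    using fderiv_holomorphic_compose[OF T(2)[OF that(1)] S.diff[OF that(2) T(1)[OF that(1)]]]
    by (simp add: cov_def fF[OF that(1)] F'[OF that(1)])
  have cvC: "S'.cvC zd (\<lambda>x. W (T x)) x = g x *s S.cvC zd W (T x)" if "x \<in> U'" "smooth_on U W" for x W
  proof -
    note s = smooth_on_reV[OF U that(2)] smooth_on_imV[OF U that(2)]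
    note Tx = T(1)[OF that(1)]
    show ?thesis
      unfolding covC_def cv[OF that(1) s(1)] cv[OF that(1) s(2)]
      by (rule zd_scale[OF S.cv_linear[OF Tx S.diff[OF s(1) Tx]] S.cv_linear[OF Tx S.diff[OF s(2) Tx]]])
  qed
  have DC: "S'.DC zd x = g x *s S.DC zd (T x)" if "x \<in> U'" for x
    using zd_scale[OF linear_fderiv[OF S.diff_F[OF T(1)[OF that]]] linear_zero, of "g x"]
    by (simp add: partC_def fF[OF that])
  let ?Q = "\<lambda>a x. S.PP a (T x)"
  have "S'.pr i x (S'.PP a x) (S'.PP b x) = g x ^ (n + 2) * S'.pr i x (?Q a x) (?Q b x)"
  proof (rule S'.pr_transform[OF _ _ _ _ _ x ab])
    show "S'.psmooth (?Q a)" for a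
      using S.psmooth_PP[of a] sm[of "\<lambda>x. fst (S.PP a x)"] sm[of "\<lambda>x. snd (S.PP a x)"]
      by (simp add: S'.psmooth_def S.psmooth_def)
    show "S'.dN zd (?Q a) x = pscale (g x) (?Q (Suc a) x)" if "x \<in> U'" for a x
    proof -
      note s = S.psmooth_PP[of a, unfolded S.psmooth_def, THEN conjunct1] S.psmooth_PP[of a, unfolded S.psmooth_def, THEN conjunct2]
      show ?thesis
        by (simp add: S'.dN_def S.dN_def pscale_def cvC[OF that s(1)] cvC[OF that s(2)] DC[OF that] ipT[OF that]
            v'[OF that] S.ip_simps) (simp add: vec_eq_iff algebra_simps)
    qed
    show "S'.PP 0 x = pscale (g x) (?Q 0 x)" if "x \<in> U'" for x
      using S'.cvC_cong[where p = zd and W = v' and Z = "\<lambda>x. v (T x)", OF that v'] by (simp add: pscale_def DC[OF that] cvC[OF that S.smooth_v])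
    show "S'.pr i x (?Q a x) (?Q b x) = 0" if "a + b < n" "x \<in> U'" for a b x
      unfolding prT[OF that(2)] by (rule low[OF that(1) T(1)[OF that(2)]])
    show "S'.pr i x (?Q a x) (?Q (Suc b) x) = - S'.pr i x (?Q (Suc a) x) (?Q b x)" if "Suc (a + b) = n" "x \<in> U'" for a b x
      unfolding prT[OF that(2)] by (rule alt[OF that(1) T(1)[OF that(2)]])
  qed
  then show ?thesis unfolding prT[OF x] .
qed

section \<open>Harmonic maps, Jacobi fields and variations in coordinates\<close>

context map_into_chart
begin

lemma cv_DF_scale:
  assumes x: "x \<in> U"
  shows "cv (r *\<^sub>R u) (DF (s *\<^sub>R w)) x = (r * s) *\<^sub>R cv u (DF w) x"
proof -
  have "cv (r *\<^sub>R u) (DF (s *\<^sub>R w)) x = cv (r *\<^sub>R u) (\<lambda>x. s *\<^sub>R DF w x) x"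
    by (rule cv_cong[OF x]) (simp add: linear_cmul[OF linear_fderiv[OF diff_F]])
  also have "\<dots> = s *\<^sub>R cv (r *\<^sub>R u) (DF w) x"
    by (simp add: cov_def fderiv_bounded_linear[OF bounded_linear_scaleR_right diff[OF smooth_DF x]]
        \<Gamma>_scale FV[OF x] scaleR_add_right)
  also have "\<dots> = (r * s) *\<^sub>R cv u (DF w) x"
    by (simp add: linear_cmul[OF cv_linear[OF x diff[OF smooth_DF x]]])
  finally show ?thesis .
qed

lemma cv_scaleR:
  "x \<in> U \<Longrightarrow> smooth_on U A \<Longrightarrow> cv u (\<lambda>x. s *\<^sub>R A x) x = s *\<^sub>R cv u A x"
  by (simp add: cov_def fderiv_bounded_linear[OF bounded_linear_scaleR_right diff] \<Gamma>_scale FV scaleR_add_right)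

lemma cv_zero: "x \<in> U \<Longrightarrow> cv u (\<lambda>x. 0) x = 0"
  by (simp add: cov_def bilinear_rzero[OF bil_\<Gamma>[OF FV]])

lemma cov_C_eq:
  fixes W :: "'e \<Rightarrow> complex ^ 'd"
  assumes x: "x \<in> U" and W: "smooth_on U W"
  shows "fderiv W x u + christoffel_C (\<Gamma> (F x)) (cvec (fderiv F x u)) (W x) =
    mkV (cv u (\<lambda>x. reV (W x)) x) (cv u (\<lambda>x. imV (W x)) x)"
  by (rule complex_vec_eqI)
    (simp_all add: fderiv_mkV[OF diff[OF W x]] christoffel_C_eq[OF bil_\<Gamma>[OF FV[OF x]]] cov_def
      bilinear_lzero[OF bil_\<Gamma>[OF FV[OF x]]])

end

context surface_deformation
begin

lemma half_direction:
  "linear l \<Longrightarrow> l (1 / 2) = (1 / 2) *\<^sub>R l 1" "linear l \<Longrightarrow> l (\<i> / 2) = (1 / 2) *\<^sub>R l \<i>"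
  "linear l \<Longrightarrow> l (- (\<i> / 2)) = - ((1 / 2) *\<^sub>R l \<i>)" for l :: "complex \<Rightarrow> 'b::real_vector"
proof -
  have e: "(1 / 2) *\<^sub>R (1::complex) = 1 / 2" "(1 / 2) *\<^sub>R \<i> = \<i> / 2" "(- (1 / 2)) *\<^sub>R \<i> = - (\<i> / 2)"
    by (simp_all add: complex_eq_iff)
  show "linear l \<Longrightarrow> l (1 / 2) = (1 / 2) *\<^sub>R l 1" "linear l \<Longrightarrow> l (\<i> / 2) = (1 / 2) *\<^sub>R l \<i>"
    "linear l \<Longrightarrow> l (- (\<i> / 2)) = - ((1 / 2) *\<^sub>R l \<i>)"
    using linear_cmul[of l "1 / 2" 1, unfolded e] linear_cmul[of l "1 / 2" \<i>, unfolded e]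
      linear_cmul[of l "- (1 / 2)" \<i>, unfolded e] by simp_all
qed

lemma nabla_z_eq:
  assumes x: "x \<in> U" and W: "smooth_on U W"
  shows "nabla_z \<Gamma> F W x = cvC zd W x"
proof -
  note l = cv_linear[OF x diff[OF smooth_on_reV[OF open_U W] x]] cv_linear[OF x diff[OF smooth_on_imV[OF open_U W] x]]
  show ?thesis
    by (rule complex_vec_eqI)
      (simp_all add: nabla_z_def cov_C_def cov_C_eq[OF x W] covC_def half_direction[OF l(1)] half_direction[OF l(2)] algebra_simps)
qed

lemma d_z_eq: "x \<in> U \<Longrightarrow> d_z F x = DC zd x"
  by (rule complex_vec_eqI)
    (simp_all add: d_z_def partC_def half_direction[OF linear_fderiv[OF diff_F]])

lemma nabla_z_cong:
  assumes "x \<in> U" "\<And>y. y \<in> U \<Longrightarrow> W y = Z y" shows "nabla_z \<Gamma> F W x = nabla_z \<Gamma> F Z x"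
  using fderiv_cong[OF open_U assms] by (simp add: nabla_z_def cov_C_def assms)

lemma smooth_cvC_power: "smooth_on U W \<Longrightarrow> smooth_on U ((cvC p ^^ k) W)"
  by (induction k) (simp_all add: smooth_cvC)

lemma nabla_z_power:
  assumes W: "smooth_on U W" and Z: "\<And>y. y \<in> U \<Longrightarrow> Z y = W y"
  shows "x \<in> U \<Longrightarrow> (nabla_z \<Gamma> F ^^ k) Z x = (cvC zd ^^ k) W x"
proof (induction k arbitrary: x)
  case 0
  then show ?case by (simp add: Z)
next
  case (Suc k)
  show ?case
    using nabla_z_cong[OF Suc.prems Suc.IH] nabla_z_eq[OF Suc.prems smooth_cvC_power[OF W, where k = k and p = zd]] by simp
qed

lemma nabla_z_PP: "x \<in> U \<Longrightarrow> (nabla_z \<Gamma> F ^^ a) (d_z F) x = fst (PP a x)"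
  using nabla_z_power[OF smooth_DC d_z_eq, of x a] by (simp add: fst_PP)

text \<open>The sum is j with indices a + 1 and b + 1. Isotropy lets the iterated derivatives of v
  replace the second components of \<open>PP\<close>, after which the sum is the epsilon
  pairing.\<close>

lemma pr_nabla_z:
  assumes H: "\<And>i a b x. x \<in> U \<Longrightarrow> pr i x (PP a x) (PP b x) = 0" and x: "x \<in> U"
  shows "ip x ((nabla_z \<Gamma> F ^^ Suc a) v x) ((nabla_z \<Gamma> F ^^ b) (d_z F) x) +
    ip x ((nabla_z \<Gamma> F ^^ a) (d_z F) x) ((nabla_z \<Gamma> F ^^ Suc b) v x) = 0"
  using H[OF x, of True a b] pr_nabla_power[OF H x, of a b] pr_nabla_power[OF H x, of b a]
  unfolding nabla_z_PP[OF x] nabla_z_power[OF smooth_v refl x]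
  by (simp add: pr_def ip_sym[OF x, of "fst (PP a x)"] add.commute)

text \<open>The mixed derivative is a quarter of the sum of the two pure second covariant
  derivatives; its imaginary part cancels by torsion-freeness.\<close>

lemma harmonic_zI:
  assumes x: "x \<in> U" and harm: "cv 1 (DF 1) x + cv \<i> (DF \<i>) x = 0"
  shows "cvC zb (DC zd) x = 0"
proof -
  have e: "(1 / 2) *\<^sub>R (1::complex) = 1 / 2" "(1 / 2) *\<^sub>R \<i> = \<i> / 2" "(- (1 / 2)) *\<^sub>R \<i> = - (\<i> / 2)"
    by (simp_all add: complex_eq_iff)
  note c = cv_DF_scale[OF x, of "1 / 2" 1 "1 / 2" 1, unfolded e] cv_DF_scale[OF x, of "1 / 2" \<i> "- (1 / 2)" \<i>, unfolded e]
    cv_DF_scale[OF x, of "1 / 2" 1 "- (1 / 2)" \<i>, unfolded e] cv_DF_scale[OF x, of "1 / 2" \<i> "1 / 2" 1, unfolded e]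
  have "cv \<i> (DF \<i>) x = - cv 1 (DF 1) x" using harm by (simp add: eq_neg_iff_add_eq_0 add.commute)
  then show ?thesis
    by (intro complex_vec_eqI)
      (simp_all only: covC_def partC_def fst_conv snd_conv reV_mkV imV_mkV c torsion_free[OF x, of \<i> 1], simp_all)
qed

text \<open>Four times the mixed derivative of v has the flat Laplacian of W as real part and a
  commutator as imaginary part. The Jacobi equation rewrites the former, the Ricci identity the
  latter, and in both cases the space-form curvature gives exactly the stated K-term.\<close>

lemma jacobi_zI:
  assumes x: "x \<in> U" and W: "smooth_on U W" and v: "\<And>x. x \<in> U \<Longrightarrow> v x = cvec (W x)"
    and jac: "cv 1 (cv 1 W) x + cv \<i> (cv \<i> W) x +
      (curvature \<Gamma> (F x) (DF 1 x) (W x) (DF 1 x) + curvature \<Gamma> (F x) (DF \<i> x) (W x) (DF \<i> x)) = 0"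
  shows "cvC zb (cvC zd v) x +
      of_real K *s (ip x (DC zb x) (DC zd x) *s v x - ip x (v x) (DC zd x) *s DC zb x) = 0"
proof -
  have sv: "smooth_on U (\<lambda>x. cvec (W x))" by (rule smooth_on_cvec[OF open_U W])
  have "cvC zb (cvC zd v) x = cvC zb (\<lambda>x. mkV ((1 / 2) *\<^sub>R cv 1 W x) ((- 1 / 2) *\<^sub>R cv \<i> W x)) x"
  proof (rule cvC_cong[OF x])
    fix y assume y: "y \<in> U"
    have "cvC zd v y = cvC zd (\<lambda>x. cvec (W x)) y" by (rule cvC_cong[OF y v])
    then show "cvC zd v y = mkV ((1 / 2) *\<^sub>R cv 1 W y) ((- 1 / 2) *\<^sub>R cv \<i> W y)"
      by (simp add: covC_def cv_zero[OF y] half_direction[OF cv_linear[OF y diff[OF W y]]])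
  qed
  also have "\<dots> = mkV ((1 / 4) *\<^sub>R (cv 1 (cv 1 W) x + cv \<i> (cv \<i> W) x)) ((1 / 4) *\<^sub>R (cv \<i> (cv 1 W) x - cv 1 (cv \<i> W) x))"
  proof -
    show ?thesis
      by (rule complex_vec_eqI)
        (simp_all only: covC_def reV_mkV imV_mkV fst_conv snd_conv half_direction[OF cv_linear[OF x diff[OF smooth_cv[OF W] x]]]
          cv_scaleR[OF x smooth_cv[OF W]], simp_all add: algebra_simps)
  qed
  also have "cv \<i> (cv 1 W) x - cv 1 (cv \<i> W) x = - curvature \<Gamma> (F x) (DF \<i> x) (DF 1 x) (W x)"
    by (rule ricci_identity[OF x W])
  also have "cv 1 (cv 1 W) x + cv \<i> (cv \<i> W) x =
      - (curvature \<Gamma> (F x) (DF 1 x) (W x) (DF 1 x) + curvature \<Gamma> (F x) (DF \<i> x) (W x) (DF \<i> x))"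
    using jac by (simp only: eq_neg_iff_add_eq_0)
  finally show ?thesis
    using FV[OF x]
    by (intro complex_vec_eqI)
      (simp_all add: curvature_space_form ip_eq[OF x] v[OF x] partC_def half_direction[OF linear_fderiv[OF diff_F[OF x]]]
        G_scale G_neg bilinear_lzero[OF bil] sym[of _ "W x" "DF _ x"] sym[of _ "DF \<i> x" "DF 1 x"],
       simp_all add: algebra_simps)
qed

end

subsection \<open>Variations\<close>

text \<open>A variation is treated as one map of the pair (z, t). \<open>zd3\<close> and
  \<open>t3\<close> are the complexified directions of z and t on the product, so the commutation
  rules for covariant derivatives apply to space and time together.\<close>

abbreviation zd3 :: "(complex \<times> real) \<times> (complex \<times> real)" where "zd3 \<equiv> ((1 / 2, 0), (- (\<i> / 2), 0))"
abbreviation t3 :: "(complex \<times> real) \<times> (complex \<times> real)" where "t3 \<equiv> ((0, 1), (0, 0))"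

lemma fderiv_slice:
  fixes f :: "'a::real_normed_vector \<times> 'b::real_normed_vector \<Rightarrow> 'c::real_normed_vector"
  assumes "f differentiable at (x, t)"
  shows "fderiv (\<lambda>x. f (x, t)) x u = fderiv f (x, t) (u, 0)"
proof -
  have "((\<lambda>x. (x, t)) has_derivative (\<lambda>u. (u, 0))) (at x)"
    by (intro has_derivative_Pair has_derivative_ident has_derivative_const)
  from fderiv_eq[OF has_derivative_compose[OF this has_fderiv[OF assms]]] show ?thesis .
qed

locale variation_in_chart = space_form_map V G K U \<Phi>
  for V :: "(real ^ 'd::finite) set" and G and K and U :: "(complex \<times> real) set" and \<Phi>
begin

abbreviation slice :: "real \<Rightarrow> complex set" where "slice t \<equiv> {x. (x, t) \<in> U}"

lemma open_slice: "open (slice t)"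
proof -
  have "open ((\<lambda>x. (x, t)) -` U)" by (rule open_vimage[OF open_U]) (intro continuous_intros)
  then show ?thesis by (simp add: vimage_def)
qed

lemma smooth_slice: "smooth_on U f \<Longrightarrow> smooth_on (slice t) (\<lambda>x. f (x, t))" for f :: "_ \<Rightarrow> 'b::real_normed_vector"
proof -
  have "smooth_on (slice t) (\<lambda>x. (x, 0) + (0, t))"
    by (intro smooth_on_add smooth_on_linear smooth_on_const open_slice bounded_linear_Pair bounded_linear_ident bounded_linear_zero)
  then have "smooth_on (slice t) (\<lambda>x. (x, t))" by simp
  then show "smooth_on U f \<Longrightarrow> smooth_on (slice t) (\<lambda>x. f (x, t))"
    using smooth_on_compose[OF open_slice open_U, of "\<lambda>x. (x, t)" t f] by auto
qed

lemma slice_map: "space_form_map V G K (slice t) (\<lambda>x. \<Phi> (x, t))"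
  by unfold_locales (use open_slice smooth_slice[OF smooth_F] FV in auto)

lemma cov_slice:
  assumes "(x, t) \<in> U" "smooth_on U A"
  shows "cov \<Gamma> (\<lambda>x. \<Phi> (x, t)) u (\<lambda>x. A (x, t)) x = cv (u, 0) A (x, t)"
  using fderiv_slice[OF diff[OF assms(2,1)]] fderiv_slice[OF diff_F[OF assms(1)]] by (simp add: cov_def)

lemma covC_slice:
  assumes "(x, t) \<in> U" "smooth_on U W"
  shows "covC \<Gamma> (\<lambda>x. \<Phi> (x, t)) zd (\<lambda>x. W (x, t)) x = cvC zd3 W (x, t)"
  using cov_slice[OF assms(1) smooth_on_reV[OF open_U assms(2)]] cov_slice[OF assms(1) smooth_on_imV[OF open_U assms(2)]]
  by (simp add: covC_def)

lemma partC_slice: "(x, t) \<in> U \<Longrightarrow> partC (\<lambda>x. \<Phi> (x, t)) zd x = DC zd3 (x, t)"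
  using fderiv_slice[OF diff_F] by (simp add: partC_def)

definition \<Psi> :: "nat \<Rightarrow> complex \<times> real \<Rightarrow> complex ^ 'd" where "\<Psi> a = (cvC zd3 ^^ a) (DC zd3)"

lemma smooth_\<Psi>: "smooth_on U (\<Psi> a)"
  unfolding \<Psi>_def by (induction a) (simp_all add: smooth_DC smooth_cvC)

lemma slice_deformation:
  assumes "smooth_on (slice t) v"
  shows "surface_deformation V G K (slice t) (\<lambda>x. \<Phi> (x, t)) v"
proof -
  interpret S: space_form_map V G K "slice t" "\<lambda>x. \<Phi> (x, t)" by (rule slice_map)
  show ?thesis by unfold_locales (rule assms)
qed

lemma nabla_z_slice:
  assumes xt: "(x, t) \<in> U"
  shows "(nabla_z \<Gamma> (\<lambda>x. \<Phi> (x, t)) ^^ a) (d_z (\<lambda>x. \<Phi> (x, t))) x = \<Psi> a (x, t)"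
proof -
  interpret S: surface_deformation V G K "slice t" "\<lambda>x. \<Phi> (x, t)" "\<lambda>_. 0"
    by (rule slice_deformation) (rule smooth_on_const[OF open_slice])
  have "fst (S.PP a x) = \<Psi> a (x, t)" if "x \<in> slice t" for x
    using that
  proof (induction a arbitrary: x)
    case 0
    then show ?case by (simp add: \<Psi>_def partC_slice)
  next
    case (Suc a)
    then have "S.cvC zd (\<lambda>x. fst (S.PP a x)) x = S.cvC zd (\<lambda>x. \<Psi> a (x, t)) x"
      by (intro S.cvC_cong) auto
    also have "\<dots> = \<Psi> (Suc a) (x, t)"
      using Suc.prems covC_slice[of x t "\<Psi> a"] smooth_\<Psi> by (simp add: \<Psi>_def)
    finally show ?case by (simp add: S.dN_def)
  qed
  then show ?thesis using S.nabla_z_PP[of x a] xt by simp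
qed

text \<open>The formal deformation is the actual one. Torsion-freeness exchanges t and z in the
  starting value; in the induction step, exchanging the t and z derivatives creates precisely the
  curvature term built into \<open>dN\<close>.\<close>

lemma PP_slice:
  assumes x: "(x, 0) \<in> U"
  shows "surface_deformation.PP G K (\<lambda>x. \<Phi> (x, 0)) (\<lambda>x. DC t3 (x, 0)) a x = (\<Psi> a (x, 0), cvC t3 (\<Psi> a) (x, 0))"
proof -
  interpret S: surface_deformation V G K "slice 0" "\<lambda>x. \<Phi> (x, 0)" "\<lambda>x. DC t3 (x, 0)"
    by (rule slice_deformation) (rule smooth_slice[OF smooth_DC])
  have "S.PP a x = (\<Psi> a (x, 0), cvC t3 (\<Psi> a) (x, 0))" if "x \<in> slice 0" for x
    using that
  proof (induction a arbitrary: x)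
    case 0
    then show ?case
      using covC_slice[of x 0 "DC t3"] cvC_torsion_free[of "(x, 0)" t3 zd3] by (simp add: \<Psi>_def partC_slice smooth_DC)
  next
    case (Suc a)
    then have xU: "(x, 0) \<in> U" by simp
    have "S.cvC zd (\<lambda>x. fst (S.PP a x)) x = S.cvC zd (\<lambda>x. \<Psi> a (x, 0)) x"
      "S.cvC zd (\<lambda>x. snd (S.PP a x)) x = S.cvC zd (\<lambda>x. cvC t3 (\<Psi> a) (x, 0)) x"
      using Suc by (intro S.cvC_cong; simp)+
    then have 1: "S.cvC zd (\<lambda>x. fst (S.PP a x)) x = \<Psi> (Suc a) (x, 0)"
      "S.cvC zd (\<lambda>x. snd (S.PP a x)) x = cvC zd3 (cvC t3 (\<Psi> a)) (x, 0)"
      using covC_slice[OF xU smooth_\<Psi>, of a] covC_slice[OF xU smooth_cvC[OF smooth_\<Psi>], of t3 a]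
      by (simp_all add: \<Psi>_def)
    have "cvC t3 (\<Psi> (Suc a)) (x, 0) = cvC zd3 (cvC t3 (\<Psi> a)) (x, 0) +
       K *\<^sub>R (ip (x, 0) (DC zd3 (x, 0)) (\<Psi> a (x, 0)) *s DC t3 (x, 0) - ip (x, 0) (DC t3 (x, 0)) (\<Psi> a (x, 0)) *s DC zd3 (x, 0))"
      using cvC_ricci[OF xU smooth_\<Psi>, of t3 zd3 a] by (simp add: \<Psi>_def algebra_simps)
    then show ?case
      using Suc.IH[OF Suc.prems] by (simp add: S.dN_def 1 partC_slice[OF xU] scaleR_eq_cscale[of K])
  qed
  then show ?thesis using x by simp
qed

text \<open>By metric compatibility the t-derivative of the pairing is its epsilon coefficient at t
  = 0, which is assumed to vanish.\<close>

lemma eta_derivative: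
  assumes x: "(x, 0) \<in> U" and zero: "deformation.pr G (\<lambda>x. \<Phi> (x, 0)) True x
      (surface_deformation.PP G K (\<lambda>x. \<Phi> (x, 0)) (\<lambda>x. DC t3 (x, 0)) a x)
      (surface_deformation.PP G K (\<lambda>x. \<Phi> (x, 0)) (\<lambda>x. DC t3 (x, 0)) b x) = 0"
  shows "((\<lambda>t. ip (x, t) (\<Psi> a (x, t)) (\<Psi> b (x, t))) has_vector_derivative 0) (at 0)"
proof -
  interpret S: surface_deformation V G K "slice 0" "\<lambda>x. \<Phi> (x, 0)" "\<lambda>x. DC t3 (x, 0)"
    by (rule slice_deformation) (rule smooth_slice[OF smooth_DC])
  let ?f = "\<lambda>y. ip y (\<Psi> a y) (\<Psi> b y)"
  have d: "?f differentiable at (x, 0)" by (rule diff[OF smooth_ip[OF smooth_\<Psi> smooth_\<Psi>] x])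
  have "derivC t3 ?f (x, 0) = 0"
    unfolding derivC_ip[OF x smooth_\<Psi> smooth_\<Psi>]
    using zero unfolding PP_slice[OF x] S.pr_def by (simp add: add.commute)
  then have 0: "fderiv ?f (x, 0) (0, 1) = 0"
    using linear_0[OF linear_fderiv[OF d]] by (simp add: derivC_def zero_prod_def)
  have "((\<lambda>t. (x, t)) has_derivative (\<lambda>r. (0, r))) (at 0)"
    by (intro has_derivative_Pair has_derivative_ident has_derivative_const)
  from has_derivative_compose[OF this has_fderiv[OF d]]
  have "((\<lambda>t. ?f (x, t)) has_derivative (\<lambda>r. fderiv ?f (x, 0) (0, r))) (at 0)" .
  moreover have "fderiv ?f (x, 0) (0, r) = r *\<^sub>R 0" for r
    using linear_cmul[OF linear_fderiv[OF d], of r "(0, 1)"] 0 by simp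
  ultimately show ?thesis by (simp add: has_vector_derivative_def)
qed

end

section \<open>Conformal traces\<close>

text \<open>\<open>metric_trace\<close> uses a chosen orthonormal basis, about which only
  orthonormality is known. Expanding vectors in it gives the Parseval identity \<open>par\<close>;
  for the vectors 1 and \<i> this yields the sums of squares and products of real and imaginary
  parts, which are all that a bilinear B sees.\<close>

lemma metric_trace_conformal:
  fixes B :: "complex \<Rightarrow> complex \<Rightarrow> 'b::real_vector"
  assumes b: "\<And>u w. b u w = l * (u \<bullet> w)" and l: "l > 0" and B: "bilinear B"
  shows "metric_trace b B = (1 / l) *\<^sub>R (B 1 1 + B \<i> \<i>)"
proof -
  \<comment> \<open>Some orthonormal basis has to exist for the choice to be meaningful: 1 and \<i>
    rescaled by the conformal factor.\<close>
  have "orthonormal_basis b {of_real (1 / sqrt l), of_real (1 / sqrt l) * \<i>}"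
  proof -
    have "z \<in> span {of_real (1 / sqrt l), of_real (1 / sqrt l) * \<i>}" for z
    proof -
      have "z = (Re z * sqrt l) *\<^sub>R of_real (1 / sqrt l) + (Im z * sqrt l) *\<^sub>R (of_real (1 / sqrt l) * \<i>)"
        using l by (simp add: complex_eq_iff)
      then show ?thesis by (metis insertCI span_add span_base span_scale)
    qed
    moreover have "of_real (1 / sqrt l) \<noteq> of_real (1 / sqrt l) * \<i>" using l by (simp add: complex_eq_iff)
    ultimately show ?thesis using l by (auto simp: orthonormal_basis_def b inner_complex_def)
  qed
  then have onb: "orthonormal_basis b (SOME E. orthonormal_basis b E)" by (rule someI)
  define E where "E = (SOME E. orthonormal_basis b E)"
  have E: "finite E" "span E = UNIV" "\<And>e e'. e \<in> E \<Longrightarrow> e' \<in> E \<Longrightarrow> b e e' = (if e = e' then 1 else 0)"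
    using onb[folded E_def] unfolding orthonormal_basis_def by blast+
  have exp: "z = (\<Sum>e\<in>E. (l * (z \<bullet> e)) *\<^sub>R e)" for z
  proof -
    have "z \<in> span E" using E by simp
    then obtain c where c: "z = (\<Sum>e\<in>E. c e *\<^sub>R e)" using E(1) by (auto simp: span_finite)
    have "l * (z \<bullet> e) = c e" if "e \<in> E" for e
    proof -
      have "l * (z \<bullet> e) = (\<Sum>e'\<in>E. c e' * b e' e)" by (simp add: c inner_sum_left sum_distrib_left b algebra_simps)
      also have "\<dots> = (\<Sum>e'\<in>E. if e' = e then c e else 0)" using E(3) that by (intro sum.cong) auto
      finally show ?thesis using E(1) that by simp
    qed
    then show ?thesis using c by simp
  qed
  have par: "l * (\<Sum>e\<in>E. (z \<bullet> e) * (w \<bullet> e)) = z \<bullet> w" for z w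
  proof -
    have "z \<bullet> w = (\<Sum>e\<in>E. (l * (z \<bullet> e)) *\<^sub>R e) \<bullet> w" using exp[of z] by simp
    also have "\<dots> = l * (\<Sum>e\<in>E. (z \<bullet> e) * (w \<bullet> e))"
      by (simp add: inner_sum_left sum_distrib_left mult.assoc) (simp add: inner_commute)
    finally show ?thesis by simp
  qed
  have p: "(\<Sum>e\<in>E. Re e * Re e) = 1 / l" "(\<Sum>e\<in>E. Im e * Im e) = 1 / l" "(\<Sum>e\<in>E. Re e * Im e) = 0"
    using par[of 1 1] par[of \<i> \<i>] par[of 1 \<i>] l by (simp_all add: inner_complex_def field_simps)
  have Bee: "B e e = (Re e * Re e) *\<^sub>R B 1 1 + (Im e * Im e) *\<^sub>R B \<i> \<i> + (Re e * Im e) *\<^sub>R (B 1 \<i> + B \<i> 1)" for e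
  proof -
    have e: "e = Re e *\<^sub>R 1 + Im e *\<^sub>R \<i>" by (simp add: complex_eq_iff)
    have "B e e = B (Re e *\<^sub>R 1 + Im e *\<^sub>R \<i>) (Re e *\<^sub>R 1 + Im e *\<^sub>R \<i>)" using e by simp
    also have "\<dots> = (Re e * Re e) *\<^sub>R B 1 1 + (Im e * Im e) *\<^sub>R B \<i> \<i> + (Re e * Im e) *\<^sub>R (B 1 \<i> + B \<i> 1)"
      by (simp only: bilinear_ladd[OF B] bilinear_radd[OF B] bilinear_lmul[OF B] bilinear_rmul[OF B])
        (simp add: algebra_simps)
    finally show ?thesis .
  qed
  have "(\<Sum>e\<in>E. B e e) = (\<Sum>e\<in>E. (Re e * Re e) *\<^sub>R B 1 1 + (Im e * Im e) *\<^sub>R B \<i> \<i>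
      + (Re e * Im e) *\<^sub>R (B 1 \<i> + B \<i> 1))"
    by (intro sum.cong refl Bee)
  also have "\<dots> = (\<Sum>e\<in>E. Re e * Re e) *\<^sub>R B 1 1 + (\<Sum>e\<in>E. Im e * Im e) *\<^sub>R B \<i> \<i>
      + (\<Sum>e\<in>E. Re e * Im e) *\<^sub>R (B 1 \<i> + B \<i> 1)"
    by (simp only: sum.distrib scaleR_sum_left)
  finally show ?thesis unfolding metric_trace_def E_def[symmetric] p by (simp add: scaleR_add_right)
qed

text \<open>Conformal coordinates on a surface are harmonic functions. The identity follows from
  differentiating G(1, \<i>) = 0 and G(1, 1) = G(\<i>, \<i>), and it makes the domain connection
  disappear from the tension field and from the Laplacian.\<close>

lemma conformal_christoffel_trace:
  fixes G :: "complex \<Rightarrow> complex \<Rightarrow> complex \<Rightarrow> real"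
  assumes S: "open S" "x \<in> S" and conf: "\<And>y. y \<in> S \<Longrightarrow> \<exists>l>0. \<forall>u w. G y u w = l * (u \<bullet> w)"
    and lc: "levi_civita_at G x \<Gamma>"
  shows "\<Gamma> 1 1 + \<Gamma> \<i> \<i> = 0"
proof -
  obtain l where l: "l > 0" "\<And>u w. G x u w = l * (u \<bullet> w)" using conf S by blast
  define D where "D u w z = fderiv (\<lambda>y. G y w z) x u" for u w z
  have D: "D u w z = l * (\<Gamma> u w \<bullet> z) + l * (w \<bullet> \<Gamma> u z)" and s: "\<Gamma> u w = \<Gamma> w u" for u w z
    using lc unfolding levi_civita_at_def D_def l(2) by blast+
  have "fderiv (\<lambda>y. G y 1 \<i>) x = fderiv (\<lambda>_. 0) x"
    by (rule fderiv_cong[OF S]) (use conf in \<open>force simp: inner_complex_def\<close>)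
  then have D0: "D u 1 \<i> = 0" for u by (simp add: D_def)
  have "fderiv (\<lambda>y. G y 1 1) x = fderiv (\<lambda>y. G y \<i> \<i>) x"
    by (rule fderiv_cong[OF S]) (use conf in \<open>force simp: inner_complex_def\<close>)
  then have D1: "D u 1 1 = D u \<i> \<i>" for u by (simp add: D_def)
  have D': "\<Gamma> u w \<bullet> z + w \<bullet> \<Gamma> u z = D u w z / l" for u w z
    using D[of u w z] l(1) by (simp add: field_simps)
  have "\<Gamma> 1 1 \<bullet> \<i> + 1 \<bullet> \<Gamma> 1 \<i> = 0" "\<Gamma> 1 \<i> \<bullet> \<i> + 1 \<bullet> \<Gamma> \<i> \<i> = 0"
    "\<Gamma> 1 1 \<bullet> 1 + 1 \<bullet> \<Gamma> 1 1 = \<Gamma> 1 \<i> \<bullet> \<i> + \<i> \<bullet> \<Gamma> 1 \<i>"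
    "\<Gamma> 1 \<i> \<bullet> 1 + 1 \<bullet> \<Gamma> 1 \<i> = \<Gamma> \<i> \<i> \<bullet> \<i> + \<i> \<bullet> \<Gamma> \<i> \<i>"
    using D'[of 1 1 \<i>] D'[of \<i> 1 \<i>] D'[of 1 1 1] D'[of 1 \<i> \<i>] D'[of \<i> 1 1] D'[of \<i> \<i> \<i>]
    by (simp_all add: D0 D1 s[of \<i> 1])
  then show ?thesis by (simp add: complex_eq_iff inner_complex_def)
qed

context map_into_chart
begin

text \<open>Needed to evaluate traces. Linearity in the inner direction is known only on U, and is
  passed through the outer derivative by locality.\<close>

lemma bilinear_cv_cv:
  assumes x: "x \<in> U" and W: "smooth_on U W" shows "bilinear (\<lambda>u w. cv u (cv w W) x)"
proof -
  have l: "linear (\<lambda>w. cv w W y)" if "y \<in> U" for y by (rule cv_linear[OF that diff[OF W that]])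
  have "cv u (cv (w + z) W) x = cv u (cv w W) x + cv u (cv z W) x" for u w z
  proof -
    have "cv u (cv (w + z) W) x = cv u (\<lambda>y. cv w W y + cv z W y) x"
      by (rule cv_cong[OF x]) (rule linear_add[OF l])
    also have "\<dots> = cv u (cv w W) x + cv u (cv z W) x"
      by (simp add: cov_def[of _ _ u] fderiv_add[OF diff[OF smooth_cv[OF W] x] diff[OF smooth_cv[OF W] x]] \<Gamma>_add FV[OF x])
    finally show ?thesis .
  qed
  moreover have "cv u (cv (r *\<^sub>R w) W) x = r *\<^sub>R cv u (cv w W) x" for u r w
    using cv_cong[OF x, of "cv (r *\<^sub>R w) W" "\<lambda>y. r *\<^sub>R cv w W y" u] linear_cmul[OF l] cv_scaleR[OF x smooth_cv[OF W]] by simp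
  ultimately show ?thesis
    unfolding bilinear_def using cv_linear[OF x diff[OF smooth_cv[OF W] x]] by (auto intro!: linearI)
qed

lemma bilinear_cv_DF:
  assumes x: "x \<in> U" shows "bilinear (\<lambda>u w. cv u (DF w) x)"
proof -
  have l: "linear (\<lambda>w. DF w y)" if "y \<in> U" for y by (rule linear_fderiv[OF diff_F[OF that]])
  have "cv u (DF (w + z)) x = cv u (DF w) x + cv u (DF z) x" for u w z
  proof -
    have "cv u (DF (w + z)) x = cv u (\<lambda>y. DF w y + DF z y) x"
      by (rule cv_cong[OF x]) (rule linear_add[OF l])
    also have "\<dots> = cv u (DF w) x + cv u (DF z) x"
      by (simp add: cov_def fderiv_add[OF diff[OF smooth_DF x] diff[OF smooth_DF x]] \<Gamma>_add FV[OF x])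
    finally show ?thesis .
  qed
  moreover have "cv u (DF (r *\<^sub>R w)) x = r *\<^sub>R cv u (DF w) x" for u r w
    using cv_cong[OF x, of "DF (r *\<^sub>R w)" "\<lambda>y. r *\<^sub>R DF w y" u] linear_cmul[OF l] cv_scaleR[OF x smooth_DF] by simp
  ultimately show ?thesis
    unfolding bilinear_def using cv_linear[OF x diff[OF smooth_DF x]] by (auto intro!: linearI)
qed

end

lemma bilinear_diff:
  assumes "bilinear B" "bilinear C" shows "bilinear (\<lambda>u w. B u w - C u w)"
  using assms by (auto simp: bilinear_def linear_iff algebra_simps)

lemma bilinear_linear:
  assumes "bilinear B" "linear L" shows "bilinear (\<lambda>u w. L (B u w))"
  using assms by (auto simp: bilinear_def linear_iff)

section \<open>Charts\<close>

abbreviation cinv :: "('m, 'e) chart \<Rightarrow> 'e \<Rightarrow> 'm" where "cinv c \<equiv> inv_into (fst c) (snd c)"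
abbreviation img :: "('m, 'e) chart \<Rightarrow> 'e set" where "img c \<equiv> snd c ` fst c"

lemma chart_open: "is_chart M c \<Longrightarrow> open (img c)"
  by (simp add: is_chart_def)

lemma chart_openin: "is_chart M c \<Longrightarrow> openin (top_of_set M) (fst c)"
  by (simp add: is_chart_def)

lemma chart_subset: "is_chart M c \<Longrightarrow> fst c \<subseteq> M"
  by (rule openin_imp_subset[OF chart_openin])

lemma chart_inv: "is_chart M c \<Longrightarrow> p \<in> fst c \<Longrightarrow> cinv c (snd c p) = p"
  unfolding is_chart_def homeomorphism_def by (metis inj_on_def inv_into_f_f)

lemma chart_inv_in: "x \<in> img c \<Longrightarrow> cinv c x \<in> fst c" and chart_right_inv: "x \<in> img c \<Longrightarrow> snd c (cinv c x) = x"
  by (auto intro: inv_into_into f_inv_into_f)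

lemma chart_continuous_inv: assumes "is_chart M c" shows "continuous_on (img c) (cinv c)"
proof -
  obtain k where k: "homeomorphism (fst c) (img c) (snd c) k" using assms by (auto simp: is_chart_def)
  have "cinv c x = k x" if "x \<in> img c" for x
    using k that chart_inv[OF assms] unfolding homeomorphism_def by (metis imageE)
  then show ?thesis using k unfolding homeomorphism_def by (metis (no_types, lifting) continuous_on_cong)
qed

lemma rep_dom_iff:
  assumes "is_chart M c"
  shows "x \<in> rep_dom c d f \<longleftrightarrow> x \<in> img c \<and> f (cinv c x) \<in> fst d"
  unfolding rep_dom_def using chart_inv[OF assms] by (auto simp: image_iff)

lemma open_rep_dom:
  assumes c: "is_chart M c" and f: "continuous_on M f" "f ` M \<subseteq> N" and d: "openin (top_of_set N) (fst d)"
  shows "open (rep_dom c d f)"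
proof -
  obtain T where T: "open T" "fst d = N \<inter> T" using d by (auto simp: openin_open)
  have m: "cinv c x \<in> M" if "x \<in> img c" for x using chart_inv_in[OF that] chart_subset[OF c] by blast
  have "continuous_on (img c) (\<lambda>x. f (cinv c x))"
    by (rule continuous_on_compose2[OF f(1) chart_continuous_inv[OF c]]) (use m in auto)
  from continuous_open_preimage[OF this chart_open[OF c] T(1)]
  have "open (img c \<inter> (\<lambda>x. f (cinv c x)) -` T)" .
  moreover have "img c \<inter> (\<lambda>x. f (cinv c x)) -` T = rep_dom c d f"
    using m f(2) by (intro set_eqI) (unfold rep_dom_iff[OF c] T(2), blast)
  ultimately show ?thesis by simp
qed

section \<open>Holomorphy and real smoothness\<close>

lemma holomorphic_smooth_on:
  assumes "f holomorphic_on S" "open S" shows "smooth_on S f"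
proof -
  have "Ck_on k S f" if "f holomorphic_on S" for k and f :: "complex \<Rightarrow> complex"
    using that
  proof (induction k arbitrary: f)
    case 0
    then show ?case by (simp add: holomorphic_on_imp_continuous_on)
  next
    case (Suc k)
    have d: "(f has_derivative (*) (deriv f x)) (at x)" if "x \<in> S" for x
      using holomorphic_derivI[OF Suc.prems assms(2) that, of UNIV] by (simp add: has_field_derivative_def)
    show ?case
    proof (rule Ck_on_SucI[OF assms(2)])
      show "f differentiable at x" if "x \<in> S" for x using d[OF that] by (auto simp: differentiable_def)
      have "Ck_on k S (\<lambda>x. deriv f x * u)" for u
        by (rule Suc.IH) (intro holomorphic_intros holomorphic_deriv[OF Suc.prems assms(2)])
      then show "Ck_on k S (\<lambda>x. fderiv f x u)" for u
        by (rule Ck_on_cong[OF assms(2), of "\<lambda>x. deriv f x * u", rotated]) (simp add: fderiv_eq[OF d])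
    qed
  qed
  then show ?thesis using assms(1) by (simp add: smooth_on_def)
qed

lemma cauchy_riemann_holomorphic:
  assumes S: "open S" and f: "\<And>x. x \<in> S \<Longrightarrow> f differentiable at x"
    and cr: "\<And>x. x \<in> S \<Longrightarrow> derivC zb f x = 0"
  shows "f holomorphic_on S"
proof -
  have "(f has_field_derivative fderiv f x 1) (at x)" if x: "x \<in> S" for x
  proof -
    note l = linear_fderiv[OF f[OF x]]
    have e: "(1 / 2) *\<^sub>R (1::complex) = 1 / 2" "(1 / 2) *\<^sub>R \<i> = \<i> / 2" by (simp_all add: complex_eq_iff)
    have "fderiv f x 1 + \<i> * fderiv f x \<i> = 0"
      using cr[OF x] linear_cmul[OF l, of "1 / 2" 1, unfolded e] linear_cmul[OF l, of "1 / 2" \<i>, unfolded e]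
      by (simp add: derivC_def complex_eq_iff)
    then have i: "fderiv f x \<i> = \<i> * fderiv f x 1"
      by (simp add: complex_eq_iff)
    have eq: "fderiv f x 1 * u = fderiv f x u" for u
    proof -
      have "fderiv f x u = fderiv f x (Re u *\<^sub>R 1 + Im u *\<^sub>R \<i>)"
        by (rule arg_cong[of _ _ "fderiv f x"]) (simp add: complex_eq_iff)
      also have "\<dots> = Re u *\<^sub>R fderiv f x 1 + Im u *\<^sub>R fderiv f x \<i>"
        by (simp only: linear_add[OF l] linear_cmul[OF l])
      finally show ?thesis by (simp add: i complex_eq_iff algebra_simps)
    qed
    have "(*) (fderiv f x 1) = fderiv f x" by (intro ext eq)
    then show ?thesis using has_fderiv[OF f[OF x]] by (simp only: has_field_derivative_def)
  qed
  then show ?thesis using S by (auto simp: holomorphic_on_open)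
qed

section \<open>The stereographic charts of the sphere\<close>

definition stereo_N :: "(complex \<times> real, complex) chart" where
  "stereo_N = (S2 - {(0, 1)}, \<lambda>(w, t). w / complex_of_real (1 - t))"

definition stereo_S :: "(complex \<times> real, complex) chart" where
  "stereo_S = (S2 - {(0, - 1)}, \<lambda>(w, t). cnj w / complex_of_real (1 + t))"

lemma stereographic_charts_eq: "stereographic_charts = {stereo_N, stereo_S}"
  by (simp add: stereographic_charts_def stereo_N_def stereo_S_def)

definition unstereo :: "complex \<Rightarrow> complex \<times> real" where
  "unstereo z = (complex_of_real (2 / (1 + (cmod z)\<^sup>2)) * z, ((cmod z)\<^sup>2 - 1) / ((cmod z)\<^sup>2 + 1))"

text \<open>The rotation by \<pi> about the real axis of the complex plane. It exchanges the poles
  and carries one stereographic chart to the other, so facts about \<open>stereo_S\<close> are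
  transported from \<open>stereo_N\<close>.\<close>

definition flip :: "complex \<times> real \<Rightarrow> complex \<times> real" where "flip p = (cnj (fst p), - snd p)"

lemma S2_iff: "(w, t) \<in> S2 \<longleftrightarrow> (cmod w)\<^sup>2 + t\<^sup>2 = 1"
  by (simp add: S2_def norm_Pair)

lemma pos_one_plus: "1 + (cmod z)\<^sup>2 > 0"
  by (simp add: add_pos_nonneg)

lemma unstereo_S2: "unstereo z \<in> S2"
proof -
  have "(2 / (1 + r) * s)\<^sup>2 + ((r - 1) / (r + 1))\<^sup>2 = 1" if "r = s\<^sup>2" "1 + r > 0" for r s :: real
    using that by (simp add: field_simps) (simp add: power2_eq_square algebra_simps)
  moreover have "cmod (fst (unstereo z)) = 2 / (1 + (cmod z)\<^sup>2) * cmod z"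
    using pos_one_plus[of z] by (simp only: unstereo_def fst_conv norm_mult norm_of_real) simp
  ultimately show ?thesis
    using pos_one_plus[of z] S2_iff[of "fst (unstereo z)" "snd (unstereo z)"] by (simp add: unstereo_def)
qed

lemma unstereo_props:
  "complex_of_real (1 - snd (unstereo z)) \<noteq> 0" "fst (unstereo z) / complex_of_real (1 - snd (unstereo z)) = z"
proof -
  have e: "1 - snd (unstereo z) = 2 / (1 + (cmod z)\<^sup>2)" using pos_one_plus[of z] by (simp add: unstereo_def field_simps)
  define c where "c = 2 / (1 + (cmod z)\<^sup>2)"
  have "complex_of_real c \<noteq> 0" using pos_one_plus[of z] by (simp only: c_def of_real_eq_0_iff) simp
  then show "complex_of_real (1 - snd (unstereo z)) \<noteq> 0" "fst (unstereo z) / complex_of_real (1 - snd (unstereo z)) = z"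
    unfolding e c_def[symmetric] by (simp_all add: unstereo_def c_def[symmetric])
qed

lemma unstereo_inverse:
  assumes "(w, t) \<in> S2" "t \<noteq> 1"
  shows "unstereo (w / complex_of_real (1 - t)) = (w, t)"
proof -
  have t: "1 - t \<noteq> 0" using assms by simp
  have r: "(cmod (w / complex_of_real (1 - t)))\<^sup>2 = (1 + t) / (1 - t)"
  proof -
    have "(cmod w)\<^sup>2 = (1 + t) * (1 - t)" using assms(1) by (simp add: S2_iff power2_eq_square algebra_simps)
    then show ?thesis using t
      by (simp only: norm_divide norm_of_real power_divide power2_abs) (simp add: power2_eq_square)
  qed
  have "1 + (1 + t) / (1 - t) = 2 / (1 - t)" "(1 + t) / (1 - t) - 1 = 2 * t / (1 - t)" using t by (simp_all add: field_simps)
  then show ?thesis using t unfolding unstereo_def r by (simp add: add.commute)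
qed

lemma flip_S2: "flip p \<in> S2 \<longleftrightarrow> p \<in> S2" and flip_flip: "flip (flip p) = p"
  by (cases p; simp add: flip_def S2_iff)+

lemma snd_stereo_S: "snd stereo_S p = snd stereo_N (flip p)"
  by (cases p) (simp add: stereo_N_def stereo_S_def flip_def)

lemma fst_stereo_N: "(w, t) \<in> fst stereo_N \<longleftrightarrow> (w, t) \<in> S2 \<and> t \<noteq> 1"
  by (auto simp: stereo_N_def S2_iff)

lemma fst_stereo_S: "p \<in> fst stereo_S \<longleftrightarrow> flip p \<in> fst stereo_N"
  by (cases p) (auto simp: stereo_N_def stereo_S_def flip_def S2_iff)

lemma stereo_N_homeomorphism: "homeomorphism (fst stereo_N) UNIV (snd stereo_N) unstereo"
proof (rule homeomorphismI)
  have "continuous_on (fst stereo_N) (\<lambda>p. fst p / complex_of_real (1 - snd p))"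
    by (intro continuous_intros) (auto simp: fst_stereo_N)
  then show "continuous_on (fst stereo_N) (snd stereo_N)" by (simp add: stereo_N_def case_prod_unfold)
  show "continuous_on UNIV unstereo"
    unfolding unstereo_def using pos_one_plus
    by (intro continuous_intros) (auto simp: add.commute less_imp_neq[THEN not_sym])
  show "unstereo ` UNIV \<subseteq> fst stereo_N"
  proof (rule image_subsetI)
    fix z :: complex
    show "unstereo z \<in> fst stereo_N"
      using unstereo_S2[of z] unstereo_props(1)[of z] fst_stereo_N[of "fst (unstereo z)" "snd (unstereo z)"] by auto
  qed
  show "unstereo (snd stereo_N p) = p" if "p \<in> fst stereo_N" for p
    using that unstereo_inverse[of "fst p" "snd p"] fst_stereo_N[of "fst p" "snd p"]
    by (simp add: stereo_N_def case_prod_unfold)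
  show "snd stereo_N (unstereo z) = z" for z
    using unstereo_props(2)[of z] by (simp add: stereo_N_def case_prod_unfold)
qed auto

lemma stereo_S_homeomorphism: "homeomorphism (fst stereo_S) UNIV (snd stereo_S) (\<lambda>z. flip (unstereo z))"
proof -
  have cf: "continuous_on A flip" for A unfolding flip_def by (intro continuous_intros)
  note h = stereo_N_homeomorphism[unfolded homeomorphism_def]
  show ?thesis
  proof (rule homeomorphismI)
    show "continuous_on (fst stereo_S) (snd stereo_S)"
      unfolding snd_stereo_S[abs_def]
      by (rule continuous_on_compose2[of "fst stereo_N" "snd stereo_N", OF _ cf]) (use h fst_stereo_S in auto)
    show "continuous_on UNIV (\<lambda>z. flip (unstereo z))"
      by (rule continuous_on_compose2[OF cf[of UNIV]]) (use h in auto)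
    show "(\<lambda>z. flip (unstereo z)) ` UNIV \<subseteq> fst stereo_S"
      using h by (auto simp: fst_stereo_S flip_flip)
    show "flip (unstereo (snd stereo_S p)) = p" if "p \<in> fst stereo_S" for p
      using h that by (simp add: snd_stereo_S fst_stereo_S flip_flip)
    show "snd stereo_S (flip (unstereo z)) = z" for z
      using h by (simp add: snd_stereo_S flip_flip)
  qed auto
qed

lemma stereo_is_chart: "is_chart S2 stereo_N" "is_chart S2 stereo_S"
proof -
  have o: "openin (top_of_set S2) (S2 - {p})" for p
    by (simp add: Diff_eq openin_open_Int open_Compl)
  have "img stereo_N = UNIV" "img stereo_S = UNIV"
    using stereo_N_homeomorphism stereo_S_homeomorphism by (simp_all add: homeomorphism_def)
  moreover have "fst stereo_N = S2 - {(0, 1)}" "fst stereo_S = S2 - {(0, - 1)}"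
    by (simp_all add: stereo_N_def stereo_S_def)
  ultimately show "is_chart S2 stereo_N" "is_chart S2 stereo_S"
    using stereo_N_homeomorphism stereo_S_homeomorphism o by (auto simp: is_chart_def)
qed

lemma img_stereo: "s \<in> stereographic_charts \<Longrightarrow> img s = UNIV"
  using stereo_N_homeomorphism stereo_S_homeomorphism by (auto simp: stereographic_charts_eq homeomorphism_def)

lemma cinv_stereo: "cinv stereo_N z = unstereo z" "cinv stereo_S z = flip (unstereo z)"
proof -
  have "cinv stereo_N (snd stereo_N (unstereo z)) = unstereo z"
    by (rule chart_inv[OF stereo_is_chart(1)]) (use stereo_N_homeomorphism in \<open>auto simp: homeomorphism_def\<close>)
  then show "cinv stereo_N z = unstereo z" using stereo_N_homeomorphism by (simp add: homeomorphism_def)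
  have "cinv stereo_S (snd stereo_S (flip (unstereo z))) = flip (unstereo z)"
    by (rule chart_inv[OF stereo_is_chart(2)]) (use stereo_S_homeomorphism in \<open>auto simp: homeomorphism_def\<close>)
  then show "cinv stereo_S z = flip (unstereo z)" using stereo_S_homeomorphism by (simp add: homeomorphism_def)
qed

lemma transition_dom_iff: "is_chart M c \<Longrightarrow> x \<in> transition_dom c d \<longleftrightarrow> x \<in> img c \<and> cinv c x \<in> fst d"
  unfolding transition_dom_def by (simp add: rep_dom_iff)

lemma transition_eq: "transition c d x = snd d (cinv c x)"
  by (simp add: transition_def local_rep_def)

lemma stereo_flip:
  "snd stereo_N (flip (unstereo z)) = 1 / z" "flip (unstereo z) \<in> fst stereo_N \<longleftrightarrow> z \<noteq> 0"
proof -
  define r where "r = (cmod z)\<^sup>2"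
  have r: "1 + r > 0" using pos_one_plus[of z] by (simp add: r_def)
  have 1: "1 + (r - 1) / (r + 1) = 2 * r / (1 + r)" using r by (simp add: field_simps)
  have z: "complex_of_real r = z * cnj z" using complex_norm_square[of z] by (simp add: r_def)
  define a where "a = complex_of_real (2 / (1 + r))"
  have a: "a \<noteq> 0" using r by (simp only: a_def of_real_eq_0_iff) simp
  have "1 - snd (flip (unstereo z)) = 2 / (1 + r) * r"
    by (simp add: flip_def unstereo_def r_def[symmetric] 1)
  moreover have "fst (flip (unstereo z)) = a * cnj z"
    by (simp add: flip_def unstereo_def r_def[symmetric] a_def)
  moreover have "snd stereo_N p = fst p / complex_of_real (1 - snd p)" for p
    by (simp add: stereo_N_def case_prod_unfold)
  ultimately have "snd stereo_N (flip (unstereo z)) = a * cnj z / (a * complex_of_real r)"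
    by (simp only: of_real_mult a_def)
  also have "\<dots> = cnj z / complex_of_real r" using a by simp
  \<comment> \<open>At z = 0 both sides are 0 by the convention for division by zero; that point
    lies outside the transition domain by the second claim.\<close>
  also have "\<dots> = 1 / z" unfolding z by (cases "z = 0") auto
  finally show "snd stereo_N (flip (unstereo z)) = 1 / z" .
  have "snd (flip (unstereo z)) \<noteq> 1 \<longleftrightarrow> z \<noteq> 0"
    using r by (auto simp: flip_def unstereo_def r_def[symmetric] field_simps) (simp_all add: r_def)
  then show "flip (unstereo z) \<in> fst stereo_N \<longleftrightarrow> z \<noteq> 0"
    using fst_stereo_N[of "fst (flip (unstereo z))" "snd (flip (unstereo z))"] unstereo_S2[of z] by (simp add: flip_S2)
qed

lemma stereo_transition:
  assumes "s \<in> stereographic_charts" "s' \<in> stereographic_charts" "s \<noteq> s'"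
  shows "transition s s' z = 1 / z" "cinv s z \<in> fst s' \<longleftrightarrow> z \<noteq> 0"
  using assms stereo_flip[of z]
  by (auto simp: stereographic_charts_eq transition_eq cinv_stereo snd_stereo_S fst_stereo_S flip_flip)

text \<open>This puts the stereographic charts under the general change-of-coordinate results, so
  the global argument can be carried out in these two charts alone.\<close>

lemma stereographic_subset: "stereographic_charts \<subseteq> complex_coordinates_S2"
proof
  fix s assume s: "s \<in> stereographic_charts"
  have ch: "is_chart S2 s'" if "s' \<in> stereographic_charts" for s' using that stereo_is_chart by (auto simp: stereographic_charts_eq)
  have "transition s1 s2 holomorphic_on transition_dom s1 s2" if "s1 \<in> stereographic_charts" "s2 \<in> stereographic_charts" for s1 s2
  proof (cases "s1 = s2")
    case True
    have "z = transition s1 s2 z" if "z \<in> transition_dom s1 s2" for z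
    proof -
      have "z \<in> img s1" using that unfolding transition_dom_iff[OF ch[OF \<open>s1 \<in> _\<close>]] by blast
      then show ?thesis using True chart_right_inv[of z s1] by (simp add: transition_eq)
    qed
    with holomorphic_on_ident show ?thesis by (rule holomorphic_transform)
  next
    case False
    have "0 \<notin> transition_dom s1 s2"
      unfolding transition_dom_iff[OF ch[OF that(1)]] stereo_transition(2)[OF that False] by simp
    then have "(\<lambda>z. 1 / z) holomorphic_on transition_dom s1 s2"
      by (intro holomorphic_intros) auto
    then show ?thesis by (rule holomorphic_transform) (simp add: stereo_transition(1)[OF that False])
  qed
  then show "s \<in> complex_coordinates_S2" using s ch by (auto simp: complex_coordinates_S2_def)
qed

lemma stereo_cover: "p \<in> S2 \<Longrightarrow> \<exists>s\<in>stereographic_charts. p \<in> fst s"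
  by (auto simp: stereographic_charts_eq stereo_N_def stereo_S_def)

lemma stereo_other: "s \<in> stereographic_charts \<Longrightarrow> \<exists>s'\<in>stereographic_charts. s \<noteq> s'"
proof -
  have "(0, 1) \<in> S2" by (simp add: S2_iff)
  then have "(0, 1) \<in> fst stereo_S" "(0, 1) \<notin> fst stereo_N" by (simp_all add: stereo_N_def stereo_S_def)
  then have "stereo_N \<noteq> stereo_S" by metis
  then show "s \<in> stereographic_charts \<Longrightarrow> \<exists>s'\<in>stereographic_charts. s \<noteq> s'"
    by (auto simp: stereographic_charts_eq)
qed

section \<open>Jacobi fields along harmonic spheres\<close>

lemma surface_deformation_subset:
  assumes "surface_deformation V G K U F v" "open U0" "U0 \<subseteq> U"
  shows "surface_deformation V G K U0 F v"
proof -
  interpret S: surface_deformation V G K U F v by fact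
  show ?thesis
    by unfold_locales (use assms(2,3) smooth_on_subset[OF S.smooth_F] smooth_on_subset[OF S.smooth_v] S.FV in auto)
qed

locale sphere_jacobi =
  fixes N :: "('n::t2_space, real ^ 'd::finite) riemannian"
    and h :: "(complex \<times> real, complex) chart \<Rightarrow> complex \<Rightarrow> complex \<Rightarrow> complex \<Rightarrow> real"
    and \<phi> :: "complex \<times> real \<Rightarrow> 'n" and v :: "(complex \<times> real, 'n, real ^ 'd) field_along" and K :: real
  assumes N: "compact_riemannian_manifold N"
    and K: "d \<in> charts N \<Longrightarrow> y \<in> img d \<Longrightarrow> u \<noteq> w \<Longrightarrow> independent {u, w} \<Longrightarrow> sectional_curvature (metric N d) y u w = K"
    and h: "is_metric (sphere_with_metric h)" "conformal_metric (sphere_with_metric h)"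
    and harm: "harmonic (sphere_with_metric h) N \<phi>"
    and jac: "jacobi_field (sphere_with_metric h) N \<phi> v"
begin

abbreviation "CC \<equiv> complex_coordinates_S2"
abbreviation "Dm c d \<equiv> rep_dom c d \<phi>"
abbreviation "Fr c d \<equiv> local_rep c d \<phi>"
abbreviation "Vr c d \<equiv> \<lambda>x. cvec (field_rep c d v x)"

lemma chN: "d \<in> charts N \<Longrightarrow> is_chart (pts N) d"
  using N by (simp add: compact_riemannian_manifold_def smooth_manifold_def)

lemma chS: "c \<in> CC \<Longrightarrow> is_chart S2 c"
  by (simp add: complex_coordinates_S2_def)

lemma metric_N: "is_metric N"
  using N by (simp add: compact_riemannian_manifold_def)

lemma cover_N: "q \<in> pts N \<Longrightarrow> \<exists>d\<in>charts N. q \<in> fst d"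
  using N by (auto simp: compact_riemannian_manifold_def smooth_manifold_def)

lemma target_chart: assumes d: "d \<in> charts N" shows "space_form_chart (img d) (metric N d) K"
proof unfold_locales
  show "open (img d)" by (rule chart_open[OF chN[OF d]])
  show "sectional_curvature (metric N d) y u w = K" if "y \<in> img d" "u \<noteq> w" "independent {u, w}" for y u w
    by (rule K[OF d that])
qed (use metric_N d in \<open>auto simp: is_metric_def\<close>)

lemma phi: "continuous_on S2 \<phi>" "\<phi> ` S2 \<subseteq> pts N"
  using harm by (auto simp: harmonic_def smooth_map_def sphere_with_metric_def)

lemma open_Dm: "c \<in> CC \<Longrightarrow> d \<in> charts N \<Longrightarrow> open (Dm c d)"
  by (rule open_rep_dom[OF chS phi chart_openin[OF chN]])

lemma Dm_iff: "c \<in> CC \<Longrightarrow> x \<in> Dm c d \<longleftrightarrow> x \<in> img c \<and> \<phi> (cinv c x) \<in> fst d"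
  by (rule rep_dom_iff[OF chS])

lemma cinv_S2: "c \<in> CC \<Longrightarrow> x \<in> img c \<Longrightarrow> cinv c x \<in> S2"
  by (rule subsetD[OF chart_subset[OF chS] chart_inv_in])

lemma target_map:
  assumes c: "c \<in> CC" and d: "d \<in> charts N"
  shows "space_form_map (img d) (metric N d) K (Dm c d) (Fr c d)"
proof -
  interpret space_form_chart "img d" "metric N d" K by (rule target_chart[OF d])
  show ?thesis
  proof unfold_locales
    show "open (Dm c d)" by (rule open_Dm[OF c d])
    show "smooth_on (Dm c d) (Fr c d)"
      using harm c d by (auto simp: harmonic_def smooth_map_def sphere_with_metric_def)
    show "Fr c d x \<in> img d" if "x \<in> Dm c d" for x
      using that by (simp add: Dm_iff[OF c] local_rep_def)
  qed
qed

lemma smooth_field: "c \<in> CC \<Longrightarrow> d \<in> charts N \<Longrightarrow> smooth_on (Dm c d) (field_rep c d v)"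
  using jac by (auto simp: jacobi_field_def vector_field_along_def sphere_with_metric_def)

lemma sphere_sel: "pts (sphere_with_metric h) = S2" "charts (sphere_with_metric h) = CC" "metric (sphere_with_metric h) = h"
  by (simp_all add: sphere_with_metric_def)

lemma conformal_point:
  assumes "c \<in> CC" "x \<in> img c"
  shows "\<exists>l>0. \<forall>u w. h c x u w = l * (u \<bullet> w)"
  using h(2)[unfolded conformal_metric_def sphere_sel, rule_format, OF assms] by blast

lemma field_change:
  assumes "p \<in> S2" "d \<in> charts N" "d' \<in> charts N" "\<phi> p \<in> fst d" "\<phi> p \<in> fst d'"
  shows "v d' p = fderiv (transition d d') (snd d (\<phi> p)) (v d p)"
  using jac assms unfolding jacobi_field_def vector_field_along_def sphere_sel by blast

lemma domain_christoffel:
  assumes c: "c \<in> CC" and x: "x \<in> img c"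
  shows "bilinear (christoffel (h c) x)" "christoffel (h c) x 1 1 + christoffel (h c) x \<i> \<i> = 0"
proof -
  note o = chart_open[OF chS[OF c]]
  have m: "bilinear (h c y)" "h c y u w = h c y w u" "u \<noteq> 0 \<Longrightarrow> h c y u u > 0" if "y \<in> img c" for y u w
    using h(1) c that by (auto simp: is_metric_def sphere_with_metric_def)
  have s: "smooth_on (img c) (\<lambda>x. h c x u w)" for u w
    using h(1) c by (auto simp: is_metric_def sphere_with_metric_def)
  have "\<exists>!\<Gamma>. levi_civita_at (h c) x \<Gamma>"
    by (rule levi_civita_unique_existence[OF o x m(1) m(2) m(3)[OF x] smooth_on_differentiable[OF s o x]])
  then have lc: "levi_civita_at (h c) x (christoffel (h c) x)"
    unfolding christoffel_def by (rule theI')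
  then show "bilinear (christoffel (h c) x)" by (simp add: levi_civita_at_def)
  have cf: "\<exists>l>0. \<forall>u w. h c y u w = l * (u \<bullet> w)" if "y \<in> img c" for y
    by (rule conformal_point[OF c that])
  show "christoffel (h c) x 1 1 + christoffel (h c) x \<i> \<i> = 0"
    by (rule conformal_christoffel_trace[OF o x cf lc])
qed

text \<open>In a conformal coordinate each trace is a positive multiple of the sum over the
  directions 1 and \<i>, and the domain Christoffel terms cancel in that sum. The conformal factor
  then divides out, and the equations no longer contain the metric of the sphere.\<close>

lemma system:
  assumes c: "c \<in> CC" and d: "d \<in> charts N"
  shows "jacobi_system (img d) (metric N d) K (Dm c d) (Fr c d) (Vr c d)"
proof -
  interpret space_form_map "img d" "metric N d" K "Dm c d" "Fr c d" by (rule target_map[OF c d])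
  interpret surface_deformation "img d" "metric N d" K "Dm c d" "Fr c d" "Vr c d"
    by unfold_locales (rule smooth_on_cvec[OF open_U smooth_field[OF c d]])
  note W = smooth_field[OF c d]
  show ?thesis
  proof unfold_locales
    fix x assume x: "x \<in> Dm c d"
    then have xc: "x \<in> img c" by (simp add: Dm_iff[OF c])
    obtain l where l: "l > 0" "\<And>u w. h c x u w = l * (u \<bullet> w)" using conformal_point[OF c xc] by blast
    note tr = metric_trace_conformal[of "h c x", OF l(2,1)]
    note ch = domain_christoffel[OF c xc]
    note lF = linear_fderiv[OF diff_F[OF x]]
    have "tension (sphere_with_metric h) N \<phi> c d x = 0"
      using harm c d x by (auto simp: harmonic_def sphere_with_metric_def)
    then have "metric_trace (h c x) (\<lambda>u w. cv u (DF w) x - fderiv (Fr c d) x (christoffel (h c) x u w)) = 0"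
      by (simp add: tension_def Let_def sphere_with_metric_def)
    then have "cv 1 (DF 1) x - fderiv (Fr c d) x (christoffel (h c) x 1 1) +
        (cv \<i> (DF \<i>) x - fderiv (Fr c d) x (christoffel (h c) x \<i> \<i>)) = 0"
      unfolding tr[OF bilinear_diff[OF bilinear_cv_DF[OF x] bilinear_linear[OF ch(1) lF]]]
      using l(1) by (simp only: scaleR_eq_0_iff) simp
    then have "(cv 1 (DF 1) x + cv \<i> (DF \<i>) x) - fderiv (Fr c d) x (christoffel (h c) x 1 1 + christoffel (h c) x \<i> \<i>) = 0"
      unfolding linear_add[OF lF] by (simp add: algebra_simps)
    then have "cv 1 (DF 1) x + cv \<i> (DF \<i>) x = 0" unfolding ch(2) linear_0[OF lF] by simp
    then show "cvC zb (DC zd) x = 0" by (rule harmonic_zI[OF x])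
    let ?W = "field_rep c d v"
    let ?R = "\<lambda>u w. curvature \<Gamma> (Fr c d x) (DF u x) (?W x) (DF w x)"
    have lW: "linear (\<lambda>u. cv u ?W x)" by (rule cv_linear[OF x diff[OF W x]])
    have R: "bilinear ?R"
      unfolding bilinear_def linear_iff
      by (simp add: curvature_space_form[OF FV[OF x]] linear_add[OF lF] linear_cmul[OF lF] G_add G_scale FV[OF x] algebra_simps)
    have "jacobi_operator (sphere_with_metric h) N \<phi> v c d x = 0"
      using jac c d x by (auto simp: jacobi_field_def sphere_with_metric_def)
    then have "- metric_trace (h c x) (\<lambda>u w. cv u (cv w ?W) x - cv (christoffel (h c) x u w) ?W x)
        - metric_trace (h c x) ?R = 0"
      by (simp add: jacobi_operator_def rough_laplacian_def Let_def sphere_with_metric_def)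
    then have "(1 / l) *\<^sub>R (cv 1 (cv 1 ?W) x + cv \<i> (cv \<i> ?W) x
        - cv (christoffel (h c) x 1 1 + christoffel (h c) x \<i> \<i>) ?W x + (?R 1 1 + ?R \<i> \<i>)) = 0"
      unfolding tr[OF bilinear_diff[OF bilinear_cv_cv[OF x W] bilinear_linear[OF ch(1) lW]]] tr[OF R] linear_add[OF lW]
      by (simp add: algebra_simps eq_neg_iff_add_eq_0 neg_eq_iff_add_eq_0)
    then have "cv 1 (cv 1 ?W) x + cv \<i> (cv \<i> ?W) x + (?R 1 1 + ?R \<i> \<i>) = 0"
      unfolding ch(2) linear_0[OF lW] using l(1) by simp
    then show "cvC zb (cvC zd (Vr c d)) x +
      of_real K *s (ip x (DC zb x) (DC zd x) *s Vr c d x - ip x (Vr c d x) (DC zd x) *s DC zb x) = 0"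
      by (rule jacobi_zI[OF x W refl])
  qed
qed

section \<open>The pairings as differentials on the sphere\<close>

definition PPr :: "(complex \<times> real, complex) chart \<Rightarrow> ('n, real ^ 'd) chart \<Rightarrow> nat \<Rightarrow> complex \<Rightarrow> (complex ^ 'd) \<times> (complex ^ 'd)" where
  "PPr c d = surface_deformation.PP (metric N d) K (Fr c d) (Vr c d)"

definition EE :: "bool \<Rightarrow> nat \<Rightarrow> nat \<Rightarrow> (complex \<times> real, complex) chart \<Rightarrow> ('n, real ^ 'd) chart \<Rightarrow> complex \<Rightarrow> complex" where
  "EE i a b c d x = deformation.pr (metric N d) (Fr c d) i x (PPr c d a x) (PPr c d b x)"

lemma surface: "c \<in> CC \<Longrightarrow> d \<in> charts N \<Longrightarrow> surface_deformation (img d) (metric N d) K (Dm c d) (Fr c d) (Vr c d)"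
  using system by (simp add: jacobi_system_def)

lemma target_chart_change:
  assumes d: "d \<in> charts N" "d' \<in> charts N"
  shows "chart_change (img d) (metric N d) (img d') (metric N d') (transition_dom d d') (transition d d')"
proof -
  interpret S: space_form_chart "img d" "metric N d" K by (rule target_chart[OF d(1)])
  interpret S': space_form_chart "img d'" "metric N d'" K by (rule target_chart[OF d(2)])
  note ti = transition_dom_iff[OF chN[OF d(1)]]
  show ?thesis
  proof unfold_locales
    show "open (transition_dom d d')"
      unfolding transition_dom_def
      by (rule open_rep_dom[OF chN[OF d(1)] continuous_on_id _ chart_openin[OF chN[OF d(2)]]]) simp
    show "transition_dom d d' \<subseteq> img d" using ti by blast
    show "smooth_on (transition_dom d d') (transition d d')"
      using N d by (simp add: compact_riemannian_manifold_def smooth_manifold_def)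
    show "transition d d' y \<in> img d'" if "y \<in> transition_dom d d'" for y
      using that by (simp add: ti transition_eq)
    show "metric N d y u w = metric N d' (transition d d' y) (fderiv (transition d d') y u) (fderiv (transition d d') y w)"
      if "y \<in> transition_dom d d'" for y u w
      using metric_N d that unfolding is_metric_def Let_def by blast
  qed
qed

text \<open>The two chart expressions are compared on the common domain, where the transition map of
  N is an isometry and the components of v transform by its derivative.\<close>

lemma EE_target:
  assumes c: "c \<in> CC" and d: "d \<in> charts N" "d' \<in> charts N" and x: "x \<in> Dm c d" "x \<in> Dm c d'"
  shows "EE i a b c d' x = EE i a b c d x"
proof -
  let ?U = "Dm c d \<inter> Dm c d'"
  have o: "open ?U" using open_Dm c d by blast
  have S: "surface_deformation (img d) (metric N d) K ?U (Fr c d) (Vr c d)"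
    "surface_deformation (img d') (metric N d') K ?U (Fr c d') (Vr c d')"
    by (rule surface_deformation_subset[OF surface[OF c d(1)] o], simp)
      (rule surface_deformation_subset[OF surface[OF c d(2)] o], simp)
  note C = target_chart_change[OF d]
  interpret C: chart_change "img d" "metric N d" "img d'" "metric N d'" "transition_dom d d'" "transition d d'" by (rule C)
  have FT: "Fr c d x \<in> transition_dom d d'" "Fr c d' x = transition d d' (Fr c d x)" if "x \<in> ?U" for x
    using that chart_inv[OF chN[OF d(1)]]
    by (auto simp: Dm_iff[OF c] transition_dom_iff[OF chN[OF d(1)]] local_rep_def transition_eq)
  have "field_rep c d' v x = fderiv (transition d d') (Fr c d x) (field_rep c d v x)" if "x \<in> ?U" for x
    using that field_change[OF cinv_S2[OF c] d] unfolding Int_iff Dm_iff[OF c] field_rep_def local_rep_def by blast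
  then have v': "Vr c d' x = C.lift (Fr c d x) (Vr c d x)" if "x \<in> ?U" for x
    using that by (intro complex_vec_eqI) (simp_all add: C.lift_def linear_0[OF C.linear_T[OF FT(1)]])
  show ?thesis
    unfolding EE_def PPr_def
    by (rule pr_target_change[OF S C FT v']) (use x in auto)
qed

text \<open>Once all lower levels vanish in the coordinate c, level n transforms as a differential
  of degree n + 2. The sign rule demanded by \<open>pr_domain_change\<close> comes from
  differentiating the vanishing pairings of level n - 1.\<close>

lemma EE_domain:
  assumes c: "c \<in> CC" "c' \<in> CC" and d: "d \<in> charts N"
    and T: "transition c' c holomorphic_on transition_dom c' c"
    and zero: "\<And>a b x. a + b < n \<Longrightarrow> x \<in> Dm c d \<Longrightarrow> EE i a b c d x = 0"
    and x: "x \<in> Dm c' d" "cinv c' x \<in> fst c" and ab: "a + b = n"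
  shows "EE i a b c' d x = deriv (transition c' c) x ^ (n + 2) * EE i a b c d (transition c' c x)"
    and "transition c' c x \<in> Dm c d"
proof -
  let ?T = "transition c' c"
  let ?D = "transition_dom c' c"
  let ?U = "Dm c' d \<inter> ?D"
  interpret S: jacobi_system "img d" "metric N d" K "Dm c d" "Fr c d" "Vr c d" by (rule system[OF c(1) d])
  have oD: "open ?D"
    unfolding transition_dom_def
    by (rule open_rep_dom[OF chS[OF c(2)] continuous_on_id _ chart_openin[OF chS[OF c(1)]]]) simp
  have oU: "open ?U" using oD open_Dm[OF c(2) d] by blast
  have S': "surface_deformation (img d) (metric N d) K ?U (Fr c' d) (Vr c' d)"
    by (rule surface_deformation_subset[OF surface[OF c(2) d] oU]) simp
  have ci: "cinv c (?T x) = cinv c' x" "?T x \<in> img c" if "x \<in> ?D" for x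
    using that chart_inv[OF chS[OF c(1)]] by (auto simp: transition_dom_iff[OF chS[OF c(2)]] transition_eq)
  have TD: "?T x \<in> Dm c d" if "x \<in> ?U" for x
    using that ci[of x] by (simp add: Dm_iff[OF c(1)] Dm_iff[OF c(2)])
  have xU: "x \<in> ?U" using x by (simp add: transition_dom_iff[OF chS[OF c(2)]] Dm_iff[OF c(2)])
  then show "?T x \<in> Dm c d" by (rule TD)
  show "EE i a b c' d x = deriv ?T x ^ (n + 2) * EE i a b c d (?T x)"
    unfolding EE_def PPr_def
  proof (rule pr_domain_change[OF surface[OF c(1) d] S' TD])
    show "(?T has_field_derivative deriv ?T x) (at x)" if "x \<in> ?U" for x
      using holomorphic_derivI[OF T oD] that by blast
    show "smooth_on ?U ?T" by (rule smooth_on_subset[OF holomorphic_smooth_on[OF T oD]]) simp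
    show "Fr c' d x = Fr c d (?T x)" "Vr c' d x = Vr c d (?T x)" if "x \<in> ?U" for x
      using that ci[of x] by (simp_all add: local_rep_def field_rep_def)
    show "S.pr i x (S.PP a x) (S.PP b x) = 0" if "a + b < n" "x \<in> Dm c d" for a b x
      using zero[OF that] by (simp add: EE_def PPr_def)
    show "S.pr i x (S.PP a x) (S.PP (Suc b) x) = - S.pr i x (S.PP (Suc a) x) (S.PP b x)"
      if "Suc (a + b) = n" "x \<in> Dm c d" for a b x
      by (rule S.pr_alternating[OF _ that(2)]) (use zero[of a b] that in \<open>simp add: EE_def PPr_def\<close>)
  qed (use xU ab in auto)
qed

text \<open>Strong induction on the level, simultaneously for both coefficients, both charts and all
  index pairs: holomorphy at level n needs both coefficients below it, and the decay at infinity in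
  one chart is read off from the other.\<close>

lemma EE_stereographic:
  assumes "s \<in> stereographic_charts" "d \<in> charts N" "x \<in> Dm s d" "a + b = n"
  shows "EE i a b s d x = 0"
  using assms
proof (induction n arbitrary: i a b s d x rule: less_induct)
  case (less n)
  have low: "EE i a b s d x = 0" if "a + b < n" "s \<in> stereographic_charts" "d \<in> charts N" "x \<in> Dm s d" for i a b s d x
    using less.IH[OF that(1) that(2-4) refl] .
  note ab = less.prems(4)
  have sC: "s \<in> CC" if "s \<in> stereographic_charts" for s using that stereographic_subset by blast
  \<comment> \<open>One target chart need not contain the image of the sphere, so a chart is chosen
    at every z. By \<open>EE_target\<close> the resulting f does not depend on these choices and is
    defined on the whole plane.\<close>
  define dd where "dd s z = (SOME d. d \<in> charts N \<and> z \<in> Dm s d)" for s and z :: complex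
  have dd: "dd s z \<in> charts N \<and> z \<in> Dm s (dd s z)" if s: "s \<in> stereographic_charts" for s z
  proof -
    have z: "z \<in> img s" using img_stereo[OF s] by simp
    then obtain d where "d \<in> charts N" "\<phi> (cinv s z) \<in> fst d"
      using cover_N phi(2) cinv_S2[OF sC[OF s] z] by blast
    then have "\<exists>d. d \<in> charts N \<and> z \<in> Dm s d" unfolding Dm_iff[OF sC[OF s]] using z by blast
    then show ?thesis unfolding dd_def by (rule someI_ex)
  qed
  define f where "f s z = EE i a b s (dd s z) z" for s z
  have f_eq: "f s z = EE i a b s d z" if "s \<in> stereographic_charts" "d \<in> charts N" "z \<in> Dm s d" for s d z
    unfolding f_def using EE_target[OF sC[OF that(1)] that(2) _ that(3)] dd[OF that(1), of z] by blast
  have holo: "f s holomorphic_on UNIV" if s: "s \<in> stereographic_charts" for s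
  proof (rule cauchy_riemann_holomorphic)
    fix z
    let ?d = "dd s z"
    have d: "?d \<in> charts N" "z \<in> Dm s ?d" using dd[OF s, of z] by auto
    interpret S: jacobi_system "img ?d" "metric N ?d" K "Dm s ?d" "Fr s ?d" "Vr s ?d" by (rule system[OF sC[OF s] d(1)])
    have e: "S.pr i y (S.PP a y) (S.PP b y) = f s y" if "y \<in> Dm s ?d" for y
      using f_eq[OF s d(1) that] by (simp add: EE_def PPr_def)
    have df: "(\<lambda>y. S.pr i y (S.PP a y) (S.PP b y)) differentiable at z"
      by (rule S.diff[OF S.smooth_pr[OF S.psmooth_PP S.psmooth_PP] d(2)])
    show "f s differentiable at z"
      by (rule differentiable_cong[OF S.open_U d(2) _ df]) (rule e)
    have "derivC zb (f s) z = derivC zb (\<lambda>y. S.pr i y (S.PP a y) (S.PP b y)) z"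
      by (rule S.derivC_cong[OF d(2) e[symmetric]])
    also have "\<dots> = 0"
      by (rule S.pr_holomorphic[OF _ d(2), of n])
        (use low[OF _ s d(1)] ab in \<open>auto simp: EE_def PPr_def\<close>)
    finally show "derivC zb (f s) z = 0" .
  qed simp
  have change: "f s z = (- (inverse z)\<^sup>2) ^ (n + 2) * f s' (inverse z)"
    if s: "s \<in> stereographic_charts" "s' \<in> stereographic_charts" "s \<noteq> s'" and z: "z \<noteq> 0" for s s' z
  proof -
    let ?d = "dd s z"
    have d: "?d \<in> charts N" "z \<in> Dm s ?d" using dd[OF s(1), of z] by auto
    have T: "transition s s' = inverse" using stereo_transition(1)[OF s] by (auto simp: inverse_eq_divide)
    have hol: "transition s s' holomorphic_on transition_dom s s'"
      using sC[OF s(1)] s(2) by (simp add: complex_coordinates_S2_def)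
    have zs: "cinv s z \<in> fst s'" using stereo_transition(2)[OF s] z by simp
    have zero: "EE i a b s' ?d x = 0" if "a + b < n" "x \<in> Dm s' ?d" for a b x
      using low[OF that(1) s(2) d(1) that(2)] .
    have "deriv inverse z = - (inverse z)\<^sup>2"
      using DERIV_imp_deriv[OF DERIV_inverse[OF z]] by (simp add: power2_eq_square)
    then show ?thesis
      using EE_domain[OF sC[OF s(2)] sC[OF s(1)] d(1) hol zero d(2) zs ab]
      unfolding T f_eq[OF s(1) d] by (simp add: f_eq[OF s(2) d(1)])
  qed
  \<comment> \<open>The other chart sees infinity as 0, where its function is continuous. The
    positive power of the transition derivative tends to 0, so f tends to 0 at infinity, and
    Liouville's theorem applies.\<close>
  have "f s z = 0" if s: "s \<in> stereographic_charts" for s z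
  proof (rule Liouville_weak_0[OF holo[OF s]])
    obtain s' where s': "s' \<in> stereographic_charts" "s \<noteq> s'" using stereo_other[OF s] by blast
    have "isCont (f s') 0"
      using holomorphic_on_imp_continuous_on[OF holo[OF s'(1)]] by (simp add: continuous_on_eq_continuous_at)
    then have "((\<lambda>z. f s' (inverse z)) \<longlongrightarrow> f s' 0) at_infinity"
      using tendsto_inverse_0 by (rule isCont_tendsto_compose)
    moreover have "((\<lambda>z. (- (inverse z)\<^sup>2) ^ (n + 2)) \<longlongrightarrow> (- (0::complex)\<^sup>2) ^ (n + 2)) at_infinity"
      by (intro tendsto_intros tendsto_inverse_0)
    ultimately have "((\<lambda>z. (- (inverse z)\<^sup>2) ^ (n + 2) * f s' (inverse z)) \<longlongrightarrow> (- 0\<^sup>2) ^ (n + 2) * f s' 0) at_infinity"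
      by (rule tendsto_mult[rotated])
    then have "((\<lambda>z. (- (inverse z)\<^sup>2) ^ (n + 2) * f s' (inverse z)) \<longlongrightarrow> 0) at_infinity" by simp
    then show "(f s \<longlongrightarrow> 0) at_infinity"
      by (rule Lim_transform_eventually)
        (use eventually_not_equal_at_infinity[of 0] change[OF s s'] in \<open>auto elim!: eventually_mono\<close>)
  qed
  then show ?case using f_eq[OF less.prems(1-3)] less.prems(1) by simp
qed

text \<open>Near any point some stereographic chart is available, where every level vanishes; the
  transformation rule then carries the vanishing to the arbitrary coordinate c.\<close>

lemma EE_zero:
  assumes c: "c \<in> CC" and d: "d \<in> charts N" and x: "x \<in> Dm c d"
  shows "EE i a b c d x = 0"
proof -
  have "x \<in> img c" using x by (simp add: Dm_iff[OF c])
  then obtain s where s: "s \<in> stereographic_charts" "cinv c x \<in> fst s" using stereo_cover cinv_S2[OF c] by blast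
  then have sC: "s \<in> CC" using stereographic_subset by blast
  have hol: "transition c s holomorphic_on transition_dom c s"
    using c s(1) by (simp add: complex_coordinates_S2_def)
  have "EE i a b s d y = 0" if "y \<in> Dm s d" for a b y
    by (rule EE_stereographic[OF s(1) d that refl])
  then show ?thesis
    using EE_domain[OF sC c d hol, of "a + b" i x a b] x s(2) by auto
qed

section \<open>Conclusions for the Jacobi field and for its variations\<close>

lemma preserves: "preserves_real_isotropy (sphere_with_metric h) N \<phi> v"
proof -
  have "j_R N \<phi> v r s c d x = 0"
    if r: "r \<ge> 1" "s \<ge> 1" and c: "c \<in> CC" and d: "d \<in> charts N" and x: "x \<in> Dm c d" for r s c d x
  proof -
    interpret S: jacobi_system "img d" "metric N d" K "Dm c d" "Fr c d" "Vr c d" by (rule system[OF c d])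
    have "S.pr i x (S.PP a x) (S.PP b x) = 0" if "x \<in> Dm c d" for i a b x
      using EE_zero[OF c d that] by (simp add: EE_def PPr_def)
    from S.pr_nabla_z[OF this x, of "r - 1" "s - 1"] show ?thesis
      using r by (simp add: j_R_def Let_def)
  qed
  then show ?thesis by (simp add: preserves_real_isotropy_def sphere_with_metric_def)
qed

text \<open>In the product chart \<open>?c\<close> the variation becomes one smooth map
  \<open>\<Theta>\<close> on an open set U of pairs (y, t). Its slice at t = 0 represents \<phi>,
  its t-derivative there represents v, and so the pairings known to vanish are the values and
  t-derivatives of eta.\<close>

lemma first_order:
  assumes var: "smooth_variation (sphere_with_metric h) N \<phi> I \<Phi>" and tan: "tangent_to (sphere_with_metric h) N \<Phi> v"
    and c: "c \<in> CC" and d: "d \<in> charts N" and x: "x \<in> rep_dom c d (\<Phi> 0)"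
  shows "eta N (\<Phi> 0) (Suc a) (Suc b) c d x = 0"
    and "((\<lambda>t. eta N (\<Phi> t) (Suc a) (Suc b) c d x) has_vector_derivative 0) (at 0)"
proof -
  note ci = chS[OF c]
  let ?c = "(fst c \<times> I, \<lambda>(p, t). (snd c p, t))" and ?f = "\<lambda>(p, t). \<Phi> t p"
  have I: "open I" "0 \<in> I" and \<Phi>0: "p \<in> S2 \<Longrightarrow> \<Phi> 0 p = \<phi> p" for p
    using var by (auto simp: smooth_variation_def sphere_sel)
  have sm: "smooth_map (times_interval (sphere_with_metric h) I) N ?f"
    using var by (simp add: smooth_variation_def)
  then have f: "continuous_on (S2 \<times> I) ?f" "?f ` (S2 \<times> I) \<subseteq> pts N"
    by (auto simp: smooth_map_def times_interval_def sphere_sel)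
  have "?c \<in> charts (times_interval (sphere_with_metric h) I)"
    using c by (simp add: times_interval_def sphere_sel)
  then have smr: "smooth_on (rep_dom ?c d ?f) (local_rep ?c d ?f)"
    using sm d unfolding smooth_map_def by blast
  have cinv3: "cinv ?c (y, t) = (cinv c y, t)" if "y \<in> img c" "t \<in> I" for y t
  proof (rule inv_into_f_eq)
    show "inj_on (snd ?c) (fst ?c)"
      by (rule inj_on_inverseI[where g = "\<lambda>(y, t). (cinv c y, t)"]) (auto simp: chart_inv[OF ci])
    show "(cinv c y, t) \<in> fst ?c" "snd ?c (cinv c y, t) = (y, t)"
      using that by (simp_all add: chart_inv_in chart_right_inv)
  qed
  have img3: "snd ?c ` fst ?c = img c \<times> I" by auto
  define U where "U = {(y, t). y \<in> img c \<and> t \<in> I \<and> \<Phi> t (cinv c y) \<in> fst d}"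
  define \<Theta> where "\<Theta> q = snd d (\<Phi> (snd q) (cinv c (fst q)))" for q
  have rep: "rep_dom ?c d ?f = U"
  proof -
    have "(y, t) \<in> rep_dom ?c d ?f \<longleftrightarrow> (y, t) \<in> U" for y t
    proof
      assume "(y, t) \<in> U"
      then have "(cinv c y, t) \<in> fst ?c" "?f (cinv c y, t) \<in> fst d" "snd ?c (cinv c y, t) = (y, t)"
        by (simp_all add: U_def chart_inv_in chart_right_inv)
      then show "(y, t) \<in> rep_dom ?c d ?f" unfolding rep_dom_def by (intro image_eqI[of _ _ "(cinv c y, t)"]) simp_all
    qed (auto simp: rep_dom_def U_def chart_inv[OF ci])
    then show ?thesis by auto
  qed
  obtain T where T: "open T" "fst d = pts N \<inter> T" using chart_openin[OF chN[OF d]] by (auto simp: openin_open)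
  have open_U: "open U"
  proof -
    have "continuous_on (img c \<times> I) (\<lambda>q. (cinv c (fst q), snd q))"
      by (intro continuous_intros continuous_on_compose2[OF chart_continuous_inv[OF ci]]) auto
    from continuous_on_compose2[OF f(1) this]
    have "continuous_on (img c \<times> I) (\<lambda>q. ?f (cinv c (fst q), snd q))" using cinv_S2[OF c] by force
    from continuous_open_preimage[OF this open_Times[OF chart_open[OF ci] I(1)] T(1)]
    have "open ((img c \<times> I) \<inter> (\<lambda>q. ?f (cinv c (fst q), snd q)) -` T)" .
    moreover have "(img c \<times> I) \<inter> (\<lambda>q. ?f (cinv c (fst q), snd q)) -` T = U"
    proof -
      have "\<Phi> t (cinv c y) \<in> pts N" if "y \<in> img c" "t \<in> I" for y t
        using f(2) cinv_S2[OF c that(1)] that(2) by auto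
      then show ?thesis by (auto simp: U_def T(2))
    qed
    ultimately show ?thesis by simp
  qed
  interpret space_form_chart "img d" "metric N d" K by (rule target_chart[OF d])
  interpret V: variation_in_chart "img d" "metric N d" K U \<Theta>
  proof unfold_locales
    show "open U" by (rule open_U)
    show "smooth_on U \<Theta>"
    proof (rule smooth_on_cong[OF open_U _ smr[unfolded rep]])
      fix q assume "q \<in> U"
      then have q: "fst q \<in> img c" "snd q \<in> I" by (simp_all add: U_def case_prod_unfold)
      have "local_rep ?c d ?f q = local_rep ?c d ?f (fst q, snd q)" by simp
      also have "\<dots> = \<Theta> q" unfolding local_rep_def cinv3[OF q] by (simp add: \<Theta>_def)
      finally show "local_rep ?c d ?f q = \<Theta> q" .
    qed
    show "\<Theta> q \<in> img d" if "q \<in> U" for q using that by (auto simp: U_def \<Theta>_def)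
  qed
  have slice: "(\<lambda>y. \<Theta> (y, t)) = local_rep c d (\<Phi> t)" for t by (rule ext) (simp add: \<Theta>_def local_rep_def)
  have U0: "(y, 0) \<in> U \<longleftrightarrow> y \<in> Dm c d" for y
  proof (cases "y \<in> img c")
    case True
    then show ?thesis using \<Phi>0[OF cinv_S2[OF c True]] I(2) by (simp add: U_def Dm_iff[OF c])
  next
    case False
    then show ?thesis by (simp add: U_def Dm_iff[OF c])
  qed
  have x0: "(x, 0) \<in> U" using x I(2) by (simp add: U_def rep_dom_iff[OF ci])
  have eta: "eta N (\<Phi> t) (Suc a) (Suc b) c d x = V.ip (x, t) (V.\<Psi> a (x, t)) (V.\<Psi> b (x, t))" if "(x, t) \<in> U" for t
    using V.nabla_z_slice[OF that, of a] V.nabla_z_slice[OF that, of b] unfolding slice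
    by (simp add: eta_def Let_def \<Theta>_def local_rep_def)
  \<comment> \<open>Tangency enters here. The second direction in \<open>t3\<close> is zero, so the
    complexified t-derivative is a real vector, as is v.\<close>
  have v: "V.DC t3 (y, 0) = Vr c d y" if "(y, 0) \<in> U" for y
  proof -
    have y: "y \<in> img c" "\<Phi> 0 (cinv c y) \<in> fst d" using that by (simp_all add: U_def)
    note dT = V.diff_F[OF that]
    have "((\<lambda>t. (y, t)) has_derivative (\<lambda>r. (0, r))) (at 0)"
      by (intro has_derivative_Pair has_derivative_ident has_derivative_const)
    from has_derivative_compose[OF this has_fderiv[OF dT]]
    have "((\<lambda>t. \<Theta> (y, t)) has_derivative (\<lambda>r. fderiv \<Theta> (y, 0) (0, r))) (at 0)" .
    moreover have "(\<lambda>r. fderiv \<Theta> (y, 0) (0, r)) = (\<lambda>r. r *\<^sub>R fderiv \<Theta> (y, 0) (0, 1))"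
    proof
      show "fderiv \<Theta> (y, 0) (0, r) = r *\<^sub>R fderiv \<Theta> (y, 0) (0, 1)" for r
        using linear_cmul[OF linear_fderiv[OF dT], of r "(0, 1)"] by simp
    qed
    ultimately have "((\<lambda>t. \<Theta> (y, t)) has_vector_derivative fderiv \<Theta> (y, 0) (0, 1)) (at 0)"
      by (simp only: has_vector_derivative_def)
    then have "vector_derivative (\<lambda>t. snd d (\<Phi> t (cinv c y))) (at 0) = fderiv \<Theta> (y, 0) (0, 1)"
      unfolding \<Theta>_def fst_conv snd_conv by (rule vector_derivative_at)
    moreover have "v d (cinv c y) = vector_derivative (\<lambda>t. snd d (\<Phi> t (cinv c y))) (at 0)"
      using tan cinv_S2[OF c y(1)] d y(2) unfolding tangent_to_def sphere_sel by blast
    ultimately show ?thesis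
      using linear_0[OF linear_fderiv[OF dT]]
      by (intro complex_vec_eqI) (simp_all add: partC_def field_rep_def zero_prod_def)
  qed
  have zero: "deformation.pr (metric N d) (\<lambda>y. \<Theta> (y, 0)) i x
      (surface_deformation.PP (metric N d) K (\<lambda>y. \<Theta> (y, 0)) (\<lambda>y. V.DC t3 (y, 0)) a x)
      (surface_deformation.PP (metric N d) K (\<lambda>y. \<Theta> (y, 0)) (\<lambda>y. V.DC t3 (y, 0)) b x) = 0" for i
  proof -
    note S = surface[OF c d]
    have E: "deformation.pr (metric N d) (Fr c d) i y (surface_deformation.PP (metric N d) K (Fr c d) (Vr c d) a y)
        (surface_deformation.PP (metric N d) K (Fr c d) (Vr c d) b y) = 0" if "y \<in> Dm c d" for a b y
      using EE_zero[OF c d that] by (simp add: EE_def PPr_def)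
    have S': "surface_deformation (img d) (metric N d) K (V.slice 0) (\<lambda>y. \<Theta> (y, 0)) (\<lambda>y. V.DC t3 (y, 0))"
      by (rule V.slice_deformation[OF V.smooth_slice[OF V.smooth_DC]])
    have "deformation.pr (metric N d) (\<lambda>y. \<Theta> (y, 0)) i x
      (surface_deformation.PP (metric N d) K (\<lambda>y. \<Theta> (y, 0)) (\<lambda>y. V.DC t3 (y, 0)) a x)
      (surface_deformation.PP (metric N d) K (\<lambda>y. \<Theta> (y, 0)) (\<lambda>y. V.DC t3 (y, 0)) b x) =
      1 ^ (a + b + 2) * deformation.pr (metric N d) (Fr c d) i x (surface_deformation.PP (metric N d) K (Fr c d) (Vr c d) a x)
        (surface_deformation.PP (metric N d) K (Fr c d) (Vr c d) b x)"
    \<comment> \<open>The slice fields agree with \<open>Fr\<close> and \<open>Vr\<close> only on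
      the slice, so the iterated derivatives are compared by a coordinate change that is the
      identity with Jacobian 1.\<close>
    proof (rule pr_domain_change[OF S S', where T = "\<lambda>y. y" and g = "\<lambda>_. 1" and n = "a + b"])
      show "y \<in> Dm c d" if "y \<in> V.slice 0" for y using that U0 by simp
      show "((\<lambda>y. y) has_field_derivative 1) (at y)" for y by (rule DERIV_ident)
      show "smooth_on (V.slice 0) (\<lambda>y. y)" by (rule smooth_on_linear[OF bounded_linear_ident V.open_slice])
      show "\<Theta> (y, 0) = Fr c d y" if "y \<in> V.slice 0" for y
      proof -
        have "y \<in> img c" using that by (simp add: U_def)
        then show ?thesis by (simp add: \<Theta>_def local_rep_def \<Phi>0[OF cinv_S2[OF c]])
      qed
      show "V.DC t3 (y, 0) = Vr c d y" if "y \<in> V.slice 0" for y using that v by simp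
      show "x \<in> V.slice 0" using x0 by simp
    qed (simp_all add: E)
    then show ?thesis using E x0 U0 by simp
  qed
  interpret S: surface_deformation "img d" "metric N d" K "V.slice 0" "\<lambda>y. \<Theta> (y, 0)" "\<lambda>y. V.DC t3 (y, 0)"
    by (rule V.slice_deformation[OF V.smooth_slice[OF V.smooth_DC]])
  show "eta N (\<Phi> 0) (Suc a) (Suc b) c d x = 0"
    using zero[of False] unfolding eta[OF x0] V.PP_slice[OF x0] S.pr_def by simp
  have "((\<lambda>t. V.ip (x, t) (V.\<Psi> a (x, t)) (V.\<Psi> b (x, t))) has_vector_derivative 0) (at 0)"
    by (rule V.eta_derivative[OF x0 zero])
  \<comment> \<open>The chart formula for eta is available only while the moving point stays in the
    chart d; openness makes this a neighbourhood of t = 0, enough for a derivative.\<close>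
  moreover have "open {t. (x, t) \<in> U}"
  proof -
    have "open ((\<lambda>t. (x, t)) -` U)" by (rule open_vimage[OF open_U]) (intro continuous_intros)
    then show ?thesis by (simp add: vimage_def)
  qed
  ultimately show "((\<lambda>t. eta N (\<Phi> t) (Suc a) (Suc b) c d x) has_vector_derivative 0) (at 0)"
    by (rule has_vector_derivative_transform_within_open) (use x0 eta in auto)
qed

lemma variation_isotropic:
  assumes "smooth_variation (sphere_with_metric h) N \<phi> I \<Phi>" "tangent_to (sphere_with_metric h) N \<Phi> v"
  shows "real_isotropic_to_first_order (sphere_with_metric h) N \<Phi>"
  unfolding real_isotropic_to_first_order_def sphere_sel
proof (intro allI impI ballI)
  fix r s :: nat and c d x
  assume r: "1 \<le> r" "1 \<le> s" and cd: "c \<in> CC" "d \<in> charts N" "x \<in> rep_dom c d (\<Phi> 0)"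
  have "Suc (r - 1) = r" "Suc (s - 1) = s" using r by auto
  with first_order[OF assms cd, of "r - 1" "s - 1"]
  show "eta N (\<Phi> 0) r s c d x = 0 \<and> ((\<lambda>t. eta N (\<Phi> t) r s c d x) has_vector_derivative 0) (at 0)" by simp
qed

end

theorem proposition3p4:
  fixes N :: "('n::t2_space, real ^ 'd::finite) riemannian"
    and h :: "(complex \<times> real, complex) chart \<Rightarrow> complex \<Rightarrow> complex \<Rightarrow> complex \<Rightarrow> real"
    and \<phi> :: "complex \<times> real \<Rightarrow> 'n"
  assumes "compact_riemannian_manifold N" and "constant_curvature N"
    and "is_metric (sphere_with_metric h)" and "conformal_metric (sphere_with_metric h)"
    and "harmonic (sphere_with_metric h) N \<phi>"
  shows "(\<forall>v. jacobi_field (sphere_with_metric h) N \<phi> v \<longrightarrow>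
            preserves_real_isotropy (sphere_with_metric h) N \<phi> v) \<and>
         (\<forall>v I \<Phi>. jacobi_field (sphere_with_metric h) N \<phi> v \<longrightarrow>
            smooth_variation (sphere_with_metric h) N \<phi> I \<Phi> \<longrightarrow>
            tangent_to (sphere_with_metric h) N \<Phi> v \<longrightarrow>
            real_isotropic_to_first_order (sphere_with_metric h) N \<Phi>)"
proof -
  from assms(2) obtain K where K: "\<forall>d\<in>charts N. \<forall>y\<in>snd d ` fst d. \<forall>u w.
      u \<noteq> w \<and> independent {u, w} \<longrightarrow> sectional_curvature (metric N d) y u w = K"
    unfolding constant_curvature_def by (rule exE)
  have "sphere_jacobi N h \<phi> v K" if "jacobi_field (sphere_with_metric h) N \<phi> v" for v
  proof
    show "sectional_curvature (metric N d) y u w = K"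
      if "d \<in> charts N" "y \<in> img d" "u \<noteq> w" "independent {u, w}" for d y u w
      using K[rule_format, OF that(1,2)] that(3,4) by blast
  qed (fact assms that)+
  then show ?thesis
    by (auto intro: sphere_jacobi.preserves sphere_jacobi.variation_isotropic)
qed

end
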